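(* Let $\lambda_A=1$ and $\lambda_B=0$. There are positive absolute constants $c$, $C$ and $\eta$ such that for all $d\ge 2$ and all $\frac12-\eta<p<\frac12$, for DLAS on the bidirected $2d$-regular tree $\vec{\mathcal T}_{2d}$, $$c\log\big((1-2p)^{-1}\big)\le \mathbb{E}_pV_\infty\le C\log\big((1-2p)^{-1}\big).$$
   Context: The bidirected $2d$-regular tree $\vec{\mathcal T}_{2d}$ is the infinite $2d$-regular tree, with a distinguished root, whose edges are oriented so that each vertex has $d$ edges directed away from it and $d$ edges directed towards it. A random walk on it moves, at each jump, along one of the $d$ out-edges of its current vertex, each with probability $1/d$. DLAS (two-type diffusion-limited annihilating system) on a graph with vertex set $\mathcal V$ and jump rates $\lambda_A,\lambda_B\ge 0$ is a continuous-time Markov process $\zeta_t=(\zeta_t(v))_{v\in\mathcal V}$ on $\mathbb{Z}^{\mathcal V}$: $|\zeta_t(v)|$ is the number of particles at $v$ at time $t$, and these are all of type $A$ if $\zeta_t(v)>0$ and all of type $B$ if $\zeta_t(v)<0$. Particles perform independent continuous-time random walks (on $\vec{\mathcal T}_{2d}$, each jump is along one of the $d$ out-edges of the particle's current vertex, each chosen with probability $1/d$), $A$-particles jumping at rate $\lambda_A$ and $B$-particles at rate $\lambda_B$ (so $B$-particles do not move if $\lambda_B=0$). When a particle jumps onto a site containing a particle of the opposite type, it and one such particle are instantly both removed. Any number of particles of the same type may share a site. Initially each vertex contains exactly one particle, which independently is of type $A$ with probability $p$ and of type $B$ with probability $1-p$; $\mathbb{E}_p$ denotes expectation for this $p$.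 Let $N_t$ be the number of $A$-particles at the root at time $t$ and $V_t=\int_0^tN_s\,ds$ for $0\le t\le\infty$. *)

theory Defs
  imports "HOL-Probability.Probability"
begin

text \<open>
  Simple undirected graphs are given by a vertex set and a symmetric relation; a directed graph
  with arc set \<open>E\<close> has underlying undirected graph \<open>E \<union> E\<inverse>\<close>.
\<close>

definition connected_graph :: "'v set \<Rightarrow> ('v \<times> 'v) set \<Rightarrow> bool" where
  "connected_graph V A \<longleftrightarrow> (\<forall>u\<in>V. \<forall>v\<in>V. (u, v) \<in> A\<^sup>*)"

definition acyclic_graph :: "('v \<times> 'v) set \<Rightarrow> bool" where
  "acyclic_graph A \<longleftrightarrow>
     \<not> (\<exists>n c. 3 \<le> n \<and> inj_on c {..<n} \<and> (\<forall>i<n. (c i, c (Suc i mod n)) \<in> A))"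

definition bidirected_regular_tree :: "nat \<Rightarrow> 'v set \<Rightarrow> ('v \<times> 'v) set \<Rightarrow> bool" where
  "bidirected_regular_tree d V E \<longleftrightarrow>
     V \<noteq> {} \<and> E \<subseteq> V \<times> V \<and> E \<inter> E\<inverse> = {} \<and>
     connected_graph V (E \<union> E\<inverse>) \<and> acyclic_graph (E \<union> E\<inverse>) \<and>
     (\<forall>v\<in>V. finite (E `` {v}) \<and> card (E `` {v}) = d \<and>
            finite (E\<inverse> `` {v}) \<and> card (E\<inverse> `` {v}) = d)"

text \<open>
  The bidirected tree is realised as the Cayley graph of the free group on \<open>d\<close> generators: vertices
  are reduced words, stored with the last letter first; the letter \<open>(i, True)\<close> is the \<open>i\<close>-th
  generator, \<open>(i, False)\<close> its inverse, and the \<open>i\<close>-th out-edge multiplies by the \<open>i\<close>-th generator.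
  The root is the empty word. Lemma \<open>bidirected_regular_tree_bt\<close> below shows that this is a
  bidirected \<open>2d\<close>-regular tree.
\<close>

type_synonym vertex = "(nat \<times> bool) list"

definition bt_verts :: "nat \<Rightarrow> vertex set" where
  "bt_verts d = {w. (\<forall>x\<in>set w. fst x < d) \<and>
                    successively (\<lambda>x y. fst x = fst y \<longrightarrow> snd x = snd y) w}"

definition bt_out :: "vertex \<Rightarrow> nat \<Rightarrow> vertex" where
  "bt_out w i = (if w \<noteq> [] \<and> hd w = (i, False) then tl w else (i, True) # w)"

definition bt_arcs :: "nat \<Rightarrow> (vertex \<times> vertex) set" where
  "bt_arcs d = {(w, bt_out w i) |w i. w \<in> bt_verts d \<and> i < d}"

abbreviation bt_root :: vertex where
  "bt_root \<equiv> []"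

text \<open>
  Each vertex \<open>v\<close> is the starting point of exactly one particle, which is identified with \<open>v\<close>. It
  carries a tuple \<open>(a, g, s, m)\<close>: \<open>a\<close> says whether it is of type \<open>A\<close>; \<open>g\<close> is the sequence of
  i.i.d. Exp(1) gaps of a unit rate clock, which is run at speed \<open>\<lambda>\<^sub>A\<close> or \<open>\<lambda>\<^sub>B\<close>; \<open>s n\<close> is the index
  of the out-edge used at the \<open>n\<close>-th jump; and \<open>m\<close> is a uniform mark that is only used to select
  which particle is removed when a jump lands on a site containing several particles of the
  opposite type (the law of the particle counts does not depend on this selection rule).
\<close>

type_synonym particle = "bool \<times> (nat \<Rightarrow> real) \<times> (nat \<Rightarrow> nat) \<times> real"

definition is_A :: "particle \<Rightarrow> bool" where
  "is_A x = fst x"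

definition gap :: "particle \<Rightarrow> nat \<Rightarrow> real" where
  "gap x = fst (snd x)"

definition step :: "particle \<Rightarrow> nat \<Rightarrow> nat" where
  "step x = fst (snd (snd x))"

definition mark :: "particle \<Rightarrow> real" where
  "mark x = snd (snd (snd x))"

definition particle_measure :: "nat \<Rightarrow> real \<Rightarrow> particle measure" where
  "particle_measure d p =
     measure_pmf (bernoulli_pmf p)
     \<Otimes>\<^sub>M (\<Pi>\<^sub>M n\<in>UNIV. density lborel (exponential_density 1))
     \<Otimes>\<^sub>M (\<Pi>\<^sub>M n\<in>UNIV. measure_pmf (pmf_of_set {..<d}))
     \<Otimes>\<^sub>M uniform_measure lborel {0..1}"

text \<open>The graph enters via its vertex set and, for each vertex \<open>v\<close>, its out-edges
  \<open>out v 0, \<dots>, out v (d - 1)\<close>.\<close>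

definition dlas_measure :: "nat \<Rightarrow> 'v set \<Rightarrow> real \<Rightarrow> ('v \<Rightarrow> particle) measure" where
  "dlas_measure d V p = (\<Pi>\<^sub>M v\<in>V. particle_measure d p)"

primrec walk :: "('v \<Rightarrow> nat \<Rightarrow> 'v) \<Rightarrow> 'v \<Rightarrow> (nat \<Rightarrow> nat) \<Rightarrow> nat \<Rightarrow> 'v" where
  "walk out v s 0 = v"
| "walk out v s (Suc n) = out (walk out v s n) (s n)"

definition jump_rate :: "real \<Rightarrow> real \<Rightarrow> particle \<Rightarrow> real" where
  "jump_rate lamA lamB x = (if is_A x then lamA else lamB)"

text \<open>The clock of a particle with gaps \<open>g\<close> and rate \<open>\<lambda>\<close> rings at the times \<open>t\<close> at which
  \<open>\<lambda> t\<close> equals a partial sum of \<open>g\<close>; almost surely this never happens if \<open>\<lambda> = 0\<close>.\<close>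

definition jumps_at :: "real \<Rightarrow> real \<Rightarrow> particle \<Rightarrow> real \<Rightarrow> bool" where
  "jumps_at lamA lamB x t \<longleftrightarrow> (\<exists>n. (\<Sum>k\<le>n. gap x k) = jump_rate lamA lamB x * t)"

definition num_jumps :: "real \<Rightarrow> real \<Rightarrow> particle \<Rightarrow> real \<Rightarrow> nat" where
  "num_jumps lamA lamB x t = card {n. (\<Sum>k\<le>n. gap x k) \<le> jump_rate lamA lamB x * t}"

text \<open>Position at time \<open>t\<close> of the particle started at \<open>v\<close>, disregarding its possible removal.\<close>

definition position ::
    "('v \<Rightarrow> nat \<Rightarrow> 'v) \<Rightarrow> real \<Rightarrow> real \<Rightarrow> ('v \<Rightarrow> particle) \<Rightarrow> 'v \<Rightarrow> real \<Rightarrow> 'v" where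
  "position out lamA lamB \<omega> v t =
     walk out v (step (\<omega> v)) (num_jumps lamA lamB (\<omega> v) t)"

text \<open>
  In the following, \<open>\<tau> v \<in> (0, \<infinity>]\<close> is the time at which the particle started at \<open>v\<close> is removed, so
  that it is present at time \<open>t\<close> iff \<open>t < \<tau> v\<close>, and present immediately before time \<open>t\<close> iff
  \<open>t \<le> \<tau> v\<close>. The set \<open>opponents\<close> consists of the particles of opposite type on the site that the
  particle \<open>u\<close> occupies after its jump at time \<open>t\<close>. (As almost surely no two particles
  jump simultaneously, their positions immediately before and at time \<open>t\<close> agree.)
\<close>

definition opponents ::
    "'v set \<Rightarrow> ('v \<Rightarrow> nat \<Rightarrow> 'v) \<Rightarrow> real \<Rightarrow> real \<Rightarrow> ('v \<Rightarrow> particle) \<Rightarrow> ('v \<Rightarrow> ereal) \<Rightarrow>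
     'v \<Rightarrow> real \<Rightarrow> 'v set" where
  "opponents V out lamA lamB \<omega> \<tau> u t =
     {v \<in> V. is_A (\<omega> v) \<noteq> is_A (\<omega> u) \<and> ereal t \<le> \<tau> v \<and>
             position out lamA lamB \<omega> v t = position out lamA lamB \<omega> u t}"

text \<open>The particle \<open>u\<close> jumps at time \<open>t\<close> and annihilates with \<open>v\<close>.\<close>

definition annihilates ::
    "'v set \<Rightarrow> ('v \<Rightarrow> nat \<Rightarrow> 'v) \<Rightarrow> real \<Rightarrow> real \<Rightarrow> ('v \<Rightarrow> particle) \<Rightarrow> ('v \<Rightarrow> ereal) \<Rightarrow>
     'v \<Rightarrow> 'v \<Rightarrow> real \<Rightarrow> bool" where
  "annihilates V out lamA lamB \<omega> \<tau> u v t \<longleftrightarrow>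
     u \<in> V \<and> ereal t \<le> \<tau> u \<and> jumps_at lamA lamB (\<omega> u) t \<and>
     is_arg_min (\<lambda>w. mark (\<omega> w)) (\<lambda>w. w \<in> opponents V out lamA lamB \<omega> \<tau> u t) v"

definition dlas_dynamics ::
    "'v set \<Rightarrow> ('v \<Rightarrow> nat \<Rightarrow> 'v) \<Rightarrow> real \<Rightarrow> real \<Rightarrow> ('v \<Rightarrow> particle) \<Rightarrow> ('v \<Rightarrow> ereal) \<Rightarrow> bool" where
  "dlas_dynamics V out lamA lamB \<omega> \<tau> \<longleftrightarrow>
     (\<forall>v. 0 < \<tau> v) \<and>
     (\<forall>v t. \<tau> v = ereal t \<longleftrightarrow>
        (\<exists>u. annihilates V out lamA lamB \<omega> \<tau> u v t \<or> annihilates V out lamA lamB \<omega> \<tau> v u t))"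

text \<open>
  On graphs whose in-degrees and out-degrees all equal \<open>d \<ge> 1\<close>, for almost every \<open>\<omega>\<close> the dynamics
  has exactly one solution \<open>\<tau>\<close>: in a short time interval the sites split into finite clusters that
  do not interact, and one iterates over such intervals. So the description below is proper almost
  surely, and its value on the exceptional null set does not affect any integral.
\<close>

definition removal_time ::
    "'v set \<Rightarrow> ('v \<Rightarrow> nat \<Rightarrow> 'v) \<Rightarrow> real \<Rightarrow> real \<Rightarrow> ('v \<Rightarrow> particle) \<Rightarrow> 'v \<Rightarrow> ereal" where
  "removal_time V out lamA lamB \<omega> = (THE \<tau>. dlas_dynamics V out lamA lamB \<omega> \<tau>)"

definition present ::
    "'v set \<Rightarrow> ('v \<Rightarrow> nat \<Rightarrow> 'v) \<Rightarrow> real \<Rightarrow> real \<Rightarrow> ('v \<Rightarrow> particle) \<Rightarrow> real \<Rightarrow> 'v \<Rightarrow> 'v set" where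
  "present V out lamA lamB \<omega> t v =
     {u \<in> V. ereal t < removal_time V out lamA lamB \<omega> u \<and> position out lamA lamB \<omega> u t = v}"

definition zeta ::
    "'v set \<Rightarrow> ('v \<Rightarrow> nat \<Rightarrow> 'v) \<Rightarrow> real \<Rightarrow> real \<Rightarrow> ('v \<Rightarrow> particle) \<Rightarrow> real \<Rightarrow> 'v \<Rightarrow> int" where
  "zeta V out lamA lamB \<omega> t v =
     int (card {u \<in> present V out lamA lamB \<omega> t v. is_A (\<omega> u)}) -
     int (card {u \<in> present V out lamA lamB \<omega> t v. \<not> is_A (\<omega> u)})"

definition num_A ::
    "'v set \<Rightarrow> ('v \<Rightarrow> nat \<Rightarrow> 'v) \<Rightarrow> real \<Rightarrow> real \<Rightarrow> 'v \<Rightarrow> ('v \<Rightarrow> particle) \<Rightarrow> real \<Rightarrow> nat" where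
  "num_A V out lamA lamB \<rho> \<omega> t = nat (zeta V out lamA lamB \<omega> t \<rho>)"

definition occupation_time ::
    "'v set \<Rightarrow> ('v \<Rightarrow> nat \<Rightarrow> 'v) \<Rightarrow> real \<Rightarrow> real \<Rightarrow> 'v \<Rightarrow> ereal \<Rightarrow> ('v \<Rightarrow> particle) \<Rightarrow> ennreal" where
  "occupation_time V out lamA lamB \<rho> t \<omega> =
     (\<integral>\<^sup>+ s\<in>{s. 0 \<le> s \<and> ereal s \<le> t}. of_nat (num_A V out lamA lamB \<rho> \<omega> s) \<partial>lborel)"

lemma prob_space_particle_measure: "prob_space (particle_measure d p)"
proof -
  have 1: "prob_space (\<Pi>\<^sub>M n\<in>(UNIV::nat set). density lborel (exponential_density 1))"
    by (intro prob_space_PiM prob_space_exponential_density) simp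
  have 2: "prob_space (\<Pi>\<^sub>M n\<in>(UNIV::nat set). measure_pmf (pmf_of_set {..<d}))"
    by (intro prob_space_PiM prob_space_measure_pmf)
  have 3: "prob_space (uniform_measure lborel {0..1::real})"
    by (intro prob_space_uniform_measure) auto
  show ?thesis
    unfolding particle_measure_def
    by (intro prob_space_pair prob_space_measure_pmf 1 2 3)
qed

lemma prob_space_dlas_measure: "prob_space (dlas_measure d V p)"
  unfolding dlas_measure_def by (intro prob_space_PiM prob_space_particle_measure)

definition bt_in :: "vertex \<Rightarrow> nat \<Rightarrow> vertex" where
  "bt_in w i = (if w \<noteq> [] \<and> hd w = (i, True) then tl w else (i, False) # w)"

lemma bt_out_in_verts: "w \<in> bt_verts d \<Longrightarrow> i < d \<Longrightarrow> bt_out w i \<in> bt_verts d"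
  by (cases w) (auto simp: bt_verts_def bt_out_def successively_Cons)

lemma bt_in_in_verts: "w \<in> bt_verts d \<Longrightarrow> i < d \<Longrightarrow> bt_in w i \<in> bt_verts d"
  by (cases w) (auto simp: bt_verts_def bt_in_def successively_Cons)

lemma bt_out_in: "w \<in> bt_verts d \<Longrightarrow> bt_out (bt_in w i) i = w"
  by (cases w; cases "tl w") (auto simp: bt_verts_def bt_in_def bt_out_def)

lemma bt_in_out: "w \<in> bt_verts d \<Longrightarrow> bt_in (bt_out w i) i = w"
  by (cases w; cases "tl w") (auto simp: bt_verts_def bt_in_def bt_out_def)

lemma inj_on_bt_out: "inj_on (bt_out w) {..<d}"
proof (rule inj_onI)
  fix i j assume "bt_out w i = bt_out w j"
  then show "i = j" by (cases w) (auto simp: bt_out_def split: if_splits dest: arg_cong[of _ _ length])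
qed

lemma inj_on_bt_in: "inj_on (bt_in w) {..<d}"
proof (rule inj_onI)
  fix i j assume "bt_in w i = bt_in w j"
  then show "i = j" by (cases w) (auto simp: bt_in_def split: if_splits dest: arg_cong[of _ _ length])
qed

lemma bt_out_image: "w \<in> bt_verts d \<Longrightarrow> bt_arcs d `` {w} = bt_out w ` {..<d}"
  by (auto simp: bt_arcs_def)

lemma bt_in_image:
  assumes "w \<in> bt_verts d"
  shows "(bt_arcs d)\<inverse> `` {w} = bt_in w ` {..<d}"
proof (intro equalityI subsetI)
  fix u assume "u \<in> (bt_arcs d)\<inverse> `` {w}"
  then obtain i where "u \<in> bt_verts d" "i < d" "w = bt_out u i"
    by (auto simp: bt_arcs_def)
  then show "u \<in> bt_in w ` {..<d}"
    using bt_in_out[of u d i] by (intro image_eqI[where x = i]) simp_all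
next
  fix u assume "u \<in> bt_in w ` {..<d}"
  then obtain i where i: "i < d" "u = bt_in w i" by auto
  then have "(u, bt_out u i) \<in> bt_arcs d"
    using bt_in_in_verts[OF assms] by (auto simp: bt_arcs_def)
  then show "u \<in> (bt_arcs d)\<inverse> `` {w}"
    using bt_out_in[OF assms] i by auto
qed

lemma bt_adj_tl:
  "(u, v) \<in> bt_arcs d \<union> (bt_arcs d)\<inverse> \<Longrightarrow> (u \<noteq> [] \<and> v = tl u) \<or> (v \<noteq> [] \<and> u = tl v)"
  by (auto simp: bt_arcs_def bt_out_def split: if_splits)

lemma bt_adj_Cons:
  assumes "x # w \<in> bt_verts d"
  shows "(x # w, w) \<in> bt_arcs d \<union> (bt_arcs d)\<inverse>" "w \<in> bt_verts d"
proof -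
  show w: "w \<in> bt_verts d" using assms by (auto simp: bt_verts_def successively_Cons)
  obtain i b where x: "x = (i, b)" by (cases x)
  have i: "i < d" using assms x by (auto simp: bt_verts_def)
  show "(x # w, w) \<in> bt_arcs d \<union> (bt_arcs d)\<inverse>"
  proof (cases b)
    case True
    have "bt_out w i = x # w"
      using assms x True by (cases w) (auto simp: bt_out_def bt_verts_def)
    with w i have "(w, x # w) \<in> bt_arcs d" by (auto simp: bt_arcs_def intro!: exI[of _ i])
    then show ?thesis by auto
  next
    case False
    have "bt_out (x # w) i = w" using x False by (auto simp: bt_out_def)
    with assms i have "(x # w, w) \<in> bt_arcs d" unfolding bt_arcs_def by force
    then show ?thesis by auto
  qed
qed

lemma bt_connected: "connected_graph (bt_verts d) (bt_arcs d \<union> (bt_arcs d)\<inverse>)"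
proof -
  let ?A = "bt_arcs d \<union> (bt_arcs d)\<inverse>"
  have root: "(w, []) \<in> ?A\<^sup>*" if "w \<in> bt_verts d" for w
    using that
  proof (induction w)
    case Nil
    then show ?case by simp
  next
    case (Cons x w)
    from bt_adj_Cons[OF Cons.prems] Cons.IH show ?case
      by (meson converse_rtrancl_into_rtrancl)
  qed
  have "sym ?A" by (auto simp: sym_def)
  then have "sym (?A\<^sup>*)" by (rule sym_rtrancl)
  then have "([], w) \<in> ?A\<^sup>*" if "w \<in> bt_verts d" for w
    using root[OF that] by (auto dest: symD)
  with root show ?thesis
    unfolding connected_graph_def by (meson rtrancl_trans)
qed

lemma bt_acyclic: "acyclic_graph (bt_arcs d \<union> (bt_arcs d)\<inverse>)"
  unfolding acyclic_graph_def
proof (rule notI, elim exE conjE)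
  fix n :: nat and c :: "nat \<Rightarrow> vertex"
  assume n: "3 \<le> n" and inj: "inj_on c {..<n}"
    and adj: "\<forall>i<n. (c i, c (Suc i mod n)) \<in> bt_arcs d \<union> (bt_arcs d)\<inverse>"
  define m where "m = Max ((length \<circ> c) ` {..<n})"
  have fin: "finite ((length \<circ> c) ` {..<n})" "(length \<circ> c) ` {..<n} \<noteq> {}"
    using n by (auto simp: lessThan_empty_iff)
  then have "m \<in> (length \<circ> c) ` {..<n}" unfolding m_def by (rule Max_in)
  then obtain i where i: "i < n" "length (c i) = m" by auto
  have le: "length (c j) \<le> length (c i)" if "j < n" for j
    using Max_ge[OF fin(1), of "length (c j)"] that i by (auto simp: m_def)
  define j where "j = Suc i mod n"
  define k where "k = (if i = 0 then n - 1 else i - 1)"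
  have j: "j < n" "j = (if Suc i = n then 0 else Suc i)"
    using n i by (auto simp: j_def)
  have k: "k < n" "Suc k mod n = i" using n i by (auto simp: k_def)
  have ne: "j \<noteq> k" using n i j(2) by (auto simp: k_def split: if_splits)
  have tl: "v = tl (c i)"
    if "(c i, v) \<in> bt_arcs d \<union> (bt_arcs d)\<inverse>" "length v \<le> length (c i)" for v
    using bt_adj_tl[OF that(1)] that(2) by (cases v) auto
  have "c j = tl (c i)"
    using adj i(1) by (intro tl le j(1)) (simp add: j_def)
  moreover have "c k = tl (c i)"
    using adj[rule_format, OF k(1)] k(2) by (intro tl le k(1)) auto
  ultimately have "c j = c k" by simp
  with inj j(1) k(1) ne show False by (auto dest: inj_onD)
qed

lemma bidirected_regular_tree_bt: "bidirected_regular_tree d (bt_verts d) (bt_arcs d)"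
  unfolding bidirected_regular_tree_def
proof (intro conjI ballI)
  show "bt_verts d \<noteq> {}" by (auto simp: bt_verts_def intro!: exI[of _ "[]"])
  show "bt_arcs d \<subseteq> bt_verts d \<times> bt_verts d"
    using bt_out_in_verts by (auto simp: bt_arcs_def)
  show "bt_arcs d \<inter> (bt_arcs d)\<inverse> = {}"
  proof (rule equals0I, clarify)
    fix u v assume "(u, v) \<in> bt_arcs d" "(v, u) \<in> bt_arcs d"
    then obtain i j where ij: "v = bt_out u i" "u = bt_out v j"
      by (auto simp: bt_arcs_def)
    have "bt_out (bt_out u i) j \<noteq> u"
    proof (cases "u \<noteq> [] \<and> hd u = (i, False)")
      case True
      then have "u = (i, False) # tl u" by (cases u) auto
      moreover have "bt_out (tl u) j \<noteq> (i, False) # tl u"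
        by (auto simp: bt_out_def dest: arg_cong[of _ _ length])
      ultimately show ?thesis using True by (simp add: bt_out_def)
    next
      case False
      then show ?thesis by (auto simp: bt_out_def dest: arg_cong[of _ _ length])
    qed
    with ij show False by simp
  qed
next
  fix w assume w: "w \<in> bt_verts d"
  show "finite (bt_arcs d `` {w})" "finite ((bt_arcs d)\<inverse> `` {w})"
    unfolding bt_out_image[OF w] bt_in_image[OF w] by simp_all
  show "card (bt_arcs d `` {w}) = d" "card ((bt_arcs d)\<inverse> `` {w}) = d"
    unfolding bt_out_image[OF w] bt_in_image[OF w]
    by (simp_all add: card_image inj_on_bt_out inj_on_bt_in)
qed (rule bt_connected bt_acyclic)+

end

theory Submission
  imports Defs
begin

text \<open>
  \<open>B\<close>-particles do not move, so whether an \<open>A\<close>-particle survives its visit at \<open>v\<close> depends only on the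
  vertices from which \<open>v\<close> can be reached along arcs. These form a \<open>d\<close>-ary tree, and the survivors of
  all visits form a fixed point of a monotone operator. The least fixed point is the limit of
  systems truncated at finite depth, and it is almost surely the only one: if arrivals at time \<open>t\<close>
  are weighted by \<open>exp (- t)\<close>, each level of the tree halves the expected total weight of the
  discrepancy between two fixed points. This solves the dynamics, and \<open>V\<^sub>\<infinity>\<close> becomes the sum of the
  \<open>Exp(1)\<close> holding times of the surviving visitors of the root, so its mean equals that of the
  number \<open>N\<close> of these visitors.

  Given \<open>d\<close> independent copies of \<open>N\<close>, each thinned with probability \<open>1 / d\<close>, with sum \<open>S\<close>, the law of
  \<open>N\<close> satisfies \<open>N = S + 1\<close> with probability \<open>p\<close> and \<open>N = max (S - 1) 0\<close> otherwise. Hence the mean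
  \<open>m\<close> can only be stationary if \<open>P(S = 0) = (1 - 2p) / (1 - p)\<close>. Jensen's inequality gives
  \<open>P(S = 0) \<ge> exp (- 2m)\<close>. Conversely the bound \<open>E (1 - x)\<^sup>N \<le> exp (- m x + 2 x\<^sup>2)\<close> for
  \<open>0 \<le> x \<le> 1/2\<close> is preserved by the recursion and gives \<open>P(S = 0) \<le> exp (1 - m)\<close>.
\<close>

text \<open>Two obstacles shape the proof. The process is given by \<open>THE\<close> as a solution
  of equations for the removal times on an infinite graph, so existence and uniqueness must be
  settled path by path before expectations can be computed; counting visits turns this into a
  fixed-point problem. The discount is needed there because one level of the tree merely preserves
  the expected number of free walkers: passing one in-edge costs \<open>1 / d\<close> for the
  direction and E exp (- gap) = 1/2 for the time, hence 1/2 for all \<open>d\<close> in-edges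
  together.

  All estimates concern a finite depth n, where the means satisfy m_(n+1) - m_n = (1 - p) P(S_n = 0)
  - (1 - 2p). Truncation makes m_n increasing, so the right side is nonnegative for every n; this
  replaces stationarity in the upper bound and lets the exponential bound pass from n to n + 1. For
  the lower bound, a right side bounded away from 0 would drive m_n to infinity. An exponent c x^2
  becomes at most (c/2 + 1) x^2 after one level, and c = 2 is the least constant that this
  reproduces.\<close>

section \<open>Visits and survival\<close>

text \<open>The particle started at \<open>up v js\<close> can visit \<open>v\<close> only after \<open>length js\<close> jumps, and it does
  so iff its first steps are \<open>rev js\<close>. Visits at \<open>v\<close> are therefore indexed by \<open>js\<close>.\<close>

primrec up :: "vertex \<Rightarrow> nat list \<Rightarrow> vertex" where
  "up v [] = v"
| "up v (j # js) = up (bt_in v j) js"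

lemma up_in_verts: "v \<in> bt_verts d \<Longrightarrow> js \<in> lists {..<d} \<Longrightarrow> up v js \<in> bt_verts d"
  by (induction js arbitrary: v) (auto simp: bt_in_in_verts)

text \<open>Once the last letter is an inverse generator, further inverse generators cannot cancel
  it.\<close>

lemma up_no_cancel:
  "w \<noteq> [] \<Longrightarrow> \<not> snd (hd w) \<Longrightarrow> up w js = map (\<lambda>j. (j, False)) (rev js) @ w"
  by (induction js arbitrary: w) (auto simp: bt_in_def)

lemma length_up_le: "length (up w js) \<le> length w + length js"
proof (induction js arbitrary: w)
  case (Cons j js)
  have "length (bt_in w j) \<le> Suc (length w)" by (auto simp: bt_in_def)
  with Cons[of "bt_in w j"] show ?case by simp
qed simp

text \<open>At most one in-edge of \<open>v\<close> shortens the word. Going back along any other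
  edge \<open>j\<close> leaves the letter \<open>(j, False)\<close> next to \<open>v\<close> for
  good, so the two words differ in that letter or, if \<open>i\<close> is the shortening edge, in
  length.\<close>

lemma up_bt_in_neq:
  assumes "length js = length ks" "i \<noteq> j" "\<not> (v \<noteq> [] \<and> hd v = (j, True))"
  shows "up (bt_in v i) js \<noteq> up (bt_in v j) ks"
proof -
  have j: "up (bt_in v j) ks = map (\<lambda>j. (j, False)) (rev ks) @ (j, False) # v"
    using assms(3) by (auto simp: bt_in_def up_no_cancel)
  show ?thesis
  proof (cases "v \<noteq> [] \<and> hd v = (i, True)")
    case True
    then have "length (up (bt_in v i) js) < length v + length js + 1"
      using length_up_le[of "tl v" js] by (simp add: bt_in_def)
    with j assms(1) show ?thesis
      by (metis Suc_eq_plus1 add.commute length_Cons length_append length_map length_rev nat_neq_iff add_Suc_right)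
  next
    case False
    then have "up (bt_in v i) js = map (\<lambda>j. (j, False)) (rev js) @ (i, False) # v"
      by (auto simp: bt_in_def up_no_cancel)
    with j assms show ?thesis by simp
  qed
qed

text \<open>The homomorphism from the free group to the integers that sends every generator to 1.
  Arcs raise it by 1, so the endpoints of a directed path determine its length.\<close>

definition height :: "vertex \<Rightarrow> int" where
  "height w = (\<Sum>x\<leftarrow>w. if snd x then 1 else -1)"

lemma height_bt_in: "height (bt_in w j) = height w - 1"
  by (cases w) (auto simp: height_def bt_in_def)

lemma height_up: "height (up w js) = height w - int (length js)"
  by (induction js arbitrary: w) (auto simp: height_bt_in)

text \<open>This makes \<open>js\<close> a faithful name of a particle, on which all independence
  arguments rest. Equal endpoints give equal lengths by \<open>height\<close>; where the lists first
  differ, \<open>up_bt_in_neq\<close> applies because two distinct in-edges cannot both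
  cancel.\<close>

lemma inj_up: "up v js = up v ks \<Longrightarrow> js = ks"
proof (induction js arbitrary: v ks)
  case Nil
  then have "length ks = 0" using height_up[of v ks] height_up[of v "[]"] by simp
  then show ?case by simp
next
  case (Cons j js)
  have len: "length ks = Suc (length js)"
    using height_up[of v ks] height_up[of v "j # js"] Cons.prems by simp
  then obtain i ls where ks: "ks = i # ls" by (cases ks) auto
  have "i = j"
  proof (rule ccontr)
    assume "i \<noteq> j"
    moreover have "\<not> (v \<noteq> [] \<and> hd v = (j, True)) \<or> \<not> (v \<noteq> [] \<and> hd v = (i, True))"
      using \<open>i \<noteq> j\<close> by auto
    ultimately show False
    proof (elim disjE)
      assume "\<not> (v \<noteq> [] \<and> hd v = (j, True))"
      with up_bt_in_neq[of ls js i j v] \<open>i \<noteq> j\<close> len ks Cons.prems show False by (simp del: de_Morgan_conj)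
    next
      assume "\<not> (v \<noteq> [] \<and> hd v = (i, True))"
      with up_bt_in_neq[of js ls j i v] \<open>i \<noteq> j\<close> len ks Cons.prems show False by (simp del: de_Morgan_conj)
    qed
  qed
  with Cons ks show ?case by auto
qed

text \<open>The latest step comes first because \<open>up\<close> retraces the walk from its current
  position.\<close>

definition back_path :: "(nat \<Rightarrow> nat) \<Rightarrow> nat \<Rightarrow> nat list" where
  "back_path s n = rev (map s [0..<n])"

lemma back_path_simps [simp]: "back_path s 0 = []" "back_path s (Suc n) = s n # back_path s n" "length (back_path s n) = n"
  by (simp_all add: back_path_def)

lemma back_path_lists: "(\<And>n. s n < d) \<Longrightarrow> back_path s n \<in> lists {..<d}"
  by (auto simp: back_path_def)

lemma walk_in_verts:
  "u \<in> bt_verts d \<Longrightarrow> (\<And>n. s n < d) \<Longrightarrow> walk bt_out u s n \<in> bt_verts d"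
  by (induction n) (auto simp: bt_out_in_verts)

lemma up_walk:
  "u \<in> bt_verts d \<Longrightarrow> (\<And>n. s n < d) \<Longrightarrow> up (walk bt_out u s n) (back_path s n) = u"
proof (induction n)
  case (Suc n)
  then show ?case using bt_in_out[OF walk_in_verts[of u d s n], of "s n"] by simp
qed simp

lemma walk_up:
  assumes "v \<in> bt_verts d" "js \<in> lists {..<d}" "back_path s (length js) = js"
  shows "walk bt_out (up v js) s (length js) = v"
  using assms
proof (induction js arbitrary: v)
  case (Cons j js)
  then have "walk bt_out (up (bt_in v j) js) s (length js) = bt_in v j"
    by (intro Cons.IH) (auto simp: bt_in_in_verts)
  with Cons.prems show ?case by (simp add: bt_out_in)
qed simp

definition jump_time :: "particle \<Rightarrow> nat \<Rightarrow> real" where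
  "jump_time x n = (\<Sum>k<n. gap x k)"

lemma jump_time_simps [simp]: "jump_time x 0 = 0" "jump_time x (Suc n) = jump_time x n + gap x n"
  by (simp_all add: jump_time_def)

definition arrival :: "(vertex \<Rightarrow> particle) \<Rightarrow> vertex \<Rightarrow> nat list \<Rightarrow> real" where
  "arrival \<omega> v js = jump_time (\<omega> (up v js)) (length js)"

lemma arrival_Nil [simp]: "arrival \<omega> v [] = 0"
  by (simp add: arrival_def)

lemma arrival_Cons:
  "arrival \<omega> v (j # js) = arrival \<omega> (bt_in v j) js + gap (\<omega> (up v (j # js))) (length js)"
  by (simp add: arrival_def)

text \<open>The visit of a walker that nothing can remove, whatever its type. These are the largest
  candidates, from which \<open>upper\<close> is iterated.\<close>

definition free_visit :: "nat \<Rightarrow> (vertex \<Rightarrow> particle) \<Rightarrow> vertex \<Rightarrow> nat list \<Rightarrow> bool" where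
  "free_visit d \<omega> v js \<longleftrightarrow> js \<in> lists {..<d} \<and> back_path (step (\<omega> (up v js))) (length js) = js"

fun arrives :: "(vertex \<Rightarrow> particle) \<Rightarrow> (vertex \<Rightarrow> nat list \<Rightarrow> bool) \<Rightarrow> vertex \<Rightarrow> nat list \<Rightarrow> bool" where
  "arrives \<omega> X v [] = False"
| "arrives \<omega> X v (j # js) \<longleftrightarrow> X (bt_in v j) js \<and> step (\<omega> (up v (j # js))) (length js) = j"

text \<open>If \<open>X w ks\<close> says that the particle started at \<open>up w ks\<close> is still present after its arrival at
  \<open>w\<close>, then \<open>arrives \<omega> X v\<close> are the visits at \<open>v\<close> before annihilation there, and
  \<open>survives d \<omega> X v\<close> are those after it: a \<open>B\<close>-particle at \<open>v\<close> removes exactly the first visitor.\<close>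

definition survives ::
    "nat \<Rightarrow> (vertex \<Rightarrow> particle) \<Rightarrow> (vertex \<Rightarrow> nat list \<Rightarrow> bool) \<Rightarrow> vertex \<Rightarrow> nat list \<Rightarrow> bool" where
  "survives d \<omega> X v js \<longleftrightarrow> js \<in> lists {..<d} \<and>
     (if js = [] then is_A (\<omega> v)
      else arrives \<omega> X v js \<and>
        (is_A (\<omega> v) \<or> (\<exists>ks\<in>lists {..<d}. arrives \<omega> X v ks \<and> arrival \<omega> v ks < arrival \<omega> v js)))"

text \<open>Approximations from both sides. \<open>lower d \<omega> n v\<close> leaves out the
  particles that need \<open>n\<close> or more jumps to reach \<open>v\<close>, while
  \<open>upper d \<omega> n v\<close> counts all free visits at the vertices \<open>n\<close> arcs
  back from \<open>v\<close> as surviving. The limit \<open>visits\<close> of the former is the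
  least fixed point.\<close>

definition lower :: "nat \<Rightarrow> (vertex \<Rightarrow> particle) \<Rightarrow> nat \<Rightarrow> vertex \<Rightarrow> nat list \<Rightarrow> bool" where
  "lower d \<omega> n = (survives d \<omega> ^^ n) (\<lambda>_ _. False)"

definition upper :: "nat \<Rightarrow> (vertex \<Rightarrow> particle) \<Rightarrow> nat \<Rightarrow> vertex \<Rightarrow> nat list \<Rightarrow> bool" where
  "upper d \<omega> n = (survives d \<omega> ^^ n) (free_visit d \<omega>)"

definition visits :: "nat \<Rightarrow> (vertex \<Rightarrow> particle) \<Rightarrow> vertex \<Rightarrow> nat list \<Rightarrow> bool" where
  "visits d \<omega> v js \<longleftrightarrow> (\<exists>n. lower d \<omega> n v js)"

lemma lower_simps: "lower d \<omega> 0 v js = False" "lower d \<omega> (Suc n) = survives d \<omega> (lower d \<omega> n)"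
  by (simp_all add: lower_def)

lemma upper_simps: "upper d \<omega> 0 = free_visit d \<omega>" "upper d \<omega> (Suc n) = survives d \<omega> (upper d \<omega> n)"
  by (simp_all add: upper_def)

lemma arrives_mono:
  "(\<And>w ks. w \<in> bt_verts d \<Longrightarrow> X w ks \<Longrightarrow> Y w ks) \<Longrightarrow> v \<in> bt_verts d \<Longrightarrow> js \<in> lists {..<d} \<Longrightarrow>
    arrives \<omega> X v js \<Longrightarrow> arrives \<omega> Y v js"
  by (cases js) (auto simp: bt_in_in_verts)

text \<open>\<open>X\<close> enters only positively: at a \<open>B\<close>-site a visitor needs an
  earlier one in order to survive. An extra visitor can therefore only take the place of the
  victim.\<close>

lemma survives_mono:
  assumes "\<And>w ks. w \<in> bt_verts d \<Longrightarrow> X w ks \<Longrightarrow> Y w ks" "v \<in> bt_verts d" "survives d \<omega> X v js"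
  shows "survives d \<omega> Y v js"
proof -
  have "arrives \<omega> Y v ks" if "arrives \<omega> X v ks" "ks \<in> lists {..<d}" for ks
    using that by (intro arrives_mono[of d X Y v ks \<omega>] assms(1,2))
  with assms(3) show ?thesis unfolding survives_def by (auto split: if_splits)
qed

lemma survives_lists: "survives d \<omega> X v js \<Longrightarrow> js \<in> lists {..<d}"
  by (simp add: survives_def)

lemma lower_lists: "lower d \<omega> n v js \<Longrightarrow> js \<in> lists {..<d}"
  by (cases n) (auto simp: lower_simps survives_def)

lemma upper_lists: "upper d \<omega> n v js \<Longrightarrow> js \<in> lists {..<d}"
  by (cases n) (auto simp: upper_simps survives_def free_visit_def)

lemma lower_Suc: "v \<in> bt_verts d \<Longrightarrow> lower d \<omega> n v js \<Longrightarrow> lower d \<omega> (Suc n) v js"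
proof (induction n arbitrary: v js)
  case (Suc n)
  from Suc.prems show ?case
    unfolding lower_simps(2)[of d \<omega> "Suc n"] lower_simps(2)[of d \<omega> n]
    by (rule survives_mono[rotated 1]) (use Suc.IH in \<open>simp add: lower_simps\<close>)
qed (simp add: lower_simps)

lemma lower_mono: "m \<le> n \<Longrightarrow> v \<in> bt_verts d \<Longrightarrow> lower d \<omega> m v js \<Longrightarrow> lower d \<omega> n v js"
  by (induction n rule: dec_induct) (auto intro: lower_Suc)

lemma length_lower: "lower d \<omega> n v js \<Longrightarrow> length js < n"
proof (induction n arbitrary: v js)
  case (Suc n)
  then show ?case
    by (cases js) (auto simp: lower_simps survives_def split: if_splits)
qed (simp add: lower_simps)

lemma survives_is_A:
  "survives d \<omega> X v js \<Longrightarrow> (\<And>w ks. X w ks \<Longrightarrow> is_A (\<omega> (up w ks))) \<Longrightarrow> is_A (\<omega> (up v js))"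
  by (cases js) (auto simp: survives_def)

lemma survives_free:
  "survives d \<omega> X v js \<Longrightarrow> (\<And>w ks. X w ks \<Longrightarrow> free_visit d \<omega> w ks) \<Longrightarrow> free_visit d \<omega> v js"
  by (cases js) (auto simp: survives_def free_visit_def)

lemma lower_is_A: "lower d \<omega> n v js \<Longrightarrow> is_A (\<omega> (up v js))"
  by (induction n arbitrary: v js) (auto simp: lower_simps intro: survives_is_A)

lemma lower_free: "lower d \<omega> n v js \<Longrightarrow> free_visit d \<omega> v js"
  by (induction n arbitrary: v js) (auto simp: lower_simps intro: survives_free)

lemma upper_free: "upper d \<omega> n v js \<Longrightarrow> free_visit d \<omega> v js"
  by (induction n arbitrary: v js) (auto simp: upper_simps intro: survives_free)

lemma lower_imp_upper: "v \<in> bt_verts d \<Longrightarrow> lower d \<omega> n v js \<Longrightarrow> upper d \<omega> n v js"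
proof (induction n arbitrary: v js)
  case (Suc n)
  then show ?case unfolding lower_simps upper_simps by (blast intro: survives_mono[rotated 1])
qed (simp add: lower_simps)

text \<open>The operator commutes with increasing limits, since a survival needs at most two facts
  about \<open>X\<close>: the visitor's own arrival and one earlier arrival.\<close>

lemma visits_fixpoint:
  assumes "v \<in> bt_verts d"
  shows "visits d \<omega> v js \<longleftrightarrow> survives d \<omega> (visits d \<omega>) v js"
proof
  assume "visits d \<omega> v js"
  then obtain n where "lower d \<omega> n v js" by (auto simp: visits_def)
  then obtain m where "survives d \<omega> (lower d \<omega> m) v js" by (cases n) (auto simp: lower_simps)
  then show "survives d \<omega> (visits d \<omega>) v js"
    using assms by (intro survives_mono[of d "lower d \<omega> m" "visits d \<omega>"]) (auto simp: visits_def)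
next
  assume s: "survives d \<omega> (visits d \<omega>) v js"
  have arr: "\<exists>n. arrives \<omega> (lower d \<omega> n) v ks" if "arrives \<omega> (visits d \<omega>) v ks" for ks
    using that by (cases ks) (auto simp: visits_def)
  have mono: "arrives \<omega> (lower d \<omega> n) v ks"
    if "arrives \<omega> (lower d \<omega> m) v ks" "m \<le> n" "ks \<in> lists {..<d}" for m n ks
    using that(1) by (rule arrives_mono[rotated 3]) (use assms that lower_mono in auto)
  have js: "js \<in> lists {..<d}" using s by (rule survives_lists)
  show "visits d \<omega> v js"
  proof (cases "js = []")
    case True
    with s have "lower d \<omega> (Suc 0) v js" by (auto simp: lower_simps survives_def)
    then show ?thesis unfolding visits_def by blast
  next
    case False
    with s have "arrives \<omega> (visits d \<omega>) v js" by (simp add: survives_def)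
    from arr[OF this] obtain n where n: "arrives \<omega> (lower d \<omega> n) v js" ..
    show ?thesis
    proof (cases "is_A (\<omega> v)")
      case True
      with n js False have "lower d \<omega> (Suc n) v js" by (auto simp: lower_simps survives_def)
      then show ?thesis unfolding visits_def by blast
    next
      case f: False
      with s False obtain ks where ks: "ks \<in> lists {..<d}" "arrives \<omega> (visits d \<omega>) v ks"
        "arrival \<omega> v ks < arrival \<omega> v js" by (auto simp: survives_def)
      from arr[OF ks(2)] obtain m where m: "arrives \<omega> (lower d \<omega> m) v ks" ..
      \<comment> \<open>At depth \<open>max m n\<close> both arrivals are seen, and one more level
        applies the operator to them.\<close>
      have "lower d \<omega> (Suc (max m n)) v js"
        using js f False ks mono[OF n, of "max m n"] mono[OF m, of "max m n"]
        unfolding lower_simps survives_def by auto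
      then show ?thesis unfolding visits_def by blast
    qed
  qed
qed

lemma visits_free: "visits d \<omega> v js \<Longrightarrow> free_visit d \<omega> v js"
  by (auto simp: visits_def intro: lower_free)

lemma visits_is_A: "visits d \<omega> v js \<Longrightarrow> is_A (\<omega> (up v js))"
  by (auto simp: visits_def intro: lower_is_A)

text \<open>Every solution of the dynamics will provide such an \<open>X\<close>. Once the two
  approximations have a common limit, no choice is left for it.\<close>

lemma fixpoint_between:
  assumes fp: "\<And>v js. v \<in> bt_verts d \<Longrightarrow> X v js \<longleftrightarrow> survives d \<omega> X v js"
    and free: "\<And>v js. v \<in> bt_verts d \<Longrightarrow> X v js \<Longrightarrow> free_visit d \<omega> v js"
    and v: "v \<in> bt_verts d"
  shows "lower d \<omega> n v js \<Longrightarrow> X v js" "X v js \<Longrightarrow> upper d \<omega> n v js"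
proof -
  show "X v js" if "lower d \<omega> n v js"
    using v that
  proof (induction n arbitrary: v js)
    case (Suc n)
    from Suc.prems have "survives d \<omega> X v js"
      unfolding lower_simps by (intro survives_mono[of d "lower d \<omega> n" X]) (auto intro: Suc.IH)
    with fp Suc.prems show ?case by simp
  qed (simp add: lower_simps)
  show "upper d \<omega> n v js" if "X v js"
    using v that
  proof (induction n arbitrary: v js)
    case (Suc n)
    from Suc.prems fp have "survives d \<omega> X v js" by simp
    with Suc show ?case
      unfolding upper_simps by (intro survives_mono[of d X "upper d \<omega> n"]) auto
  qed (simp add: upper_simps free)
qed

section \<open>Solving the dynamics\<close>

text \<open>The almost sure properties that the pathwise argument uses. The last one says that the
  approximations from above and from below meet, which is uniqueness of the fixed point.\<close>

locale regular_config =
  fixes d :: nat and \<omega> :: "vertex \<Rightarrow> particle"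
  assumes gap_pos: "v \<in> bt_verts d \<Longrightarrow> 0 < gap (\<omega> v) n"
    and step_less: "v \<in> bt_verts d \<Longrightarrow> step (\<omega> v) n < d"
    and finite_jumps: "v \<in> bt_verts d \<Longrightarrow> finite {n. jump_time (\<omega> v) n \<le> t}"
    and finite_arrivals: "v \<in> bt_verts d \<Longrightarrow> finite {js. free_visit d \<omega> v js \<and> arrival \<omega> v js \<le> t}"
    and upper_imp_visits: "v \<in> bt_verts d \<Longrightarrow> (\<And>n. upper d \<omega> n v js) \<Longrightarrow> visits d \<omega> v js"
begin

abbreviation "V \<equiv> bt_verts d"
abbreviation "T u n \<equiv> jump_time (\<omega> u) n"
abbreviation "W u n \<equiv> walk bt_out u (step (\<omega> u)) n"
abbreviation "P u n \<equiv> back_path (step (\<omega> u)) n"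

lemma T_strict_mono: "u \<in> V \<Longrightarrow> strict_mono (T u)"
  by (rule strict_monoI_Suc) (simp add: gap_pos)

lemma T_less_iff [simp]: "u \<in> V \<Longrightarrow> T u m < T u n \<longleftrightarrow> m < n"
  by (rule strict_mono_less[OF T_strict_mono])

lemma T_le_iff [simp]: "u \<in> V \<Longrightarrow> T u m \<le> T u n \<longleftrightarrow> m \<le> n"
  by (rule strict_mono_less_eq[OF T_strict_mono])

lemma T_eq_iff [simp]: "u \<in> V \<Longrightarrow> T u m = T u n \<longleftrightarrow> m = n"
  by (rule strict_mono_eq[OF T_strict_mono])

lemma T_nonneg: "u \<in> V \<Longrightarrow> 0 \<le> T u n"
  using T_le_iff[of u 0 n] by simp

lemma T_Suc_pos: "u \<in> V \<Longrightarrow> 0 < T u (Suc n)"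
  using T_less_iff[of u 0 "Suc n"] by (simp del: T_less_iff)

lemma W_in: "u \<in> V \<Longrightarrow> W u n \<in> V"
  by (rule walk_in_verts[OF _ step_less])

lemma up_W: "u \<in> V \<Longrightarrow> up (W u n) (P u n) = u"
  by (rule up_walk[OF _ step_less])

lemma P_lists: "u \<in> V \<Longrightarrow> P u n \<in> lists {..<d}"
  by (rule back_path_lists[OF step_less])

lemma free_visit_W: "u \<in> V \<Longrightarrow> free_visit d \<omega> (W u n) (P u n)"
  unfolding free_visit_def using P_lists[of u n] by (simp add: up_W)

lemma arrival_W: "u \<in> V \<Longrightarrow> arrival \<omega> (W u n) (P u n) = T u n"
  by (simp add: arrival_def up_W)

lemma free_visitD:
  assumes "free_visit d \<omega> v js" "v \<in> V"
  shows "up v js \<in> V" "W (up v js) (length js) = v" "P (up v js) (length js) = js"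
  using assms walk_up[of v d js] by (auto simp: free_visit_def up_in_verts)

lemma bracket:
  assumes "u \<in> V" "0 \<le> t"
  obtains n where "T u n \<le> t" "t < T u (Suc n)"
proof -
  let ?S = "{n. T u n \<le> t}"
  have S: "finite ?S" "0 \<in> ?S" using finite_jumps assms by auto
  then have "Max ?S \<in> ?S" by (intro Max_in) blast+
  moreover have "Suc (Max ?S) \<notin> ?S" using Max_ge[OF S(1), of "Suc (Max ?S)"] by linarith
  ultimately show ?thesis using that by (metis mem_Collect_eq not_le)
qed

lemma num_jumps_A:
  assumes "u \<in> V" "is_A (\<omega> u)" "T u n \<le> t" "t < T u (Suc n)"
  shows "num_jumps 1 0 (\<omega> u) t = n"
proof -
  have "{m. (\<Sum>k\<le>m. gap (\<omega> u) k) \<le> t} = {..<n}"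
  proof (intro set_eqI iffI)
    fix m
    have eq: "(\<Sum>k\<le>m. gap (\<omega> u) k) = T u (Suc m)"
      by (simp only: jump_time_def lessThan_Suc_atMost)
    show "m \<in> {..<n}" if "m \<in> {m. (\<Sum>k\<le>m. gap (\<omega> u) k) \<le> t}"
    proof -
      have "T u (Suc m) < T u (Suc n)" using that assms(4) eq by simp
      then show ?thesis using assms(1) by (simp del: jump_time_simps)
    qed
    show "m \<in> {m. (\<Sum>k\<le>m. gap (\<omega> u) k) \<le> t}" if "m \<in> {..<n}"
    proof -
      have "T u (Suc m) \<le> T u n" using that assms(1) by (simp del: jump_time_simps)
      then show ?thesis using assms(3) eq by simp
    qed
  qed
  then show ?thesis using assms(2) by (simp add: num_jumps_def jump_rate_def)
qed

lemma position_A: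
  assumes "u \<in> V" "is_A (\<omega> u)" "T u n \<le> t" "t < T u (Suc n)"
  shows "position bt_out 1 0 \<omega> u t = W u n"
  using num_jumps_A[OF assms] by (simp add: position_def)

lemma position_A_jump:
  assumes "u \<in> V" "is_A (\<omega> u)"
  shows "position bt_out 1 0 \<omega> u (T u n) = W u n"
  using assms by (intro position_A) (simp_all add: gap_pos)

lemma position_B:
  assumes "u \<in> V" "\<not> is_A (\<omega> u)"
  shows "position bt_out 1 0 \<omega> u t = u"
proof -
  \<comment> \<open>At rate 0 the clock has rung only for partial sums that are at most 0, and
    positive gaps have none.\<close>
  have "\<not> (\<Sum>k\<le>m. gap (\<omega> u) k) \<le> 0" for m
    using T_Suc_pos[OF assms(1), of m] by (simp only: jump_time_def lessThan_Suc_atMost not_le)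
  then show ?thesis using assms by (simp add: position_def num_jumps_def jump_rate_def)
qed

lemma jumps_at_iff:
  assumes "u \<in> V"
  shows "jumps_at 1 0 (\<omega> u) t \<longleftrightarrow> is_A (\<omega> u) \<and> (\<exists>k. t = T u (Suc k))"
proof -
  have eq: "(\<Sum>k\<le>m. gap (\<omega> u) k) = T u (Suc m)" for m
    by (simp only: jump_time_def lessThan_Suc_atMost)
  show ?thesis
    using T_Suc_pos[OF assms] unfolding jumps_at_def jump_rate_def eq by (auto simp: less_le)
qed

text \<open>With immobile \<open>B\<close>-particles and one particle per vertex at the start, the
  only possible opponent at a site is the particle that started there. So \<open>is_arg_min\<close>
  ranges over at most one candidate.\<close>

lemma annihilates_iff:
  "annihilates V bt_out 1 0 \<omega> \<tau> u v t \<longleftrightarrow>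
    u \<in> V \<and> is_A (\<omega> u) \<and> ereal t \<le> \<tau> u \<and>
    (\<exists>k. t = T u (Suc k) \<and> v = W u (Suc k)) \<and> \<not> is_A (\<omega> v) \<and> ereal t \<le> \<tau> v"
proof -
  have opp: "opponents V bt_out 1 0 \<omega> \<tau> u (T u (Suc k)) =
      {v. v = W u (Suc k) \<and> \<not> is_A (\<omega> v) \<and> ereal (T u (Suc k)) \<le> \<tau> v}"
    if "u \<in> V" "is_A (\<omega> u)" for k
    using that W_in[OF that(1), of "Suc k"] position_A_jump[OF that, of "Suc k"]
    unfolding opponents_def by (auto simp del: walk.simps jump_time_simps simp: position_B)
  show ?thesis
  proof (cases "u \<in> V \<and> is_A (\<omega> u)")
    case True
    then show ?thesis
      unfolding annihilates_def is_arg_min_def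
      by (auto simp del: walk.simps jump_time_simps simp: jumps_at_iff opp)
  qed (auto simp: annihilates_def jumps_at_iff)
qed

text \<open>Jump number \<open>k\<close> (counted from 0) of \<open>u\<close> ends in an annihilation.\<close>

definition hit :: "(vertex \<Rightarrow> ereal) \<Rightarrow> vertex \<Rightarrow> nat \<Rightarrow> bool" where
  "hit \<tau> u k \<longleftrightarrow> u \<in> V \<and> is_A (\<omega> u) \<and> \<not> is_A (\<omega> (W u (Suc k))) \<and>
     ereal (T u (Suc k)) \<le> \<tau> u \<and> ereal (T u (Suc k)) \<le> \<tau> (W u (Suc k))"

abbreviation "dyn \<tau> \<equiv> dlas_dynamics V bt_out 1 0 \<omega> \<tau>"

lemma dyn_iff:
  "dyn \<tau> \<longleftrightarrow> (\<forall>v. 0 < \<tau> v) \<and>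
     (\<forall>v t. \<tau> v = ereal t \<longleftrightarrow> (\<exists>u k. hit \<tau> u k \<and> t = T u (Suc k) \<and> (v = u \<or> v = W u (Suc k))))"
proof -
  have "(\<exists>u. annihilates V bt_out 1 0 \<omega> \<tau> u v t \<or> annihilates V bt_out 1 0 \<omega> \<tau> v u t) \<longleftrightarrow>
    (\<exists>u k. hit \<tau> u k \<and> t = T u (Suc k) \<and> (v = u \<or> v = W u (Suc k)))" for v t
    unfolding annihilates_iff hit_def by blast
  then show ?thesis unfolding dlas_dynamics_def by simp
qed

lemma dyn_hit:
  assumes "dyn \<tau>" "hit \<tau> u k"
  shows "\<tau> u = ereal (T u (Suc k))" "\<tau> (W u (Suc k)) = ereal (T u (Suc k))"
  using assms unfolding dyn_iff by blast+

lemma dyn_A: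
  assumes "dyn \<tau>" "is_A (\<omega> u)" "\<tau> u = ereal t"
  obtains k where "hit \<tau> u k" "t = T u (Suc k)"
proof -
  from assms(1,3) obtain w k where "hit \<tau> w k" "t = T w (Suc k)" "u = w \<or> u = W w (Suc k)"
    unfolding dyn_iff by blast
  with assms(2) that show ?thesis unfolding hit_def by auto
qed

lemma dyn_B:
  assumes "dyn \<tau>" "\<not> is_A (\<omega> v)" "\<tau> v = ereal t"
  obtains u k where "hit \<tau> u k" "t = T u (Suc k)" "v = W u (Suc k)"
proof -
  from assms(1,3) obtain w k where "hit \<tau> w k" "t = T w (Suc k)" "v = w \<or> v = W w (Suc k)"
    unfolding dyn_iff by blast
  with assms(2) that show ?thesis unfolding hit_def by auto
qed

lemma dyn_cases:
  assumes "dyn \<tau>"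
  obtains t where "\<tau> v = ereal t" | "\<tau> v = \<infinity>"
proof -
  have "0 < \<tau> v" using assms unfolding dyn_iff by blast
  then show ?thesis using that by (cases "\<tau> v") auto
qed

section \<open>Uniqueness: all solutions of the dynamics have the same surviving visits\<close>

definition surviving :: "(vertex \<Rightarrow> ereal) \<Rightarrow> vertex \<Rightarrow> nat list \<Rightarrow> bool" where
  "surviving \<tau> v js \<longleftrightarrow> free_visit d \<omega> v js \<and> is_A (\<omega> (up v js)) \<and>
     ereal (arrival \<omega> v js) < \<tau> (up v js)"

text \<open>An \<open>A\<close>-particle can only be removed at one of its own jumps, so nothing
  happens to it while it waits.\<close>

lemma T_less_tau_iff:
  assumes "dyn \<tau>" "u \<in> V" "is_A (\<omega> u)"
  shows "ereal (T u n) < \<tau> u \<longleftrightarrow> ereal (T u (Suc n)) \<le> \<tau> u"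
  using dyn_cases[OF assms(1), of u]
proof cases
  case (1 t)
  from dyn_A[OF assms(1,3) 1] obtain k where "t = T u (Suc k)" .
  with 1 assms(2) show ?thesis by (simp del: jump_time_simps add: less_Suc_eq_le)
qed simp

lemma arrives_surviving:
  assumes "dyn \<tau>" "v \<in> V" "js \<in> lists {..<d}"
  shows "arrives \<omega> (surviving \<tau>) v js \<longleftrightarrow> js \<noteq> [] \<and> free_visit d \<omega> v js \<and> is_A (\<omega> (up v js)) \<and>
     ereal (arrival \<omega> v js) \<le> \<tau> (up v js)"
proof (cases js)
  case (Cons j ks)
  have fv: "free_visit d \<omega> v js \<longleftrightarrow> free_visit d \<omega> (bt_in v j) ks \<and> step (\<omega> (up v js)) (length ks) = j"
    using assms(3) Cons by (auto simp: free_visit_def simp del: in_lists_conv_set)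
  have "up v js \<in> V" using assms by (intro up_in_verts)
  then show ?thesis
    using T_less_tau_iff[OF assms(1), of "up v js" "length ks"] Cons
    by (auto simp: fv[unfolded Cons] surviving_def arrival_def)
qed simp

text \<open>An arrival at a \<open>B\<close>-site is fatal exactly if the \<open>B\<close>-particle
  is still there, and the \<open>B\<close>-particle is gone exactly if somebody arrived earlier.
  This converts the equations for \<tau> into the fixed-point equation.\<close>

lemma surviving_fixpoint:
  assumes dyn: "dyn \<tau>" and v: "v \<in> V"
  shows "surviving \<tau> v js \<longleftrightarrow> survives d \<omega> (surviving \<tau>) v js"
proof (cases "js = []")
  case True
  have "0 < \<tau> v" using dyn unfolding dyn_iff by blast
  with True show ?thesis by (simp add: surviving_def survives_def free_visit_def zero_ereal_def)
next
  case ne: False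
  show ?thesis
  proof (cases "js \<in> lists {..<d} \<and> arrives \<omega> (surviving \<tau>) v js")
    case False
    then show ?thesis
      using arrives_surviving[OF dyn v, of js] ne
      by (auto simp: surviving_def survives_def free_visit_def)
  next
    case True
    define u where "u = up v js"
    obtain n where n: "length js = Suc n" using ne by (cases js) auto
    have a: "free_visit d \<omega> v js" "is_A (\<omega> u)" "ereal (T u (Suc n)) \<le> \<tau> u" and arr: "arrival \<omega> v js = T u (Suc n)"
      using True arrives_surviving[OF dyn v, of js] n unfolding u_def arrival_def by auto
    have u: "u \<in> V" "W u (Suc n) = v"
      using free_visitD[OF a(1) v] n by (auto simp: u_def)
    have "ereal (T u (Suc n)) < \<tau> u \<longleftrightarrow>
      is_A (\<omega> v) \<or> (\<exists>ks\<in>lists {..<d}. arrives \<omega> (surviving \<tau>) v ks \<and> arrival \<omega> v ks < arrival \<omega> v js)"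
      (is "?l \<longleftrightarrow> ?A \<or> ?r")
    proof (cases ?A)
      case A: True
      have "\<tau> u \<noteq> ereal (T u (Suc n))"
      proof
        assume "\<tau> u = ereal (T u (Suc n))"
        from dyn_A[OF dyn a(2) this] obtain k where "hit \<tau> u k" "T u (Suc n) = T u (Suc k)" .
        with u A show False by (auto simp del: jump_time_simps walk.simps simp: hit_def)
      qed
      with a(3) A show ?thesis by (simp add: less_le)
    next
      case B: False
      show ?thesis
      proof
        \<comment> \<open>A survivor must have come after the removal of the
          \<open>B\<close>-particle. Whoever removed that particle is the required earlier
          arrival.\<close>
        assume ?l
        then have "\<not> hit \<tau> u n" using dyn_hit(1)[OF dyn] by auto
        then have "\<tau> v < ereal (T u (Suc n))"
          using u a B by (auto simp del: jump_time_simps walk.simps simp: hit_def)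
        then obtain t where t: "\<tau> v = ereal t" "t < T u (Suc n)"
          by (cases rule: dyn_cases[OF dyn, of v]) auto
        from dyn_B[OF dyn B t(1)] obtain w k where w: "hit \<tau> w k" "t = T w (Suc k)" "v = W w (Suc k)" .
        let ?ks = "P w (Suc k)"
        have wV: "w \<in> V" using w by (simp add: hit_def)
        have "arrives \<omega> (surviving \<tau>) v ?ks"
          using arrives_surviving[OF dyn v P_lists[OF wV, of "Suc k"]] w wV
            free_visit_W[OF wV, of "Suc k"] up_W[OF wV, of "Suc k"] arrival_W[OF wV, of "Suc k"]
          by (simp add: hit_def del: jump_time_simps walk.simps)
        moreover have "arrival \<omega> v ?ks < arrival \<omega> v js"
          using arrival_W[OF wV, of "Suc k"] t w arr by simp
        ultimately show "?A \<or> ?r" using P_lists[OF wV, of "Suc k"] by blast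
      next
        assume "?A \<or> ?r"
        with B obtain ks where ks: "ks \<in> lists {..<d}" "arrives \<omega> (surviving \<tau>) v ks"
          "arrival \<omega> v ks < T u (Suc n)" using arr by auto
        define w where "w = up v ks"
        from ks(2) obtain k where k: "length ks = Suc k" by (cases ks) auto
        have b: "free_visit d \<omega> v ks" "is_A (\<omega> w)" "ereal (T w (Suc k)) \<le> \<tau> w"
          and arr': "arrival \<omega> v ks = T w (Suc k)"
          using ks arrives_surviving[OF dyn v, of ks] k unfolding w_def arrival_def by auto
        have w: "w \<in> V" "W w (Suc k) = v"
          using free_visitD[OF b(1) v] k by (auto simp: w_def)
        \<comment> \<open>The earlier arrival \<open>w\<close> either annihilates with the
          \<open>B\<close>-particle or comes after its removal.\<close>
        have "\<tau> v < ereal (T u (Suc n))"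
        proof (cases "ereal (T w (Suc k)) \<le> \<tau> v")
          case True
          with b w B have "hit \<tau> w k" by (auto simp: hit_def simp del: jump_time_simps walk.simps)
          from dyn_hit(2)[OF dyn this] w ks(3) arr' show ?thesis by (simp del: jump_time_simps walk.simps)
        next
          case False
          then have "\<tau> v < ereal (T w (Suc k))" by simp
          also have "\<dots> < ereal (T u (Suc n))" using ks(3) arr' by simp
          finally show ?thesis .
        qed
        moreover have "\<tau> u \<noteq> ereal (T u (Suc n))" if "\<not> \<tau> v \<ge> ereal (T u (Suc n))"
        proof
          assume "\<tau> u = ereal (T u (Suc n))"
          from dyn_A[OF dyn a(2) this] obtain k where "hit \<tau> u k" "T u (Suc n) = T u (Suc k)" .
          with u that show False by (auto simp del: jump_time_simps walk.simps simp: hit_def)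
        qed
        ultimately show ?l using a(3) by (auto simp: less_le)
      qed
    qed
    with a arr True ne show ?thesis
      by (simp add: surviving_def survives_def u_def)
  qed
qed

lemma surviving_iff_visits:
  assumes "dyn \<tau>" "v \<in> V"
  shows "surviving \<tau> v js \<longleftrightarrow> visits d \<omega> v js"
proof -
  have free: "surviving \<tau> v js \<Longrightarrow> free_visit d \<omega> v js" for v js by (simp add: surviving_def)
  note b = fixpoint_between[of d "surviving \<tau>", OF surviving_fixpoint[OF assms(1)] free assms(2)]
  show ?thesis
  proof
    assume "surviving \<tau> v js"
    then show "visits d \<omega> v js" by (intro upper_imp_visits assms b(2))
  next
    assume "visits d \<omega> v js"
    then show "surviving \<tau> v js" by (auto simp: visits_def intro: b(1))
  qed
qed

text \<open>The removal time of an \<open>A\<close>-particle can be read off from its surviving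
  visits, which are the same for both solutions. A removal time that is not finite is \<infinity>,
  which also settles the vertices outside \<open>V\<close>.\<close>

lemma dyn_le:
  assumes 1: "dyn \<tau>1" and 2: "dyn \<tau>2" and A: "is_A (\<omega> u)"
  shows "\<tau>2 u \<le> \<tau>1 u"
  using dyn_cases[OF 1, of u]
proof cases
  case (1 t)
  from dyn_A[OF assms(1) A 1] obtain k where k: "hit \<tau>1 u k" "t = T u (Suc k)" .
  then have u: "u \<in> V" by (simp add: hit_def)
  have eq: "up (W u (Suc k)) (P u (Suc k)) = u" by (rule up_W[OF u])
  have "\<not> surviving \<tau>1 (W u (Suc k)) (P u (Suc k))"
    using 1 k u unfolding surviving_def eq arrival_W[OF u] by simp
  then have "\<not> surviving \<tau>2 (W u (Suc k)) (P u (Suc k))"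
    using surviving_iff_visits[OF assms(1) W_in[OF u]] surviving_iff_visits[OF assms(2) W_in[OF u]] by blast
  then show ?thesis
    using 1 k A free_visit_W[OF u, of "Suc k"] unfolding surviving_def eq arrival_W[OF u] by auto
qed simp

text \<open>The removal times of \<open>A\<close>-particles already agree, so the hit that ends
  \<open>v\<close> under \<open>\<tau>1\<close> also happens under \<open>\<tau>2\<close>, unless
  \<open>v\<close> is gone by then.\<close>

lemma dyn_le_B:
  assumes 1: "dyn \<tau>1" and 2: "dyn \<tau>2" and B: "\<not> is_A (\<omega> v)"
  shows "\<tau>2 v \<le> \<tau>1 v"
  using dyn_cases[OF 1, of v]
proof cases
  case (1 t)
  from dyn_B[OF assms(1) B 1] obtain u k where k: "hit \<tau>1 u k" "t = T u (Suc k)" "v = W u (Suc k)" .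
  have eq: "\<tau>1 u = \<tau>2 u" using dyn_le assms k by (intro antisym) (auto simp: hit_def)
  show ?thesis
  proof (cases "ereal t \<le> \<tau>2 v")
    case True
    then have "hit \<tau>2 u k" using k eq by (simp add: hit_def)
    from dyn_hit(2)[OF assms(2) this] 1 k show ?thesis by simp
  qed (use 1 in simp)
qed simp

lemma dyn_unique: "dyn \<tau>1 \<Longrightarrow> dyn \<tau>2 \<Longrightarrow> \<tau>1 = \<tau>2"
  using dyn_le dyn_le_B by (intro ext antisym) metis+

section \<open>Existence: a solution built from the least fixed point\<close>

definition bad :: "vertex \<Rightarrow> nat \<Rightarrow> bool" where
  "bad u k \<longleftrightarrow> \<not> visits d \<omega> (W u (Suc k)) (P u (Suc k))"

text \<open>Only candidates: of all these arrivals just the first is annihilated, and only if the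
  particle started at \<open>v\<close> is of type \<open>B\<close>.\<close>

definition victims :: "vertex \<Rightarrow> nat list set" where
  "victims v = {js \<in> lists {..<d}. arrives \<omega> (visits d \<omega>) v js}"

definition tau :: "vertex \<Rightarrow> ereal" where
  "tau v = (if v \<notin> V then \<infinity>
     else if is_A (\<omega> v) then (if \<exists>k. bad v k then ereal (T v (Suc (LEAST k. bad v k))) else \<infinity>)
     else if victims v = {} then \<infinity>
     else ereal (arrival \<omega> v (arg_min_on (arrival \<omega> v) (victims v))))"

lemma arrives_W:
  assumes "u \<in> V"
  shows "arrives \<omega> X (W u (Suc k)) (P u (Suc k)) \<longleftrightarrow> X (W u k) (P u k)"
  using up_W[OF assms, of k] bt_in_out[OF W_in[OF assms, of k]] by simp

text \<open>\<open>arrives\<close> asks for survival at the preceding vertex, so one fatal jump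
  spoils all later visits: after the first bad jump every jump is bad. Hence the
  \<open>LEAST\<close> in \<open>tau\<close>.\<close>

lemma P_in_victims_iff:
  assumes "u \<in> V" "is_A (\<omega> u)"
  shows "P u (Suc k) \<in> victims (W u (Suc k)) \<longleftrightarrow> (\<forall>m<k. \<not> bad u m)"
proof (induction k)
  case 0
  have "visits d \<omega> u []"
    using assms by (simp add: visits_fixpoint survives_def)
  then show ?case
    using arrives_W[OF assms(1), of "visits d \<omega>" 0] P_lists[OF assms(1), of "Suc 0"]
    by (simp add: victims_def del: walk.simps(2) back_path_simps(2))
next
  case (Suc k)
  have "P u (Suc (Suc k)) \<in> victims (W u (Suc (Suc k))) \<longleftrightarrow> \<not> bad u k"
    using arrives_W[OF assms(1), of "visits d \<omega>" "Suc k"] P_lists[OF assms(1), of "Suc (Suc k)"]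
    by (simp add: victims_def bad_def del: walk.simps(2) back_path_simps(2))
  moreover have "P u (Suc k) \<in> victims (W u (Suc k))" if "\<not> bad u k"
    using that W_in[OF assms(1), of "Suc k"] visits_fixpoint[of "W u (Suc k)" d \<omega> "P u (Suc k)"]
    by (simp add: bad_def victims_def survives_def del: walk.simps(2) split: if_splits)
  ultimately show ?case using Suc by (auto simp: less_Suc_eq)
qed

lemma bad_iff:
  assumes "u \<in> V" "P u (Suc k) \<in> victims (W u (Suc k))"
  shows "bad u k \<longleftrightarrow> \<not> is_A (\<omega> (W u (Suc k))) \<and>
    (\<forall>ks\<in>victims (W u (Suc k)). T u (Suc k) \<le> arrival \<omega> (W u (Suc k)) ks)"
proof -
  have "P u (Suc k) \<noteq> []" by simp
  then show ?thesis
    using assms(2) arrival_W[OF assms(1), of "Suc k"]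
    unfolding bad_def visits_fixpoint[OF W_in[OF assms(1)]] survives_def victims_def
    by (auto simp: not_less simp del: walk.simps back_path_simps jump_time_simps)
qed

lemma victimsD:
  assumes "js \<in> victims v" "v \<in> V"
  obtains k where "up v js \<in> V" "is_A (\<omega> (up v js))" "W (up v js) (Suc k) = v" "P (up v js) (Suc k) = js"
    "arrival \<omega> v js = T (up v js) (Suc k)" "free_visit d \<omega> v js"
proof -
  obtain j ks where js: "js = j # ks" using assms(1) by (cases js) (auto simp: victims_def)
  with assms(1) have v: "visits d \<omega> (bt_in v j) ks" "step (\<omega> (up v js)) (length ks) = j" "js \<in> lists {..<d}"
    by (auto simp: victims_def)
  have "free_visit d \<omega> v js" using visits_free[OF v(1)] v js by (auto simp: free_visit_def)
  note * = free_visitD[OF this assms(2)] this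
  show ?thesis
    by (rule that[of "length ks"]) (use * visits_is_A[OF v(1)] js in \<open>simp_all add: arrival_def\<close>)
qed

text \<open>There may be infinitely many arrivals, but only finitely many up to the time of
  \<open>js\<close>, so a first one exists. The third conclusion has content only at a
  \<open>B\<close>-site, where \<open>tau\<close> is defined by this minimum.\<close>

lemma first_victim:
  assumes "js \<in> victims v" "v \<in> V"
  obtains ks where "ks \<in> victims v" "\<And>ls. ls \<in> victims v \<Longrightarrow> arrival \<omega> v ks \<le> arrival \<omega> v ls"
    "tau v = (if is_A (\<omega> v) then tau v else ereal (arrival \<omega> v ks))"
proof -
  let ?S = "{ks \<in> victims v. arrival \<omega> v ks \<le> arrival \<omega> v js}"
  have "?S \<subseteq> {ks. free_visit d \<omega> v ks \<and> arrival \<omega> v ks \<le> arrival \<omega> v js}"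
    using victimsD[OF _ assms(2)] by blast
  then have fin: "finite ?S" by (rule finite_subset) (rule finite_arrivals[OF assms(2)])
  obtain ls where ls: "is_arg_min (arrival \<omega> v) (\<lambda>x. x \<in> ?S) ls"
    using ex_is_arg_min_if_finite[OF fin, of "arrival \<omega> v"] assms(1) by auto
  then have "is_arg_min (arrival \<omega> v) (\<lambda>x. x \<in> victims v) ls"
    by (auto simp: is_arg_min_def) (meson less_le_not_le linear order_trans)
  then have am: "is_arg_min (arrival \<omega> v) (\<lambda>x. x \<in> victims v) (arg_min_on (arrival \<omega> v) (victims v))"
    unfolding arg_min_on_def arg_min_def by (rule someI)
  show ?thesis
    by (rule that[of "arg_min_on (arrival \<omega> v) (victims v)"])
      (use am assms in \<open>auto simp: is_arg_min_def tau_def not_less\<close>)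
qed

lemma le_tau_B_iff:
  assumes "v \<in> V" "\<not> is_A (\<omega> v)"
  shows "ereal t \<le> tau v \<longleftrightarrow> (\<forall>js\<in>victims v. t \<le> arrival \<omega> v js)"
proof (cases "victims v = {}")
  case False
  then obtain js where "js \<in> victims v" by blast
  from first_victim[OF this assms(1)] obtain ks where "ks \<in> victims v"
    "\<And>ls. ls \<in> victims v \<Longrightarrow> arrival \<omega> v ks \<le> arrival \<omega> v ls" "tau v = ereal (arrival \<omega> v ks)"
    using assms(2) by metis
  then show ?thesis by force
qed (use assms in \<open>simp add: tau_def\<close>)

lemma tau_B_eq:
  assumes "v \<in> V" "\<not> is_A (\<omega> v)" "tau v = ereal t"
  obtains js where "js \<in> victims v" "t = arrival \<omega> v js"
proof -
  have "victims v \<noteq> {}" using assms by (auto simp: tau_def)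
  then obtain js where "js \<in> victims v" by blast
  from first_victim[OF this assms(1)] show ?thesis
    using that assms by (metis ereal.inject)
qed

lemma tau_B_le:
  assumes "v \<in> V" "\<not> is_A (\<omega> v)" "js \<in> victims v"
  shows "tau v \<le> ereal (arrival \<omega> v js)"
  using first_victim[OF assms(3,1)] assms(2,3) by (metis ereal_less_eq(3))

lemma le_tau_A_iff:
  assumes "u \<in> V" "is_A (\<omega> u)"
  shows "ereal (T u (Suc k)) \<le> tau u \<longleftrightarrow> (\<forall>m<k. \<not> bad u m)"
proof (cases "\<exists>k. bad u k")
  case True
  then have "tau u = ereal (T u (Suc (LEAST k. bad u k)))" using assms by (simp add: tau_def)
  then have "ereal (T u (Suc k)) \<le> tau u \<longleftrightarrow> k \<le> (LEAST k. bad u k)"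
    using assms by (simp del: jump_time_simps)
  also have "\<dots> \<longleftrightarrow> (\<forall>m<k. \<not> bad u m)"
    using LeastI_ex[OF True] not_less_Least[of _ "bad u"] by (meson less_le_trans not_less)
  finally show ?thesis .
next
  case False
  then have "tau u = \<infinity>" using assms by (simp add: tau_def)
  with False show ?thesis by simp
qed

lemma tau_A_eq_iff:
  assumes "u \<in> V" "is_A (\<omega> u)"
  shows "tau u = ereal t \<longleftrightarrow> (\<exists>k. t = T u (Suc k) \<and> bad u k \<and> (\<forall>m<k. \<not> bad u m))"
proof (cases "\<exists>k. bad u k")
  case True
  then have "tau u = ereal (T u (Suc (LEAST k. bad u k)))" using assms by (simp add: tau_def)
  moreover have "bad u k \<and> (\<forall>m<k. \<not> bad u m) \<longleftrightarrow> k = (LEAST k. bad u k)" for k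
    using LeastI_ex[OF True] not_less_Least[of _ "bad u"] by (metis linorder_neqE_nat)
  ultimately show ?thesis by auto
next
  case False
  then have "tau u = \<infinity>" using assms by (simp add: tau_def)
  with False show ?thesis by simp
qed

text \<open>Until its first bad jump a particle is present by \<open>le_tau_A_iff\<close>. By
  \<open>bad_iff\<close> that jump ends at a \<open>B\<close>-site with no earlier arrival, which by
  \<open>le_tau_B_iff\<close> means that the \<open>B\<close>-particle is still present.\<close>

lemma hit_tau_iff:
  "hit tau u k \<longleftrightarrow> u \<in> V \<and> is_A (\<omega> u) \<and> bad u k \<and> (\<forall>m<k. \<not> bad u m)"
proof (cases "u \<in> V \<and> is_A (\<omega> u) \<and> (\<forall>m<k. \<not> bad u m)")
  case True
  then show ?thesis
    using bad_iff[of u k] P_in_victims_iff[of u k] le_tau_A_iff[of u k]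
      le_tau_B_iff[OF W_in[of u "Suc k"], of "T u (Suc k)"] unfolding hit_def by blast
next
  case False
  then show ?thesis using le_tau_A_iff[of u k] unfolding hit_def by blast
qed

lemma tau_pos: "0 < tau v"
proof (cases "v \<in> V")
  case True
  show ?thesis
  proof (cases "is_A (\<omega> v)")
    case A: True
    then show ?thesis
      using True T_Suc_pos[OF True] by (simp add: tau_def del: jump_time_simps)
  next
    case B: False
    show ?thesis
    proof (cases "tau v")
      case (real t)
      from tau_B_eq[OF True B real] obtain js where "js \<in> victims v" "t = arrival \<omega> v js" .
      with victimsD[OF this(1) True] T_Suc_pos show ?thesis using real by (metis ereal_less(2))
    next
      case MInf
      with True B show ?thesis by (auto simp: tau_def split: if_splits)
    qed simp
  qed
qed (simp add: tau_def)

lemma dyn_tau: "dyn tau"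
  unfolding dyn_iff
proof (intro conjI allI tau_pos)
  fix v t
  show "tau v = ereal t \<longleftrightarrow> (\<exists>u k. hit tau u k \<and> t = T u (Suc k) \<and> (v = u \<or> v = W u (Suc k)))"
  proof (cases "v \<in> V")
    case False
    then have "tau v \<noteq> ereal t" by (simp add: tau_def)
    moreover have "u \<in> V" "W u (Suc k) \<in> V" if "hit tau u k" for u k
      using that W_in[of u "Suc k"] by (simp_all add: hit_def del: walk.simps)
    ultimately show ?thesis using False by blast
  next
    case v: True
    show ?thesis
    proof (cases "is_A (\<omega> v)")
      case True
      then have "hit tau u k \<Longrightarrow> v \<noteq> W u (Suc k)" for u k unfolding hit_def by auto
      then show ?thesis
        using tau_A_eq_iff[OF v True, of t] hit_tau_iff v True by blast
    next
      case B: False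
      show ?thesis
      proof
        assume t: "tau v = ereal t"
        from tau_B_eq[OF v B this] obtain js where js: "js \<in> victims v" "t = arrival \<omega> v js" .
        from victimsD[OF js(1) v] obtain k where k: "up v js \<in> V" "is_A (\<omega> (up v js))"
          "W (up v js) (Suc k) = v" "P (up v js) (Suc k) = js" "arrival \<omega> v js = T (up v js) (Suc k)" .
        have "ereal (T (up v js) (Suc k)) \<le> tau (up v js)"
          using le_tau_A_iff[OF k(1,2)] P_in_victims_iff[OF k(1,2), of k] k(3,4) js(1) by metis
        moreover have "ereal (T (up v js) (Suc k)) \<le> tau v" using t js k by simp
        ultimately have "hit tau (up v js) k" using k(1-3) B unfolding hit_def by simp
        with js k show "\<exists>u k. hit tau u k \<and> t = T u (Suc k) \<and> (v = u \<or> v = W u (Suc k))" by metis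
      next
        assume "\<exists>u k. hit tau u k \<and> t = T u (Suc k) \<and> (v = u \<or> v = W u (Suc k))"
        then obtain u k where h: "hit tau u k" "t = T u (Suc k)" "v = W u (Suc k)"
          using B unfolding hit_def by blast
        then have u: "u \<in> V" "is_A (\<omega> u)" "ereal t \<le> tau u" "ereal t \<le> tau v" by (simp_all add: hit_def)
        then have "P u (Suc k) \<in> victims v"
          using le_tau_A_iff[OF u(1,2), of k] P_in_victims_iff[OF u(1,2), of k] h by simp
        from tau_B_le[OF v B this] have "tau v \<le> ereal t"
          using arrival_W[OF u(1), of "Suc k"] h by simp
        with u show "tau v = ereal t" by simp
      qed
    qed
  qed
qed

lemma removal_time_eq: "removal_time V bt_out 1 0 \<omega> = tau"
  unfolding removal_time_def by (rule the_equality) (auto intro: dyn_tau dyn_unique)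

section \<open>Occupation of a vertex by surviving visitors\<close>

definition present_A :: "vertex \<Rightarrow> real \<Rightarrow> nat list set" where
  "present_A v t = {js. visits d \<omega> v js \<and> arrival \<omega> v js \<le> t \<and> t < arrival \<omega> v js + gap (\<omega> (up v js)) (length js)}"

lemma present_A_eq:
  assumes v: "v \<in> V" and t: "0 \<le> t"
  shows "{u \<in> present V bt_out 1 0 \<omega> t v. is_A (\<omega> u)} = up v ` present_A v t"
proof (intro equalityI subsetI)
  fix u assume "u \<in> {u \<in> present V bt_out 1 0 \<omega> t v. is_A (\<omega> u)}"
  then have u: "u \<in> V" "ereal t < tau u" "position bt_out 1 0 \<omega> u t = v" "is_A (\<omega> u)"
    by (simp_all add: present_def removal_time_eq)
  from bracket[OF u(1) t] obtain n where n: "T u n \<le> t" "t < T u (Suc n)" .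
  have W: "W u n = v" using position_A[OF u(1,4) n] u(3) by simp
  have "ereal (T u n) < tau u" using n u(2) by (metis ereal_less_eq(3) le_less_trans)
  then have "surviving tau v (P u n)"
    using free_visit_W[OF u(1), of n] arrival_W[OF u(1), of n] up_W[OF u(1), of n] u
    by (simp add: surviving_def W)
  then have "visits d \<omega> v (P u n)" using surviving_iff_visits[OF dyn_tau v] by simp
  then have "P u n \<in> present_A v t"
    using n arrival_W[OF u(1), of n] up_W[OF u(1), of n] by (simp add: present_A_def W)
  then show "u \<in> up v ` present_A v t" using up_W[OF u(1), of n] W by force
next
  fix u assume "u \<in> up v ` present_A v t"
  then obtain js where js: "visits d \<omega> v js" "T u (length js) \<le> t" "t < T u (Suc (length js))" "u = up v js"
    by (auto simp: present_A_def arrival_def)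
  have s: "surviving tau v js" using surviving_iff_visits[OF dyn_tau v] js(1) by simp
  then have f: "free_visit d \<omega> v js" by (simp add: surviving_def)
  have u: "u \<in> V" "is_A (\<omega> u)" using free_visitD[OF f v] s js by (auto simp: surviving_def)
  have "ereal (T u (Suc (length js))) \<le> tau u"
    using T_less_tau_iff[OF dyn_tau u, of "length js"] s js(4) by (simp add: surviving_def arrival_def)
  then have "ereal t < tau u" using js(3) by (metis ereal_less_eq(3) less_le_trans less_ereal.simps(1))
  moreover have "position bt_out 1 0 \<omega> u t = v"
    using position_A[OF u js(2,3)] free_visitD[OF f v] js(4) by simp
  ultimately show "u \<in> {u \<in> present V bt_out 1 0 \<omega> t v. is_A (\<omega> u)}"
    using u by (simp add: present_def removal_time_eq)
qed

lemma finite_present_A: "v \<in> V \<Longrightarrow> finite (present_A v t)"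
  by (rule finite_subset[OF _ finite_arrivals[of v t]]) (auto simp: present_A_def visits_free)

text \<open>\<open>num_A\<close> is the positive part of \<open>zeta\<close>, so one has to see that
  a site never holds both types. At a \<open>B\<close>-site every surviving visitor comes after an
  arrival by whose time the \<open>B\<close>-particle is removed.\<close>

lemma num_A_eq:
  assumes v: "v \<in> V" and t: "0 \<le> t"
  shows "num_A V bt_out 1 0 v \<omega> t = card (present_A v t)"
proof -
  let ?B = "{u \<in> present V bt_out 1 0 \<omega> t v. \<not> is_A (\<omega> u)}"
  have cA: "card {u \<in> present V bt_out 1 0 \<omega> t v. is_A (\<omega> u)} = card (present_A v t)"
    unfolding present_A_eq[OF assms] by (rule card_image) (auto simp: inj_on_def dest: inj_up)
  have B: "?B \<subseteq> {v}" using position_B by (auto simp: present_def)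
  show ?thesis
  proof (cases "?B = {}")
    case True
    then show ?thesis unfolding num_A_def zeta_def cA True by simp
  next
    case False
    with B have "v \<in> ?B" by auto
    then have v': "\<not> is_A (\<omega> v)" "ereal t < tau v" by (simp_all add: present_def removal_time_eq)
    have "present_A v t = {}"
    proof (rule equals0I)
      fix js assume "js \<in> present_A v t"
      then have js: "visits d \<omega> v js" "arrival \<omega> v js \<le> t" by (simp_all add: present_A_def)
      then obtain ks where "ks \<in> victims v" "arrival \<omega> v ks < arrival \<omega> v js"
        using v'(1) by (auto simp: visits_fixpoint[OF v] survives_def victims_def split: if_splits)
      with tau_B_le[OF v v'(1), of ks] js(2) v'(2) show False
        by (metis ereal_less_eq(3) leD less_le order_trans)
    qed
    then show ?thesis unfolding num_A_def zeta_def cA by simp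
  qed
qed

text \<open>At time \<open>s\<close> the particles present correspond to the holding intervals that
  contain \<open>s\<close>. Exchanging sum and integral leaves the interval lengths, which are the
  gaps following the visits.\<close>

lemma occupation_time_eq:
  assumes v: "v \<in> V"
  shows "occupation_time V bt_out 1 0 v \<infinity> \<omega> =
    (\<integral>\<^sup>+js. (if visits d \<omega> v js then ennreal (gap (\<omega> (up v js)) (length js)) else 0) \<partial>count_space (lists {..<d}))"
proof -
  let ?I = "\<lambda>js. {arrival \<omega> v js ..< arrival \<omega> v js + gap (\<omega> (up v js)) (length js)}"
  have nonneg: "0 \<le> arrival \<omega> v js" if "visits d \<omega> v js" for js
    using free_visitD(1)[OF visits_free[OF that] v] T_nonneg by (simp add: arrival_def)
  have *: "of_nat (num_A V bt_out 1 0 v \<omega> s) * indicator {s. 0 \<le> s \<and> ereal s \<le> \<infinity>} s =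
    (\<integral>\<^sup>+js. (if visits d \<omega> v js then indicator (?I js) s else 0) \<partial>count_space (lists {..<d}))" for s
  proof (cases "0 \<le> s")
    case True
    have sub: "present_A v s \<subseteq> lists {..<d}"
      unfolding present_A_def using visits_free free_visit_def by blast
    have "(\<integral>\<^sup>+js. (if visits d \<omega> v js then indicator (?I js) s else 0) \<partial>count_space (lists {..<d})) =
      (\<integral>\<^sup>+js. indicator (present_A v s) js \<partial>count_space (lists {..<d}))"
      by (intro nn_integral_cong) (auto simp: present_A_def split: split_indicator)
    also have "\<dots> = of_nat (card (present_A v s))"
      using sub finite_present_A[OF v] by (subst nn_integral_indicator) (simp_all add: emeasure_count_space)
    finally show ?thesis using True num_A_eq[OF v True] by simp
  next
    case False
    then have "(if visits d \<omega> v js then indicator (?I js) s else 0) = (0::ennreal)" for js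
      using nonneg[of js] by (auto split: split_indicator)
    with False show ?thesis by simp
  qed
  have "occupation_time V bt_out 1 0 v \<infinity> \<omega> =
    (\<integral>\<^sup>+s. \<integral>\<^sup>+js. (if visits d \<omega> v js then indicator (?I js) s else 0) \<partial>count_space (lists {..<d}) \<partial>lborel)"
    unfolding occupation_time_def * ..
  also have "\<dots> = (\<integral>\<^sup>+js. \<integral>\<^sup>+s. (if visits d \<omega> v js then indicator (?I js) s else 0) \<partial>lborel \<partial>count_space (lists {..<d}))"
    by (intro nn_integral_count_space_nn_integral) auto
  also have "\<dots> = (\<integral>\<^sup>+js. (if visits d \<omega> v js then ennreal (gap (\<omega> (up v js)) (length js)) else 0) \<partial>count_space (lists {..<d}))"
    using free_visitD(1)[OF visits_free v]
    by (intro nn_integral_cong) (auto simp: gap_pos less_imp_le)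
  finally show ?thesis .
qed

end

section \<open>Resampling independent coordinates\<close>

lemma measurable_merge_copies_PiM:
  "(\<lambda>(x, y) i. if i \<in> J then x i else y i) \<in> Pi\<^sub>M I M \<Otimes>\<^sub>M Pi\<^sub>M I M \<rightarrow>\<^sub>M Pi\<^sub>M I M"
proof (rule measurable_PiM_single')
  show "(\<lambda>\<omega>. (case \<omega> of (x, y) \<Rightarrow> \<lambda>i. if i \<in> J then x i else y i) i) \<in> Pi\<^sub>M I M \<Otimes>\<^sub>M Pi\<^sub>M I M \<rightarrow>\<^sub>M M i"
    if "i \<in> I" for i
    using that by (cases "i \<in> J") (auto simp: case_prod_unfold)
  show "(\<lambda>\<omega>. case \<omega> of (x, y) \<Rightarrow> \<lambda>i. if i \<in> J then x i else y i) \<in> space (Pi\<^sub>M I M \<Otimes>\<^sub>M Pi\<^sub>M I M)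
      \<rightarrow> Pi\<^sub>E I (\<lambda>i. space (M i))"
    by (auto simp: space_pair_measure space_PiM PiE_iff extensional_def)
qed

text \<open>It suffices to test sets that restrict finitely many coordinates, and for these the
  measure factorises into the coordinates inside and outside \<open>J\<close>.\<close>

lemma distr_merge_copies_PiM:
  assumes M: "\<And>i. i \<in> I \<Longrightarrow> prob_space (M i)"
  shows "distr (Pi\<^sub>M I M \<Otimes>\<^sub>M Pi\<^sub>M I M) (Pi\<^sub>M I M) (\<lambda>(x, y) i. if i \<in> J then x i else y i) = Pi\<^sub>M I M"
    (is "?L = _")
proof (rule measure_eqI_PiM_infinite[symmetric, OF refl])
  interpret P: prob_space "Pi\<^sub>M I M"
    using M by (intro prob_space_PiM) auto
  show "finite_measure (Pi\<^sub>M I M)" by unfold_locales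
  fix K A assume K: "finite K" "K \<subseteq> I" and A: "\<And>i. i \<in> K \<Longrightarrow> A i \<in> sets (M i)"
  let ?X = "prod_emb I M K (Pi\<^sub>E K A)"
  let ?E = "\<lambda>K. prod_emb I M K (Pi\<^sub>E K A)"
  have "Pi\<^sub>M I M ?X = (\<Prod>i\<in>K. M i (A i))"
    using M K A by (intro emeasure_PiM_emb) auto
  also have "\<dots> = (\<Prod>i\<in>K \<inter> J. M i (A i)) * (\<Prod>i\<in>K - J. M i (A i))"
    using K by (simp add: prod.Int_Diff)
  also have "(\<Prod>i\<in>K \<inter> J. M i (A i)) = Pi\<^sub>M I M (?E (K \<inter> J))"
    using M K A by (intro emeasure_PiM_emb[symmetric]) auto
  also have "(\<Prod>i\<in>K - J. M i (A i)) = Pi\<^sub>M I M (?E (K - J))"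
    using M K A by (intro emeasure_PiM_emb[symmetric]) auto
  also have "Pi\<^sub>M I M (?E (K \<inter> J)) * Pi\<^sub>M I M (?E (K - J)) =
      (Pi\<^sub>M I M \<Otimes>\<^sub>M Pi\<^sub>M I M) (?E (K \<inter> J) \<times> ?E (K - J))"
    using K A by (intro P.emeasure_pair_measure_Times[symmetric] sets_PiM_I) auto
  also have "?E (K \<inter> J) \<times> ?E (K - J) =
      (\<lambda>(x, y) i. if i \<in> J then x i else y i) -` ?X \<inter> space (Pi\<^sub>M I M \<Otimes>\<^sub>M Pi\<^sub>M I M)"
    using K by (auto simp: prod_emb_def space_pair_measure space_PiM PiE_iff extensional_def
      restrict_def split: if_splits)
  finally show "Pi\<^sub>M I M ?X = ?L ?X"
    using K A by (simp add: emeasure_distr measurable_merge_copies_PiM sets_PiM_I)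
qed simp

text \<open>Independence, with dependence on coordinates stated pointwise, so that no restricted
  products or generated \<sigma>-algebras appear. Taking the coordinates in \<open>J\<close> from
  one copy and the others from a second copy makes \<open>F\<close> a function of the first and
  \<open>G\<close> of the second.\<close>

lemma nn_integral_mult_PiM:
  fixes F G :: "('i \<Rightarrow> 'a) \<Rightarrow> ennreal"
  assumes M: "\<And>i. i \<in> I \<Longrightarrow> prob_space (M i)"
    and F: "F \<in> borel_measurable (Pi\<^sub>M I M)" and G: "G \<in> borel_measurable (Pi\<^sub>M I M)"
    and depF: "\<And>x y. (\<And>i. i \<in> J \<Longrightarrow> x i = y i) \<Longrightarrow> F x = F y"
    and depG: "\<And>x y. (\<And>i. i \<notin> J \<Longrightarrow> x i = y i) \<Longrightarrow> G x = G y"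
  shows "(\<integral>\<^sup>+x. F x * G x \<partial>Pi\<^sub>M I M) = (\<integral>\<^sup>+x. F x \<partial>Pi\<^sub>M I M) * (\<integral>\<^sup>+x. G x \<partial>Pi\<^sub>M I M)"
proof -
  interpret P: prob_space "Pi\<^sub>M I M"
    using M by (intro prob_space_PiM) auto
  let ?m = "\<lambda>(x, y) i. if i \<in> J then x i else y i"
  note [measurable] = F G
  have "(\<integral>\<^sup>+x. F x * G x \<partial>Pi\<^sub>M I M) = (\<integral>\<^sup>+x. F x * G x \<partial>distr (Pi\<^sub>M I M \<Otimes>\<^sub>M Pi\<^sub>M I M) (Pi\<^sub>M I M) ?m)"
    by (simp only: distr_merge_copies_PiM[OF M])
  also have "\<dots> = (\<integral>\<^sup>+z. F (?m z) * G (?m z) \<partial>(Pi\<^sub>M I M \<Otimes>\<^sub>M Pi\<^sub>M I M))"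
    by (rule nn_integral_distr[OF measurable_merge_copies_PiM]) measurable
  also have "\<dots> = (\<integral>\<^sup>+z. F (fst z) * G (snd z) \<partial>(Pi\<^sub>M I M \<Otimes>\<^sub>M Pi\<^sub>M I M))"
    by (intro nn_integral_cong arg_cong2[where f = times] depF depG) (auto simp: case_prod_unfold)
  also have "\<dots> = (\<integral>\<^sup>+x. (\<integral>\<^sup>+y. F x * G y \<partial>Pi\<^sub>M I M) \<partial>Pi\<^sub>M I M)"
    by (subst P.nn_integral_fst[symmetric]) auto
  also have "\<dots> = (\<integral>\<^sup>+x. F x \<partial>Pi\<^sub>M I M) * (\<integral>\<^sup>+x. G x \<partial>Pi\<^sub>M I M)"
    by (simp add: nn_integral_cmult nn_integral_multc)
  finally show ?thesis .
qed

lemma measurable_fun_upd_PiM: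
  assumes "i \<in> I" "f \<in> N \<rightarrow>\<^sub>M Pi\<^sub>M I M" "g \<in> N \<rightarrow>\<^sub>M M i"
  shows "(\<lambda>x. (f x)(i := g x)) \<in> N \<rightarrow>\<^sub>M Pi\<^sub>M I M"
  using assms measurable_fun_upd[of I I i] by (simp add: insert_absorb)

lemma nn_integral_resample_PiM:
  assumes M: "\<And>i. i \<in> I \<Longrightarrow> prob_space (M i)" and i: "i \<in> I"
    and F: "F \<in> borel_measurable (Pi\<^sub>M I M)"
  shows "(\<integral>\<^sup>+x. F x \<partial>Pi\<^sub>M I M) = (\<integral>\<^sup>+x. (\<integral>\<^sup>+y. F (x(i := y)) \<partial>M i) \<partial>Pi\<^sub>M I M)"
proof -
  interpret P: prob_space "Pi\<^sub>M I M"
    using M by (intro prob_space_PiM) auto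
  interpret Mi: prob_space "M i" using M i .
  interpret pair_sigma_finite "M i" "Pi\<^sub>M I M" ..
  note [measurable] = F
  have meas: "(\<lambda>(y, x). x(i := y)) \<in> M i \<Otimes>\<^sub>M Pi\<^sub>M I M \<rightarrow>\<^sub>M Pi\<^sub>M I M"
    using i by (simp add: case_prod_unfold measurable_fun_upd_PiM)
  have *: "distr (M i \<Otimes>\<^sub>M Pi\<^sub>M I M) (Pi\<^sub>M I M) (\<lambda>(y, x). x(i := y)) = Pi\<^sub>M I M"
    using distr_pair_PiM_eq_PiM[of I M i] M i by (simp add: insert_absorb)
  have "(\<integral>\<^sup>+x. F x \<partial>Pi\<^sub>M I M) = (\<integral>\<^sup>+x. F x \<partial>distr (M i \<Otimes>\<^sub>M Pi\<^sub>M I M) (Pi\<^sub>M I M) (\<lambda>(y, x). x(i := y)))"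
    by (simp only: *)
  also have "\<dots> = (\<integral>\<^sup>+z. F ((\<lambda>(y, x). x(i := y)) z) \<partial>(M i \<Otimes>\<^sub>M Pi\<^sub>M I M))"
    by (rule nn_integral_distr[OF meas]) (use F in simp)
  also have "\<dots> = (\<integral>\<^sup>+x. (\<integral>\<^sup>+y. F (x(i := y)) \<partial>M i) \<partial>Pi\<^sub>M I M)"
    by (subst nn_integral_snd[symmetric])
       (use meas in \<open>auto simp: case_prod_unfold intro!: measurable_compose[OF _ F]\<close>)
  finally show ?thesis .
qed

text \<open>Replacing a part of \<open>x\<close> by an independent \<open>K\<close>-distributed value by means of \<open>f\<close> preserves \<open>M\<close>.\<close>

definition resamples :: "'a measure \<Rightarrow> 'b measure \<Rightarrow> ('a \<Rightarrow> 'b \<Rightarrow> 'a) \<Rightarrow> bool" where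
  "resamples M K f \<longleftrightarrow> (\<lambda>(x, y). f x y) \<in> M \<Otimes>\<^sub>M K \<rightarrow>\<^sub>M M \<and>
     (\<forall>F\<in>borel_measurable M. (\<integral>\<^sup>+x. F x \<partial>M) = (\<integral>\<^sup>+x. (\<integral>\<^sup>+y. F (f x y) \<partial>K) \<partial>M))"

lemma resamples_measurable: "resamples M K f \<Longrightarrow> (\<lambda>z. f (fst z) (snd z)) \<in> M \<Otimes>\<^sub>M K \<rightarrow>\<^sub>M M"
  by (simp add: resamples_def case_prod_unfold)

lemma resamples_integral:
  "resamples M K f \<Longrightarrow> F \<in> borel_measurable M \<Longrightarrow>
    (\<integral>\<^sup>+x. F x \<partial>M) = (\<integral>\<^sup>+x. (\<integral>\<^sup>+y. F (f x y) \<partial>K) \<partial>M)"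
  by (simp add: resamples_def)

text \<open>Closure under products, here and in the two pair lemmas, lifts the redrawing of a single
  gap or step from its own factor through the tuple of a particle to the whole
  configuration.\<close>

lemma resamples_PiM:
  assumes M: "\<And>i. i \<in> I \<Longrightarrow> prob_space (M i)" and i: "i \<in> I" and K: "prob_space K"
    and f: "resamples (M i) K f"
  shows "resamples (Pi\<^sub>M I M) K (\<lambda>x y. x(i := f (x i) y))"
  unfolding resamples_def
proof (intro conjI ballI)
  interpret K: prob_space K by fact
  note fm = resamples_measurable[OF f]
  have "(\<lambda>z. f (fst z i) (snd z)) \<in> Pi\<^sub>M I M \<Otimes>\<^sub>M K \<rightarrow>\<^sub>M M i"
    using measurable_compose[OF _ fm, of "\<lambda>z. (fst z i, snd z)" "Pi\<^sub>M I M \<Otimes>\<^sub>M K"] i by simp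
  then show meas: "(\<lambda>(x, y). x(i := f (x i) y)) \<in> Pi\<^sub>M I M \<Otimes>\<^sub>M K \<rightarrow>\<^sub>M Pi\<^sub>M I M"
    using i by (simp add: case_prod_unfold measurable_fun_upd_PiM)
  fix F :: "('a \<Rightarrow> 'b) \<Rightarrow> ennreal" assume F[measurable]: "F \<in> borel_measurable (Pi\<^sub>M I M)"
  have 1: "(\<lambda>z. F (x(i := z))) \<in> borel_measurable (M i)" if "x \<in> space (Pi\<^sub>M I M)" for x
    using i that by (intro measurable_compose[OF _ F] measurable_fun_upd_PiM) auto
  have 2: "(\<lambda>x. \<integral>\<^sup>+y. F (x(i := f (x i) y)) \<partial>K) \<in> borel_measurable (Pi\<^sub>M I M)"
    using measurable_compose[OF meas F] by (intro K.borel_measurable_nn_integral) (simp add: case_prod_unfold)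
  have "(\<integral>\<^sup>+x. F x \<partial>Pi\<^sub>M I M) = (\<integral>\<^sup>+x. (\<integral>\<^sup>+z. F (x(i := z)) \<partial>M i) \<partial>Pi\<^sub>M I M)"
    by (rule nn_integral_resample_PiM[OF M i F])
  also have "\<dots> = (\<integral>\<^sup>+x. (\<integral>\<^sup>+z. (\<integral>\<^sup>+y. F (x(i := f z y)) \<partial>K) \<partial>M i) \<partial>Pi\<^sub>M I M)"
    by (intro nn_integral_cong resamples_integral[OF f] 1)
  \<comment> \<open>Redrawing coordinate \<open>i\<close> on the right-hand side as well replaces
    \<open>x i\<close> by \<open>z\<close>, and the later update overwrites the first.\<close>
  also have "\<dots> = (\<integral>\<^sup>+x. (\<integral>\<^sup>+y. F (x(i := f (x i) y)) \<partial>K) \<partial>Pi\<^sub>M I M)"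
    by (subst nn_integral_resample_PiM[OF M i 2]) simp_all
  finally show "(\<integral>\<^sup>+x. F x \<partial>Pi\<^sub>M I M) = (\<integral>\<^sup>+x. (\<integral>\<^sup>+y. F (x(i := f (x i) y)) \<partial>K) \<partial>Pi\<^sub>M I M)" .
qed

lemma resamples_self:
  assumes "prob_space K"
  shows "resamples K K (\<lambda>x y. y)"
proof -
  interpret prob_space K by fact
  show ?thesis by (simp add: resamples_def case_prod_unfold emeasure_space_1)
qed

lemma resamples_pair_left:
  assumes M: "prob_space M" and N: "prob_space N" and K: "prob_space K" and f: "resamples M K f"
  shows "resamples (M \<Otimes>\<^sub>M N) K (\<lambda>x y. (f (fst x) y, snd x))"
  unfolding resamples_def
proof (intro conjI ballI)
  interpret M: prob_space M by fact
  interpret N: prob_space N by fact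
  interpret K: prob_space K by fact
  interpret MN: pair_sigma_finite M N ..
  note fm = resamples_measurable[OF f]
  have "(\<lambda>z. f (fst (fst z)) (snd z)) \<in> (M \<Otimes>\<^sub>M N) \<Otimes>\<^sub>M K \<rightarrow>\<^sub>M M"
    using measurable_compose[OF _ fm, of "\<lambda>z. (fst (fst z), snd z)" "(M \<Otimes>\<^sub>M N) \<Otimes>\<^sub>M K"] by simp
  then show meas: "(\<lambda>(x, y). (f (fst x) y, snd x)) \<in> (M \<Otimes>\<^sub>M N) \<Otimes>\<^sub>M K \<rightarrow>\<^sub>M M \<Otimes>\<^sub>M N"
    by (simp add: case_prod_unfold)
  fix F :: "'a \<times> 'b \<Rightarrow> ennreal" assume F[measurable]: "F \<in> borel_measurable (M \<Otimes>\<^sub>M N)"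
  have 2: "(\<lambda>x. \<integral>\<^sup>+y. F (f (fst x) y, snd x) \<partial>K) \<in> borel_measurable (M \<Otimes>\<^sub>M N)"
    using measurable_compose[OF meas F] by (intro K.borel_measurable_nn_integral) (simp add: case_prod_unfold)
  have "(\<integral>\<^sup>+x. F x \<partial>(M \<Otimes>\<^sub>M N)) = (\<integral>\<^sup>+b. (\<integral>\<^sup>+a. F (a, b) \<partial>M) \<partial>N)"
    by (rule MN.nn_integral_snd[symmetric]) simp
  also have "\<dots> = (\<integral>\<^sup>+b. (\<integral>\<^sup>+a. (\<integral>\<^sup>+y. F (f a y, b) \<partial>K) \<partial>M) \<partial>N)"
    by (intro nn_integral_cong resamples_integral[OF f]) simp
  also have "\<dots> = (\<integral>\<^sup>+x. (\<integral>\<^sup>+y. F (f (fst x) y, snd x) \<partial>K) \<partial>(M \<Otimes>\<^sub>M N))"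
    using MN.nn_integral_snd[OF 2] by simp
  finally show "(\<integral>\<^sup>+x. F x \<partial>(M \<Otimes>\<^sub>M N)) = (\<integral>\<^sup>+x. (\<integral>\<^sup>+y. F (f (fst x) y, snd x) \<partial>K) \<partial>(M \<Otimes>\<^sub>M N))" .
qed

lemma resamples_pair_right:
  assumes M: "prob_space M" and N: "prob_space N" and K: "prob_space K" and f: "resamples N K f"
  shows "resamples (M \<Otimes>\<^sub>M N) K (\<lambda>x y. (fst x, f (snd x) y))"
  unfolding resamples_def
proof (intro conjI ballI)
  interpret M: prob_space M by fact
  interpret N: prob_space N by fact
  interpret K: prob_space K by fact
  note fm = resamples_measurable[OF f]
  have "(\<lambda>z. f (snd (fst z)) (snd z)) \<in> (M \<Otimes>\<^sub>M N) \<Otimes>\<^sub>M K \<rightarrow>\<^sub>M N"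
    using measurable_compose[OF _ fm, of "\<lambda>z. (snd (fst z), snd z)" "(M \<Otimes>\<^sub>M N) \<Otimes>\<^sub>M K"] by simp
  then show meas: "(\<lambda>(x, y). (fst x, f (snd x) y)) \<in> (M \<Otimes>\<^sub>M N) \<Otimes>\<^sub>M K \<rightarrow>\<^sub>M M \<Otimes>\<^sub>M N"
    by (simp add: case_prod_unfold)
  fix F :: "'a \<times> 'b \<Rightarrow> ennreal" assume F[measurable]: "F \<in> borel_measurable (M \<Otimes>\<^sub>M N)"
  have 2: "(\<lambda>x. \<integral>\<^sup>+y. F (fst x, f (snd x) y) \<partial>K) \<in> borel_measurable (M \<Otimes>\<^sub>M N)"
    using measurable_compose[OF meas F] by (intro K.borel_measurable_nn_integral) (simp add: case_prod_unfold)
  have "(\<integral>\<^sup>+x. F x \<partial>(M \<Otimes>\<^sub>M N)) = (\<integral>\<^sup>+a. (\<integral>\<^sup>+b. F (a, b) \<partial>N) \<partial>M)"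
    by (rule N.nn_integral_fst[symmetric]) simp
  also have "\<dots> = (\<integral>\<^sup>+a. (\<integral>\<^sup>+b. (\<integral>\<^sup>+y. F (a, f b y) \<partial>K) \<partial>N) \<partial>M)"
    by (intro nn_integral_cong resamples_integral[OF f]) simp
  also have "\<dots> = (\<integral>\<^sup>+x. (\<integral>\<^sup>+y. F (fst x, f (snd x) y) \<partial>K) \<partial>(M \<Otimes>\<^sub>M N))"
    using N.nn_integral_fst[OF 2] by simp
  finally show "(\<integral>\<^sup>+x. F x \<partial>(M \<Otimes>\<^sub>M N)) = (\<integral>\<^sup>+x. (\<integral>\<^sup>+y. F (fst x, f (snd x) y) \<partial>K) \<partial>(M \<Otimes>\<^sub>M N))" .
qed

abbreviation exp_measure :: "real measure" where
  "exp_measure \<equiv> density lborel (exponential_density 1)"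

definition set_gap :: "nat \<Rightarrow> real \<Rightarrow> particle \<Rightarrow> particle" where
  "set_gap k y x = (is_A x, (gap x)(k := y), step x, mark x)"

definition set_step :: "nat \<Rightarrow> nat \<Rightarrow> particle \<Rightarrow> particle" where
  "set_step k j x = (is_A x, gap x, (step x)(k := j), mark x)"

lemma set_gap_simps [simp]:
  "is_A (set_gap k y x) = is_A x" "gap (set_gap k y x) = (gap x)(k := y)"
  "step (set_gap k y x) = step x" "mark (set_gap k y x) = mark x"
  by (simp_all add: set_gap_def is_A_def gap_def step_def mark_def)

lemma set_step_simps [simp]:
  "is_A (set_step k j x) = is_A x" "gap (set_step k j x) = gap x"
  "step (set_step k j x) = (step x)(k := j)" "mark (set_step k j x) = mark x"
  by (simp_all add: set_step_def is_A_def gap_def step_def mark_def)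

lemma prob_space_exp: "prob_space exp_measure"
  by (rule prob_space_exponential_density) simp

abbreviation "gaps_measure \<equiv> (\<Pi>\<^sub>M n\<in>(UNIV::nat set). exp_measure)"
abbreviation "steps_measure d \<equiv> (\<Pi>\<^sub>M n\<in>(UNIV::nat set). measure_pmf (pmf_of_set {..<d::nat}))"

lemma prob_space_gaps: "prob_space gaps_measure"
  by (intro prob_space_PiM prob_space_exp)
lemma prob_space_steps: "prob_space (steps_measure d)"
  by (intro prob_space_PiM prob_space_measure_pmf)
lemma prob_space_mark: "prob_space (uniform_measure lborel {0..1::real})"
  by (intro prob_space_uniform_measure) auto

lemma measurable_particle [measurable]:
  "is_A \<in> particle_measure d p \<rightarrow>\<^sub>M count_space UNIV"
  "gap \<in> particle_measure d p \<rightarrow>\<^sub>M gaps_measure"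
  "step \<in> particle_measure d p \<rightarrow>\<^sub>M steps_measure d"
  "mark \<in> particle_measure d p \<rightarrow>\<^sub>M uniform_measure lborel {0..1}"
proof -
  have *: "sets (particle_measure d p) = sets (count_space UNIV \<Otimes>\<^sub>M gaps_measure \<Otimes>\<^sub>M steps_measure d
     \<Otimes>\<^sub>M uniform_measure lborel {0..1})"
    unfolding particle_measure_def by (intro sets_pair_measure_cong) auto
  show "is_A \<in> particle_measure d p \<rightarrow>\<^sub>M count_space UNIV"
    "gap \<in> particle_measure d p \<rightarrow>\<^sub>M gaps_measure"
    "step \<in> particle_measure d p \<rightarrow>\<^sub>M steps_measure d"
    "mark \<in> particle_measure d p \<rightarrow>\<^sub>M uniform_measure lborel {0..1}"
    unfolding is_A_def[abs_def] gap_def[abs_def] step_def[abs_def] mark_def[abs_def]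
    by (simp_all add: measurable_cong_sets[OF * refl])
qed

lemma resamples_set_gap: "resamples (particle_measure d p) exp_measure (\<lambda>x y. set_gap k y x)"
proof -
  have g: "resamples gaps_measure exp_measure (\<lambda>x y. x(k := y))"
    using resamples_PiM[of UNIV "\<lambda>_. exp_measure" k exp_measure "\<lambda>x y. y"]
    by (simp add: prob_space_exp resamples_self)
  have "resamples (particle_measure d p) exp_measure
      (\<lambda>x y. (fst x, ((fst (snd x))(k := y), snd (snd x))))"
    unfolding particle_measure_def
    by (intro resamples_pair_right resamples_pair_left[OF _ _ _ g, simplified fst_conv] g
        prob_space_pair prob_space_measure_pmf prob_space_gaps prob_space_steps prob_space_mark prob_space_exp)
  then show ?thesis
    by (simp add: set_gap_def is_A_def gap_def step_def mark_def)
qed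

lemma resamples_set_step:
  "resamples (particle_measure d p) (measure_pmf (pmf_of_set {..<d})) (\<lambda>x j. set_step k j x)"
proof -
  let ?K = "measure_pmf (pmf_of_set {..<d})"
  have g: "resamples (steps_measure d) ?K (\<lambda>x y. x(k := y))"
    using resamples_PiM[of UNIV "\<lambda>_. ?K" k ?K "\<lambda>x y. y"]
    by (simp add: prob_space_measure_pmf resamples_self)
  have "resamples (particle_measure d p) ?K
      (\<lambda>x y. (fst x, (fst (snd x), ((fst (snd (snd x)))(k := y), snd (snd (snd x))))))"
    unfolding particle_measure_def
    by (intro resamples_pair_right[where f = "\<lambda>x y. (fst x, f x y)" for f, simplified] resamples_pair_right
        resamples_pair_left[OF _ _ _ g] g
        prob_space_pair prob_space_measure_pmf prob_space_gaps prob_space_steps prob_space_mark prob_space_exp)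
  then show ?thesis
    by (simp add: set_step_def is_A_def gap_def step_def mark_def)
qed

section \<open>Almost sure regularity\<close>

text \<open>What happens up to the visits at \<open>v\<close> involves only the gaps and steps of \<open>up v js\<close> with index
  below \<open>length js\<close>; later ones are independent of it.\<close>

definition agree :: "nat \<Rightarrow> vertex \<Rightarrow> (vertex \<Rightarrow> particle) \<Rightarrow> (vertex \<Rightarrow> particle) \<Rightarrow> bool" where
  "agree d v \<omega> \<omega>' \<longleftrightarrow> (\<forall>js\<in>lists {..<d}. is_A (\<omega> (up v js)) = is_A (\<omega>' (up v js)) \<and>
     (\<forall>k<length js. gap (\<omega> (up v js)) k = gap (\<omega>' (up v js)) k \<and>
        step (\<omega> (up v js)) k = step (\<omega>' (up v js)) k))"

lemma agree_bt_in: "agree d v \<omega> \<omega>' \<Longrightarrow> j < d \<Longrightarrow> agree d (bt_in v j) \<omega> \<omega>'"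
  unfolding agree_def
proof (intro ballI)
  fix ks assume a: "\<forall>js\<in>lists {..<d}. is_A (\<omega> (up v js)) = is_A (\<omega>' (up v js)) \<and>
     (\<forall>k<length js. gap (\<omega> (up v js)) k = gap (\<omega>' (up v js)) k \<and>
        step (\<omega> (up v js)) k = step (\<omega>' (up v js)) k)" and "j < d" "ks \<in> lists {..<d}"
  then have "j # ks \<in> lists {..<d}" by simp
  from bspec[OF a this] show "is_A (\<omega> (up (bt_in v j) ks)) = is_A (\<omega>' (up (bt_in v j) ks)) \<and>
     (\<forall>k<length ks. gap (\<omega> (up (bt_in v j) ks)) k = gap (\<omega>' (up (bt_in v j) ks)) k \<and>
        step (\<omega> (up (bt_in v j) ks)) k = step (\<omega>' (up (bt_in v j) ks)) k)"
    by simp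
qed

lemma agree_arrival: "agree d v \<omega> \<omega>' \<Longrightarrow> js \<in> lists {..<d} \<Longrightarrow> arrival \<omega> v js = arrival \<omega>' v js"
  unfolding arrival_def jump_time_def agree_def by (intro sum.cong) auto

lemma agree_free_visit: "agree d v \<omega> \<omega>' \<Longrightarrow> free_visit d \<omega> v js \<longleftrightarrow> free_visit d \<omega>' v js"
proof (cases "js \<in> lists {..<d}")
  case True
  assume "agree d v \<omega> \<omega>'"
  with True have "back_path (step (\<omega> (up v js))) (length js) = back_path (step (\<omega>' (up v js))) (length js)"
    unfolding back_path_def agree_def by (intro arg_cong[where f = rev] map_cong) auto
  then show ?thesis by (simp add: free_visit_def)
qed (auto simp: free_visit_def)

lemma agree_arrives:
  assumes "agree d v \<omega> \<omega>'" "\<And>j ks. j < d \<Longrightarrow> X (bt_in v j) ks \<longleftrightarrow> X' (bt_in v j) ks" "js \<in> lists {..<d}"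
  shows "arrives \<omega> X v js \<longleftrightarrow> arrives \<omega>' X' v js"
proof (cases js)
  case (Cons j ks)
  with bspec[OF assms(1)[unfolded agree_def] assms(3)]
  have "step (\<omega> (up v js)) (length ks) = step (\<omega>' (up v js)) (length ks)"
    by simp
  with Cons assms(2,3) show ?thesis by auto
qed simp

lemma agree_survives:
  assumes "agree d v \<omega> \<omega>'" "\<And>j ks. j < d \<Longrightarrow> X (bt_in v j) ks \<longleftrightarrow> X' (bt_in v j) ks"
  shows "survives d \<omega> X v js \<longleftrightarrow> survives d \<omega>' X' v js"
proof -
  have "is_A (\<omega> v) \<longleftrightarrow> is_A (\<omega>' v)" using assms(1) unfolding agree_def by (auto dest: bspec[of _ _ "[]"])
  moreover have "arrives \<omega> X v ks \<longleftrightarrow> arrives \<omega>' X' v ks" if "ks \<in> lists {..<d}" for ks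
    using agree_arrives[OF assms(1), where X = X and X' = X'] assms(2) that by blast
  moreover note agree_arrival[OF assms(1)]
  ultimately show ?thesis unfolding survives_def by (smt (verit, best))
qed

lemma agree_lower: "agree d v \<omega> \<omega>' \<Longrightarrow> lower d \<omega> n v js \<longleftrightarrow> lower d \<omega>' n v js"
proof (induction n arbitrary: v js)
  case (Suc n)
  show ?case unfolding lower_simps
    using Suc.prems by (intro agree_survives Suc.IH agree_bt_in)
qed (simp add: lower_simps)

lemma agree_upper: "agree d v \<omega> \<omega>' \<Longrightarrow> upper d \<omega> n v js \<longleftrightarrow> upper d \<omega>' n v js"
proof (induction n arbitrary: v js)
  case (Suc n)
  show ?case unfolding upper_simps
    using Suc.prems by (intro agree_survives Suc.IH agree_bt_in)
qed (simp add: upper_simps agree_free_visit)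

lemma agree_visits: "agree d v \<omega> \<omega>' \<Longrightarrow> visits d \<omega> v js \<longleftrightarrow> visits d \<omega>' v js"
  unfolding visits_def using agree_lower by blast

abbreviation upd_gap :: "'v \<Rightarrow> nat \<Rightarrow> ('v \<Rightarrow> particle) \<Rightarrow> real \<Rightarrow> ('v \<Rightarrow> particle)" where
  "upd_gap u k \<omega> y \<equiv> (\<omega>)(u := set_gap k y (\<omega> u))"

abbreviation upd_step :: "'v \<Rightarrow> nat \<Rightarrow> ('v \<Rightarrow> particle) \<Rightarrow> nat \<Rightarrow> ('v \<Rightarrow> particle)" where
  "upd_step u k \<omega> i \<equiv> (\<omega>)(u := set_step k i (\<omega> u))"

text \<open>The gap with index \<open>length js\<close> is the holding time at \<open>v\<close>, and
  by \<open>inj_up\<close> no other list names the same particle. This is why holding times, and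
  likewise the steps out of \<open>v\<close>, are independent of the visits at
  \<open>v\<close>.\<close>

lemma agree_upd_gap: "length js \<le> k \<Longrightarrow> agree d v (upd_gap (up v js) k \<omega> y) \<omega>"
  unfolding agree_def by (auto dest: inj_up)

lemma agree_upd_step: "length js \<le> k \<Longrightarrow> agree d v (upd_step (up v js) k \<omega> i) \<omega>"
  unfolding agree_def by (auto dest: inj_up)

section \<open>Exponential moments and discounted sums\<close>

lemma nn_integral_exp_measure_exp: "(\<integral>\<^sup>+y. ennreal (exp (- y)) \<partial>exp_measure) = ennreal (1 / 2)"
proof -
  interpret E: prob_space "density lborel (exponential_density 2)"
    by (rule prob_space_exponential_density) simp
  have "(\<integral>\<^sup>+y. ennreal (exp (- y)) \<partial>exp_measure) =
      (\<integral>\<^sup>+y. ennreal (exponential_density 1 y) * ennreal (exp (- y)) \<partial>lborel)"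
    by (subst nn_integral_density) auto
  also have "\<dots> = (\<integral>\<^sup>+y. ennreal (1/2) * ennreal (exponential_density 2 y) \<partial>lborel)"
  proof (intro nn_integral_cong)
    fix y :: real
    \<comment> \<open>The discounted Exp(1) density is half the Exp(2) density, whence the value
      1/2.\<close>
    have "exponential_density 1 y * exp (- y) = 1 / 2 * exponential_density 2 y"
      by (simp add: exponential_density_def mult_exp_exp)
    then show "ennreal (exponential_density 1 y) * ennreal (exp (- y)) =
        ennreal (1 / 2) * ennreal (exponential_density 2 y)"
      by (metis ennreal_mult'' exp_ge_zero exponential_density_nonneg zero_less_numeral)
  qed
  also have "\<dots> = ennreal (1/2) * (\<integral>\<^sup>+y. ennreal (exponential_density 2 y) \<partial>lborel)"
    by (rule nn_integral_cmult) auto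
  also have "(\<integral>\<^sup>+y. ennreal (exponential_density 2 y) \<partial>lborel) = 1"
    using E.emeasure_space_1 by (subst (asm) emeasure_density) auto
  finally show ?thesis by simp
qed

text \<open>\<open>y * exp (- y)\<close> is itself a probability density, the Erlang density of
  shape 2.\<close>

lemma nn_integral_exp_measure_ident: "(\<integral>\<^sup>+y. ennreal y \<partial>exp_measure) = 1"
proof -
  have "(\<integral>\<^sup>+y. ennreal y \<partial>exp_measure) =
      (\<integral>\<^sup>+y. ennreal (exponential_density 1 y) * ennreal y \<partial>lborel)"
    by (subst nn_integral_density) auto
  also have "\<dots> = (\<integral>\<^sup>+y. ennreal (erlang_density 1 1 y) \<partial>lborel)"
    by (intro nn_integral_cong) (auto simp: exponential_density_def erlang_density_def ennreal_mult'[symmetric])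
  also have "\<dots> = 1"
    using prob_space.emeasure_space_1[OF prob_space_erlang_density[of 1 1, OF zero_less_one]]
    by (subst (asm) emeasure_density) auto
  finally show ?thesis .
qed

lemma exp_measure_singleton: "emeasure exp_measure {c} = 0"
  by (subst emeasure_density) (auto intro!: nn_integral_null_set)

lemma exp_measure_nonpos: "emeasure exp_measure {..0} = 0"
proof -
  have "AE x in lborel. x \<noteq> (0::real)" by (rule AE_lborel_singleton)
  then show ?thesis
    by (subst emeasure_density)
      (auto simp: nn_integral_0_iff_AE exponential_density_def split: split_indicator)
qed

text \<open>Sums over visits are written as integrals so that Tonelli's theorem and monotone
  convergence apply to them.\<close>

definition nsum :: "'a set \<Rightarrow> ('a \<Rightarrow> ennreal) \<Rightarrow> ennreal" where
  "nsum A f = (\<integral>\<^sup>+x. f x \<partial>count_space A)"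

lemma nsum_mono_set: "A \<subseteq> B \<Longrightarrow> nsum A f \<le> nsum B f"
  unfolding nsum_def
  by (subst (1 2) nn_integral_count_space_indicator)
    (auto intro!: nn_integral_mono split: split_indicator)

lemma nsum_subset: "A \<subseteq> B \<Longrightarrow> nsum A f = nsum B (\<lambda>x. f x * indicator A x)"
  unfolding nsum_def
  by (subst (1 2) nn_integral_count_space_indicator)
    (auto intro!: nn_integral_cong split: split_indicator)

text \<open>Splits the visits at a vertex by the arc along which they arrive, with the vertex's own
  particle apart.\<close>

lemma nsum_lists:
  "nsum (lists {..<d::nat}) f = f [] + (\<Sum>j<d. nsum (lists {..<d}) (\<lambda>ks. f (j # ks)))"
proof -
  let ?L = "lists {..<d}" and ?C = "\<lambda>j. (#) j ` lists {..<d}"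
  have "nsum ?L f = (\<integral>\<^sup>+js. f [] * indicator {[]} js + (\<Sum>j<d. f js * indicator (?C j) js) \<partial>count_space ?L)"
    unfolding nsum_def
  proof (intro nn_integral_cong)
    fix js assume "js \<in> space (count_space ?L)"
    then have js: "js \<in> ?L" by simp
    show "f js = f [] * indicator {[]} js + (\<Sum>j<d. f js * indicator (?C j) js)"
    proof (cases js)
      case (Cons i ks)
      then have "(\<Sum>j<d. f js * indicator (?C j) js) = (\<Sum>j<d. if j = i then f js else 0)"
        using js by (intro sum.cong) (auto split: split_indicator)
      with Cons js show ?thesis by simp
    qed (auto intro!: sum.neutral)
  qed
  also have "\<dots> = (\<integral>\<^sup>+js. f [] * indicator {[]} js \<partial>count_space ?L) +
      (\<Sum>j<d. \<integral>\<^sup>+js. f js * indicator (?C j) js \<partial>count_space ?L)"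
    by (subst nn_integral_add, simp, simp, subst nn_integral_sum) simp_all
  also have "(\<integral>\<^sup>+js. f [] * indicator {[]} js \<partial>count_space ?L) = f []"
    by (subst nn_integral_cmult_indicator) auto
  also have "(\<Sum>j<d. \<integral>\<^sup>+js. f js * indicator (?C j) js \<partial>count_space ?L) = (\<Sum>j<d. nsum ?L (\<lambda>ks. f (j # ks)))"
  proof (intro sum.cong refl)
    fix j assume "j \<in> {..<d}"
    then have sub: "?C j \<subseteq> ?L" by auto
    have "(\<integral>\<^sup>+js. f js * indicator (?C j) js \<partial>count_space ?L) = (\<integral>\<^sup>+js. f js \<partial>count_space (?C j))"
      using nsum_subset[OF sub, of f] by (simp add: nsum_def)
    also have "\<dots> = (\<integral>\<^sup>+ks. f (j # ks) \<partial>count_space ?L)"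
      by (rule nn_integral_bij_count_space[symmetric]) (auto simp: bij_betw_def)
    finally show "(\<integral>\<^sup>+js. f js * indicator (?C j) js \<partial>count_space ?L) = nsum ?L (\<lambda>ks. f (j # ks))"
      by (simp add: nsum_def)
  qed
  finally show ?thesis .
qed

text \<open>There are \<open>d ^ k\<close> lists of length \<open>k\<close>, so the levels
  contribute a geometric series of ratio 1/2.\<close>

lemma nsum_lists_length:
  assumes "d > 0"
  shows "nsum (lists {..<d::nat}) (\<lambda>js. ennreal ((1 / (2 * d)) ^ length js)) = 2"
proof -
  let ?L = "lists {..<d}"
  let ?f = "\<lambda>js. ennreal ((1 / (2 * d)) ^ length js)"
  have fin: "finite {js \<in> ?L. length js = k}" for k
    using finite_lists_length_eq[of "{..<d}" k] by (auto elim!: finite_subset[rotated])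
  have c: "card {js \<in> ?L. length js = k} = d ^ k" for k
    using card_lists_length_eq[of "{..<d}" k] by (simp add: in_lists_conv_set subset_iff Ball_def)
  have "nsum ?L ?f = (\<integral>\<^sup>+js. \<integral>\<^sup>+k. (if length js = k then ?f js else 0) \<partial>count_space UNIV \<partial>count_space ?L)"
    unfolding nsum_def
  proof (intro nn_integral_cong)
    fix js :: "nat list"
    have "(\<integral>\<^sup>+k. (if length js = k then ?f js else 0) \<partial>count_space UNIV) =
        (\<integral>\<^sup>+k. ?f js * indicator {length js} k \<partial>count_space UNIV)"
      by (intro nn_integral_cong) (auto split: split_indicator)
    also have "\<dots> = ?f js" by (subst nn_integral_cmult_indicator) auto
    finally show "?f js = (\<integral>\<^sup>+k. (if length js = k then ?f js else 0) \<partial>count_space UNIV)" by simp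
  qed
  also have "\<dots> = (\<integral>\<^sup>+k. \<integral>\<^sup>+js. (if length js = k then ?f js else 0) \<partial>count_space ?L \<partial>count_space UNIV)"
    by (intro nn_integral_count_space_nn_integral) auto
  also have "\<dots> = (\<integral>\<^sup>+k. ennreal ((1 / 2) ^ k) \<partial>count_space UNIV)"
  proof (intro nn_integral_cong)
    fix k :: nat
    have "(\<integral>\<^sup>+js. (if length js = k then ?f js else 0) \<partial>count_space ?L) =
        (\<integral>\<^sup>+js. ennreal ((1 / (2 * d)) ^ k) * indicator {js \<in> ?L. length js = k} js \<partial>count_space ?L)"
      by (intro nn_integral_cong) (auto split: split_indicator)
    also have "\<dots> = ennreal ((1 / (2 * d)) ^ k) * of_nat (card {js \<in> ?L. length js = k})"
      using fin by (subst nn_integral_cmult_indicator) (auto simp: emeasure_count_space)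
    also have "\<dots> = ennreal ((1 / 2) ^ k)"
      using assms by (simp add: c ennreal_of_nat_eq_real_of_nat ennreal_mult'[symmetric] power_mult_distrib
        power_divide field_simps flip: ennreal_mult)
    finally show "(\<integral>\<^sup>+js. (if length js = k then ?f js else 0) \<partial>count_space ?L) = ennreal ((1 / 2) ^ k)" .
  qed
  also have "\<dots> = (\<Sum>k. ennreal ((1 / 2) ^ k))"
    by (rule nn_integral_count_space_nat)
  also have "\<dots> = ennreal 2"
    using geometric_sums[of "1/2::real"] by (intro suminf_ennreal_eq) auto
  finally show ?thesis by simp
qed

text \<open>Each of these elements contributes at least \<open>exp (- t)\<close> to a finite
  sum.\<close>

lemma finite_of_nsum_exp:
  assumes "nsum A (\<lambda>x. if Q x then ennreal (exp (- f x)) else 0) \<noteq> \<infinity>"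
  shows "finite {x \<in> A. Q x \<and> f x \<le> t}"
proof (rule ccontr)
  let ?S = "{x \<in> A. Q x \<and> f x \<le> t}"
  assume "infinite ?S"
  then have "\<infinity> = ennreal (exp (- t)) * emeasure (count_space A) ?S"
    by (subst emeasure_count_space_infinite) (auto simp: ennreal_mult_top)
  also have "\<dots> = (\<integral>\<^sup>+x. ennreal (exp (- t)) * indicator ?S x \<partial>count_space A)"
    by (rule nn_integral_cmult_indicator[symmetric]) auto
  also have "\<dots> \<le> nsum A (\<lambda>x. if Q x then ennreal (exp (- f x)) else 0)"
    unfolding nsum_def by (intro nn_integral_mono) (auto split: split_indicator)
  finally show False using assms by (simp add: top_unique)
qed

text \<open>\<open>P\<close> and \<open>Q\<close> are the arrivals at a vertex in two systems, and a \<open>B\<close>-particle there removes the first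
  arrival \<open>a\<close> of \<open>P\<close> and the first arrival \<open>b\<close> of \<open>Q\<close>. If they differ, \<open>b\<close> becomes a discrepancy
  in place of the earlier and hence heavier \<open>a\<close>.\<close>

lemma nsum_survivors_le:
  fixes t :: "'a \<Rightarrow> real"
  assumes "Q \<subseteq> P" and inj: "inj_on t P" and fin: "\<And>c. finite {x \<in> P. t x \<le> c}"
  shows "nsum ({x\<in>P. \<exists>y\<in>P. t y < t x} - {x\<in>Q. \<exists>y\<in>Q. t y < t x}) (\<lambda>x. ennreal (exp (- t x)))
    \<le> nsum (P - Q) (\<lambda>x. ennreal (exp (- t x)))" (is "nsum ?S ?w \<le> _")
proof -
  have least: "\<exists>a\<in>R. \<forall>y\<in>R. t a \<le> t y" if "R \<subseteq> P" "R \<noteq> {}" for R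
  proof -
    from that obtain c where c: "c \<in> R" by blast
    let ?R = "{x \<in> R. t x \<le> t c}"
    have "finite ?R" using that by (intro finite_subset[OF _ fin[of "t c"]]) auto
    moreover have "?R \<noteq> {}" using c by auto
    ultimately obtain a where "a \<in> ?R" "\<And>y. y \<in> ?R \<Longrightarrow> \<not> t y < t a"
      using ex_is_arg_min_if_finite[of ?R t] by (auto simp: is_arg_min_def)
    then show ?thesis by (intro bexI[of _ a]) force+
  qed
  \<comment> \<open>Weights decrease in time, so it is enough to inject the surviving discrepancies
    into the arriving ones by a map that never goes to a later time.\<close>
  have le: "nsum ?S ?w \<le> nsum (P - Q) ?w"
    if g: "inj_on g ?S" "g ` ?S \<subseteq> P - Q" "\<And>x. x \<in> ?S \<Longrightarrow> t (g x) \<le> t x" for g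
  proof -
    have "nsum ?S ?w \<le> (\<integral>\<^sup>+x. ?w (g x) \<partial>count_space ?S)"
      unfolding nsum_def using g(3) by (intro nn_integral_mono) (simp add: ennreal_leI)
    also have "\<dots> = (\<integral>\<^sup>+x. ?w x \<partial>count_space (g ` ?S))"
      by (rule nn_integral_bij_count_space) (use g(1) in \<open>simp add: bij_betw_def\<close>)
    also have "\<dots> \<le> nsum (P - Q) ?w"
      using nsum_mono_set[OF g(2)] by (simp add: nsum_def)
    finally show ?thesis .
  qed
  show ?thesis
  proof (cases "Q = {}")
    case True
    then show ?thesis by (intro le[of id]) auto
  next
    case False
    with assms(1) have "P \<noteq> {}" by auto
    from least[OF assms(1) False] obtain b where b: "b \<in> Q" "\<And>y. y \<in> Q \<Longrightarrow> t b \<le> t y" by blast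
    from least[OF order_refl \<open>P \<noteq> {}\<close>] obtain a where a: "a \<in> P" "\<And>y. y \<in> P \<Longrightarrow> t a \<le> t y" by blast
    \<comment> \<open>A surviving discrepancy that lies in \<open>Q\<close> has no earlier element
      in \<open>Q\<close>, so it is the first arrival \<open>b\<close>.\<close>
    have xb: "x = b" if "x \<in> ?S" "x \<in> Q" for x
    proof (rule inj_onD[OF inj])
      show "t x = t b" using that b by (intro antisym) (auto simp: not_less)
    qed (use that b assms(1) in auto)
    have na: "a \<notin> ?S" using a by (auto simp: not_less[symmetric])
    have aQ: "a \<notin> Q" if "b \<in> ?S"
    proof
      assume "a \<in> Q"
      then have "t a = t b" using a b assms(1) by (intro antisym) auto
      then have "a = b" using inj a b assms(1) by (auto dest: inj_onD)
      with na that show False by blast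
    qed
    show ?thesis
    proof (rule le[of "\<lambda>x. if x = b then a else x"])
      show "inj_on (\<lambda>x. if x = b then a else x) ?S" using na by (auto simp: inj_on_def)
      show "(\<lambda>x. if x = b then a else x) ` ?S \<subseteq> P - Q"
      proof (rule image_subsetI)
        fix x assume x: "x \<in> ?S"
        show "(if x = b then a else x) \<in> P - Q"
        proof (cases "x = b")
          case True
          with x aQ a(1) show ?thesis by simp
        next
          case False
          with x xb[OF x] show ?thesis by auto
        qed
      qed
      show "t (if x = b then a else x) \<le> t x" if "x \<in> ?S" for x using a b assms(1) by auto
    qed
  qed
qed

lemma nsum_nn_integral:
  assumes "countable A" "\<And>x. x \<in> A \<Longrightarrow> f x \<in> borel_measurable M"
  shows "(\<integral>\<^sup>+\<omega>. nsum A (\<lambda>x. f x \<omega>) \<partial>M) = nsum A (\<lambda>x. \<integral>\<^sup>+\<omega>. f x \<omega> \<partial>M)"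
  unfolding nsum_def using assms by (rule nn_integral_count_space_nn_integral)

lemma nsum_cong: "(\<And>x. x \<in> A \<Longrightarrow> f x = g x) \<Longrightarrow> nsum A f = nsum A g"
  unfolding nsum_def by (intro nn_integral_cong) simp

lemma nsum_mono: "(\<And>x. x \<in> A \<Longrightarrow> f x \<le> g x) \<Longrightarrow> nsum A f \<le> nsum A g"
  unfolding nsum_def by (intro nn_integral_mono) simp

lemma nsum_cmult: "nsum A (\<lambda>x. c * f x) = c * nsum A f"
  unfolding nsum_def by (rule nn_integral_cmult) simp

lemma nsum_ge: "x \<in> A \<Longrightarrow> f x \<le> nsum A f"
proof -
  assume "x \<in> A"
  then have "f x = nsum A (\<lambda>y. f y * indicator {x} y)"
    using nsum_subset[of "{x}" A f] by (simp add: nsum_def nn_integral_count_space_finite)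
  also have "\<dots> \<le> nsum A f" by (intro nsum_mono) (auto split: split_indicator)
  finally show ?thesis .
qed

lemma nsum_If: "nsum A (\<lambda>x. if Q x then f x else 0) = nsum {x \<in> A. Q x} f"
proof -
  have "{x \<in> A. Q x} \<subseteq> A" by auto
  from nsum_subset[OF this, of f] show ?thesis
    by (auto intro!: nsum_cong split: split_indicator)
qed

lemma nsum_measurable:
  assumes "countable A" and f: "\<And>x. x \<in> A \<Longrightarrow> f x \<in> borel_measurable M"
  shows "(\<lambda>\<omega>. nsum A (\<lambda>x. f x \<omega>)) \<in> borel_measurable M"
proof (cases "finite A")
  case True
  then show ?thesis using f by (simp add: nsum_def nn_integral_count_space_finite)
next
  case False
  note bij = bij_betw_from_nat_into[OF assms(1) False]
  have "nsum A g = (\<Sum>n. g (from_nat_into A n))" for g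
    unfolding nsum_def
    by (simp add: nn_integral_bij_count_space[symmetric, OF bij] nn_integral_count_space_nat)
  moreover have "f (from_nat_into A n) \<in> borel_measurable M" for n
    using False by (intro f from_nat_into) auto
  ultimately show ?thesis by simp
qed

locale dlas_tree =
  fixes d :: nat and p :: real
  assumes d: "2 \<le> d" and p: "0 \<le> p" "p \<le> 1"
begin

abbreviation "V \<equiv> bt_verts d"
abbreviation "L \<equiv> lists {..<d}"

definition M :: "(vertex \<Rightarrow> particle) measure" where
  "M = dlas_measure d V p"

lemma M_PiM: "M = (\<Pi>\<^sub>M v\<in>V. particle_measure d p)"
  by (simp add: M_def dlas_measure_def)

sublocale M: prob_space M
  unfolding M_def by (rule prob_space_dlas_measure)

lemma countable_L: "countable (L :: nat list set)"
  by simp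

lemma measurable_component_M [measurable (raw)]: "u \<in> V \<Longrightarrow> (\<lambda>\<omega>. \<omega> u) \<in> M \<rightarrow>\<^sub>M particle_measure d p"
  unfolding M_PiM by (rule measurable_component_singleton)

lemma measurable_gap: "u \<in> V \<Longrightarrow> (\<lambda>\<omega>. gap (\<omega> u) k) \<in> borel_measurable M"
proof -
  assume [measurable]: "u \<in> V"
  have "(\<lambda>\<omega>. gap (\<omega> u) k) \<in> M \<rightarrow>\<^sub>M exp_measure" by measurable
  then show ?thesis by simp
qed

lemma measurable_step: "u \<in> V \<Longrightarrow> (\<lambda>\<omega>. step (\<omega> u) k) \<in> M \<rightarrow>\<^sub>M count_space UNIV"
proof -
  assume [measurable]: "u \<in> V"
  have "(\<lambda>\<omega>. step (\<omega> u) k) \<in> M \<rightarrow>\<^sub>M measure_pmf (pmf_of_set {..<d})" by measurable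
  then show ?thesis by simp
qed

lemma measurable_is_A: "u \<in> V \<Longrightarrow> Measurable.pred M (\<lambda>\<omega>. is_A (\<omega> u))"
  by measurable

lemma measurable_arrival: "v \<in> V \<Longrightarrow> js \<in> L \<Longrightarrow> (\<lambda>\<omega>. arrival \<omega> v js) \<in> borel_measurable M"
  unfolding arrival_def jump_time_def
  by (intro borel_measurable_sum measurable_gap up_in_verts)

lemma pred_step_eq: "u \<in> V \<Longrightarrow> Measurable.pred M (\<lambda>\<omega>. step (\<omega> u) k = j)"
  using measurable_step[of u k] by measurable

lemma measurable_free_visit: "v \<in> V \<Longrightarrow> Measurable.pred M (\<lambda>\<omega>. free_visit d \<omega> v js)"
proof (induction js arbitrary: v)
  case (Cons j js)
  have *: "free_visit d \<omega> v (j # js) \<longleftrightarrow> j < d \<and> free_visit d \<omega> (bt_in v j) js \<and> step (\<omega> (up v (j # js))) (length js) = j" for \<omega>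
    by (auto simp: free_visit_def)
  show ?case
  proof (cases "j # js \<in> L")
    case True
    then have [measurable]: "Measurable.pred M (\<lambda>\<omega>. free_visit d \<omega> (bt_in v j) js)"
      "Measurable.pred M (\<lambda>\<omega>. step (\<omega> (up v (j # js))) (length js) = j)"
      using Cons by (auto intro!: Cons.IH pred_step_eq up_in_verts bt_in_in_verts simp del: up.simps)
    show ?thesis unfolding * by measurable
  next
    case False
    then have "free_visit d \<omega> v (j # js) = False" for \<omega> by (auto simp: free_visit_def)
    then show ?thesis by simp
  qed
qed (simp add: free_visit_def)

lemma measurable_arrives:
  assumes X: "\<And>w ks. w \<in> V \<Longrightarrow> Measurable.pred M (\<lambda>\<omega>. X \<omega> w ks)" and v: "v \<in> V" and js: "js \<in> L"
  shows "Measurable.pred M (\<lambda>\<omega>. arrives \<omega> (X \<omega>) v js)"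
proof (cases js)
  case (Cons j ks)
  then have [measurable]: "Measurable.pred M (\<lambda>\<omega>. X \<omega> (bt_in v j) ks)"
      "Measurable.pred M (\<lambda>\<omega>. step (\<omega> (up v (j # ks))) (length ks) = j)"
    using v js by (auto intro!: X pred_step_eq up_in_verts bt_in_in_verts)
  show ?thesis unfolding Cons arrives.simps by measurable
qed simp

lemma measurable_survives:
  assumes X: "\<And>w ks. w \<in> V \<Longrightarrow> Measurable.pred M (\<lambda>\<omega>. X \<omega> w ks)" and v: "v \<in> V"
  shows "Measurable.pred M (\<lambda>\<omega>. survives d \<omega> (X \<omega>) v js)"
proof (cases "js \<in> L")
  case True
  note [measurable] = measurable_arrives[OF X v] measurable_arrival[OF v] measurable_is_A[OF v] countable_L True
  show ?thesis
  proof (cases "js = []")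
    case False
    then have eq: "survives d \<omega> (X \<omega>) v js \<longleftrightarrow> arrives \<omega> (X \<omega>) v js \<and>
        (is_A (\<omega> v) \<or> (\<exists>ks\<in>L. arrives \<omega> (X \<omega>) v ks \<and> arrival \<omega> v ks < arrival \<omega> v js))" for \<omega>
      using True by (simp add: survives_def)
    show ?thesis unfolding eq by measurable
  qed (simp add: survives_def measurable_is_A[OF v])
qed (simp add: survives_def)

lemma measurable_lower: "v \<in> V \<Longrightarrow> Measurable.pred M (\<lambda>\<omega>. lower d \<omega> n v js)"
proof (induction n arbitrary: v js)
  case (Suc n)
  then show ?case unfolding lower_simps by (intro measurable_survives)
qed (simp add: lower_simps)

lemma measurable_upper: "v \<in> V \<Longrightarrow> Measurable.pred M (\<lambda>\<omega>. upper d \<omega> n v js)"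
proof (induction n arbitrary: v js)
  case (Suc n)
  then show ?case unfolding upper_simps by (intro measurable_survives)
qed (simp add: upper_simps measurable_free_visit)

lemma measurable_visits: "v \<in> V \<Longrightarrow> Measurable.pred M (\<lambda>\<omega>. visits d \<omega> v js)"
  unfolding visits_def by (intro pred_intros_countable measurable_lower)

lemma resamples_gap: "u \<in> V \<Longrightarrow> resamples M exp_measure (upd_gap u k)"
  unfolding M_PiM
  by (rule resamples_PiM) (auto intro: prob_space_particle_measure prob_space_exp resamples_set_gap)

lemma resamples_step: "u \<in> V \<Longrightarrow> resamples M (measure_pmf (pmf_of_set {..<d})) (upd_step u k)"
  unfolding M_PiM
  by (rule resamples_PiM) (auto intro: prob_space_particle_measure prob_space_measure_pmf resamples_set_step)

text \<open>\<open>inv\<close> says that \<open>F\<close> does not look at this gap, so redrawing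
  the gap integrates it out alone. The lemma for steps works in the same way.\<close>

lemma nn_integral_gap:
  assumes u: "u \<in> V" and [measurable]: "F \<in> borel_measurable M" "h \<in> borel_measurable borel"
    and inv: "\<And>\<omega> y. F (upd_gap u k \<omega> y) = F \<omega>"
  shows "(\<integral>\<^sup>+\<omega>. F \<omega> * h (gap (\<omega> u) k) \<partial>M) = (\<integral>\<^sup>+\<omega>. F \<omega> \<partial>M) * (\<integral>\<^sup>+y. h y \<partial>exp_measure)"
proof -
  have [measurable]: "(\<lambda>\<omega>. gap (\<omega> u) k) \<in> borel_measurable M" by (rule measurable_gap[OF u])
  have "(\<integral>\<^sup>+\<omega>. F \<omega> * h (gap (\<omega> u) k) \<partial>M) = (\<integral>\<^sup>+\<omega>. (\<integral>\<^sup>+y. F \<omega> * h y \<partial>exp_measure) \<partial>M)"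
    by (subst resamples_integral[OF resamples_gap[OF u, of k]]) (simp_all add: inv)
  then show ?thesis by (simp add: nn_integral_cmult nn_integral_multc)
qed

lemma nn_integral_step:
  assumes u: "u \<in> V" and [measurable]: "F \<in> borel_measurable M"
    and inv: "\<And>\<omega> i. F (upd_step u k \<omega> i) = F \<omega>" and j: "j < d"
  shows "(\<integral>\<^sup>+\<omega>. F \<omega> * (if step (\<omega> u) k = j then a else b) \<partial>M) =
    (\<integral>\<^sup>+\<omega>. F \<omega> * (ennreal (1 / real d) * a + ennreal (1 - 1 / real d) * b) \<partial>M)"
proof -
  let ?K = "measure_pmf (pmf_of_set {..<d})"
  have [measurable]: "Measurable.pred M (\<lambda>\<omega>. step (\<omega> u) k = j)" by (rule pred_step_eq[OF u])
  have "(\<integral>\<^sup>+i. (if i = j then a else b) \<partial>?K) = (\<integral>\<^sup>+i. a * indicator {j} i + b * indicator (- {j}) i \<partial>?K)"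
    by (intro nn_integral_cong) (auto split: split_indicator)
  also have "\<dots> = a * emeasure ?K {j} + b * emeasure ?K (- {j})"
    by (subst nn_integral_add) (auto simp: nn_integral_cmult_indicator)
  also have "emeasure ?K {j} = ennreal (1 / real d)"
    using j using d by (simp add: emeasure_pmf_single pmf_of_set lessThan_empty_iff)
  also have "emeasure ?K (- {j}) = ennreal (1 - 1 / real d)"
    using j d measure_pmf.prob_compl[of "{j}" "pmf_of_set {..<d}"]
    by (simp add: measure_pmf.emeasure_eq_measure Compl_eq_Diff_UNIV measure_pmf_single lessThan_empty_iff)
  finally have K: "(\<integral>\<^sup>+i. (if i = j then a else b) \<partial>?K) = ennreal (1 / real d) * a + ennreal (1 - 1 / real d) * b"
    by (simp add: mult.commute)
  have "(\<integral>\<^sup>+\<omega>. F \<omega> * (if step (\<omega> u) k = j then a else b) \<partial>M) =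
      (\<integral>\<^sup>+\<omega>. (\<integral>\<^sup>+i. F \<omega> * (if i = j then a else b) \<partial>?K) \<partial>M)"
    by (subst resamples_integral[OF resamples_step[OF u, of k]]) (simp_all add: inv)
  also have "\<dots> = (\<integral>\<^sup>+\<omega>. F \<omega> * (ennreal (1 / real d) * a + ennreal (1 - 1 / real d) * b) \<partial>M)"
    by (simp add: nn_integral_cmult K)
  finally show ?thesis .
qed

section \<open>Discounted visits, finiteness and absence of ties\<close>

definition weight :: "(vertex \<Rightarrow> particle) \<Rightarrow> vertex \<Rightarrow> nat list \<Rightarrow> ennreal" where
  "weight \<omega> v js = ennreal (exp (- arrival \<omega> v js))"

lemma measurable_weight: "v \<in> V \<Longrightarrow> js \<in> L \<Longrightarrow> (\<lambda>\<omega>. weight \<omega> v js) \<in> borel_measurable M"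
  unfolding weight_def using measurable_arrival[of v js] by measurable

lemma measurable_If_weight:
  assumes "v \<in> V" "js \<in> L" "Measurable.pred M Q"
  shows "(\<lambda>\<omega>. if Q \<omega> then weight \<omega> v js else 0) \<in> borel_measurable M"
  using measurable_weight[OF assms(1,2)] assms(3) by measurable

text \<open>The last move into \<open>v\<close> costs \<open>1 / d\<close> for its direction and 1/2
  for its discounted duration. Both have index \<open>length ks\<close>, which neither
  \<open>Q\<close> nor the arrival at \<open>bt_in v j\<close> sees.\<close>

lemma nn_integral_weight_Cons:
  assumes v: "v \<in> V" and js: "j < d" "ks \<in> L"
    and Q [measurable]: "Measurable.pred M Q"
    and inv: "\<And>\<omega> \<omega>'. agree d (bt_in v j) \<omega> \<omega>' \<Longrightarrow> Q \<omega> \<longleftrightarrow> Q \<omega>'"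
  shows "(\<integral>\<^sup>+\<omega>. (if Q \<omega> \<and> step (\<omega> (up v (j # ks))) (length ks) = j then weight \<omega> v (j # ks) else 0) \<partial>M)
    = ennreal (1 / (2 * real d)) * (\<integral>\<^sup>+\<omega>. (if Q \<omega> then weight \<omega> (bt_in v j) ks else 0) \<partial>M)"
proof -
  let ?w = "bt_in v j" and ?k = "length ks"
  let ?u = "up ?w ks"
  have w: "?w \<in> V" and u: "?u \<in> V" using v js by (auto intro!: bt_in_in_verts up_in_verts)
  note [measurable] = measurable_weight[OF w js(2)] pred_step_eq[OF u] measurable_gap[OF u]
  let ?F = "\<lambda>\<omega>. if Q \<omega> then weight \<omega> ?w ks else 0"
  have half: "ennreal (1 / real d) * ennreal (1 / 2) = ennreal (1 / (2 * real d))"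
    by (subst ennreal_mult[symmetric]) auto
  have F: "?F \<omega> = ?F \<omega>'" if "agree d ?w \<omega> \<omega>'" for \<omega> \<omega>'
    using inv[OF that] agree_arrival[OF that js(2)] by (simp add: weight_def)
  have "(\<integral>\<^sup>+\<omega>. (if Q \<omega> \<and> step (\<omega> (up v (j # ks))) ?k = j then weight \<omega> v (j # ks) else 0) \<partial>M) =
      (\<integral>\<^sup>+\<omega>. (?F \<omega> * (if step (\<omega> ?u) ?k = j then 1 else 0)) * ennreal (exp (- gap (\<omega> ?u) ?k)) \<partial>M)"
    by (intro nn_integral_cong)
      (auto simp: weight_def arrival_Cons exp_add[symmetric] simp flip: ennreal_mult)
  also have "\<dots> = (\<integral>\<^sup>+\<omega>. ?F \<omega> * (if step (\<omega> ?u) ?k = j then 1 else 0) \<partial>M) * ennreal (1 / 2)"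
  proof (subst nn_integral_gap[OF u, where h = "\<lambda>y. ennreal (exp (- y))"])
    fix \<omega> y
    show "?F (upd_gap ?u ?k \<omega> y) * (if step (upd_gap ?u ?k \<omega> y ?u) ?k = j then 1 else 0) =
      ?F \<omega> * (if step (\<omega> ?u) ?k = j then 1 else 0)"
      by (subst F[OF agree_upd_gap[OF order_refl]]) simp
  qed (simp_all add: nn_integral_exp_measure_exp)
  also have "(\<integral>\<^sup>+\<omega>. ?F \<omega> * (if step (\<omega> ?u) ?k = j then 1 else 0) \<partial>M) = (\<integral>\<^sup>+\<omega>. ?F \<omega> * ennreal (1 / real d) \<partial>M)"
    by (subst nn_integral_step[OF u _ F[OF agree_upd_step[OF order_refl]] js(1)]) simp_all
  also have "\<dots> = (\<integral>\<^sup>+\<omega>. ?F \<omega> \<partial>M) * ennreal (1 / real d)"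
    by (rule nn_integral_multc) simp
  finally show ?thesis
    unfolding half[symmetric] by (simp only: ac_simps)
qed

lemma nn_integral_free_weight:
  "v \<in> V \<Longrightarrow> js \<in> L \<Longrightarrow>
    (\<integral>\<^sup>+\<omega>. (if free_visit d \<omega> v js then weight \<omega> v js else 0) \<partial>M) = ennreal ((1 / (2 * d)) ^ length js)"
proof (induction js arbitrary: v)
  case Nil
  then show ?case by (simp add: free_visit_def weight_def M.emeasure_space_1)
next
  case (Cons j js)
  then have jd: "j < d" "js \<in> L" and w: "bt_in v j \<in> V" by (auto intro: bt_in_in_verts)
  have *: "free_visit d \<omega> v (j # js) \<longleftrightarrow> free_visit d \<omega> (bt_in v j) js \<and> step (\<omega> (up v (j # js))) (length js) = j" for \<omega>
    using jd by (auto simp: free_visit_def)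
  show ?case
    unfolding * using Cons.IH[OF w jd(2)]
    by (subst nn_integral_weight_Cons[OF Cons.prems(1) jd measurable_free_visit[OF w] agree_free_visit])
      (simp_all flip: ennreal_mult)
qed

lemma nn_integral_nsum_free:
  assumes "v \<in> V"
  shows "(\<integral>\<^sup>+\<omega>. nsum L (\<lambda>js. if free_visit d \<omega> v js then weight \<omega> v js else 0) \<partial>M) = 2"
proof -
  have "(\<integral>\<^sup>+\<omega>. nsum L (\<lambda>js. if free_visit d \<omega> v js then weight \<omega> v js else 0) \<partial>M) =
      nsum L (\<lambda>js. \<integral>\<^sup>+\<omega>. (if free_visit d \<omega> v js then weight \<omega> v js else 0) \<partial>M)"
    by (intro nsum_nn_integral countable_L measurable_If_weight measurable_free_visit assms)
  also have "\<dots> = nsum L (\<lambda>js. ennreal ((1 / (2 * d)) ^ length js))"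
    by (intro nsum_cong nn_integral_free_weight assms)
  finally show ?thesis using d by (simp add: nsum_lists_length)
qed

text \<open>The discounted number of free visits has mean 2, so it is almost surely finite even
  though infinitely many particles may come.\<close>

lemma AE_finite_arrivals:
  assumes "v \<in> V"
  shows "AE \<omega> in M. \<forall>t. finite {js. free_visit d \<omega> v js \<and> arrival \<omega> v js \<le> t}"
proof -
  have "(\<lambda>\<omega>. nsum L (\<lambda>js. if free_visit d \<omega> v js then weight \<omega> v js else 0)) \<in> borel_measurable M"
    by (intro nsum_measurable countable_L measurable_If_weight measurable_free_visit assms)
  then have "AE \<omega> in M. nsum L (\<lambda>js. if free_visit d \<omega> v js then weight \<omega> v js else 0) \<noteq> \<infinity>"
    by (intro nn_integral_noteq_infinite) (auto simp: nn_integral_nsum_free[OF assms])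
  then show ?thesis
  proof (eventually_elim, intro allI)
    fix \<omega> t assume "nsum L (\<lambda>js. if free_visit d \<omega> v js then weight \<omega> v js else 0) \<noteq> \<infinity>"
    then have "finite {js \<in> L. free_visit d \<omega> v js \<and> arrival \<omega> v js \<le> t}"
      unfolding weight_def by (rule finite_of_nsum_exp)
    moreover have "{js \<in> L. free_visit d \<omega> v js \<and> arrival \<omega> v js \<le> t} = {js. free_visit d \<omega> v js \<and> arrival \<omega> v js \<le> t}"
      by (auto simp: free_visit_def)
    ultimately show "finite {js. free_visit d \<omega> v js \<and> arrival \<omega> v js \<le> t}" by simp
  qed
qed

lemma jump_time_upd_gap: "jump_time (upd_gap u n \<omega> y u) n = jump_time (\<omega> u) n"
  by (simp add: jump_time_def)

lemma nn_integral_exp_jump_time: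
  assumes u: "u \<in> V"
  shows "(\<integral>\<^sup>+\<omega>. ennreal (exp (- jump_time (\<omega> u) n)) \<partial>M) = ennreal ((1 / 2) ^ n)"
proof (induction n)
  case (Suc n)
  have [measurable]: "(\<lambda>\<omega>. jump_time (\<omega> u) n) \<in> borel_measurable M"
    unfolding jump_time_def by (intro borel_measurable_sum measurable_gap u)
  have "(\<integral>\<^sup>+\<omega>. ennreal (exp (- jump_time (\<omega> u) (Suc n))) \<partial>M) =
      (\<integral>\<^sup>+\<omega>. ennreal (exp (- jump_time (\<omega> u) n)) * ennreal (exp (- gap (\<omega> u) n)) \<partial>M)"
    by (intro nn_integral_cong) (simp add: exp_add[symmetric] flip: ennreal_mult)
  also have "\<dots> = ennreal ((1 / 2) ^ n) * ennreal (1 / 2)"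
    by (subst nn_integral_gap[OF u, where h = "\<lambda>y. ennreal (exp (- y))"])
      (simp_all only: Suc nn_integral_exp_measure_exp jump_time_upd_gap, simp_all)
  also have "\<dots> = ennreal ((1 / 2) ^ Suc n)"
    by (subst ennreal_mult[symmetric]) (auto simp: mult.commute)
  finally show ?case .
qed (simp add: M.emeasure_space_1)

lemma AE_finite_jumps:
  assumes u: "u \<in> V"
  shows "AE \<omega> in M. \<forall>t. finite {n. jump_time (\<omega> u) n \<le> t}"
proof -
  have [measurable]: "(\<lambda>\<omega>. jump_time (\<omega> u) n) \<in> borel_measurable M" for n
    unfolding jump_time_def by (intro borel_measurable_sum measurable_gap u)
  let ?S = "\<lambda>\<omega>. nsum UNIV (\<lambda>n. ennreal (exp (- jump_time (\<omega> u) n)))"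
  have "(\<integral>\<^sup>+\<omega>. ?S \<omega> \<partial>M) = nsum UNIV (\<lambda>n. ennreal ((1 / 2) ^ n))"
    by (subst nsum_nn_integral) (auto simp: nn_integral_exp_jump_time[OF u])
  also have "\<dots> = (\<Sum>k. ennreal ((1 / 2) ^ k))"
    unfolding nsum_def by (rule nn_integral_count_space_nat)
  also have "\<dots> = ennreal 2"
    using geometric_sums[of "1/2::real"] by (intro suminf_ennreal_eq) auto
  finally have "AE \<omega> in M. ?S \<omega> \<noteq> \<infinity>"
    by (intro nn_integral_noteq_infinite nsum_measurable) auto
  then show ?thesis
  proof (eventually_elim, intro allI)
    fix \<omega> t assume "?S \<omega> \<noteq> \<infinity>"
    then show "finite {n. jump_time (\<omega> u) n \<le> t}"
      using finite_of_nsum_exp[of UNIV "\<lambda>_. True" "\<lambda>n. jump_time (\<omega> u) n" t] by simp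
  qed
qed

lemma AE_not_of_nn_integral:
  assumes [measurable]: "Measurable.pred M Q" and 0: "(\<integral>\<^sup>+\<omega>. (if Q \<omega> then 1 else 0) \<partial>M) = 0"
  shows "AE \<omega> in M. \<not> Q \<omega>"
proof -
  have "(\<lambda>\<omega>. if Q \<omega> then 1 else 0 :: ennreal) \<in> borel_measurable M" by measurable
  from nn_integral_0_iff_AE[OF this] 0 have "AE \<omega> in M. (if Q \<omega> then 1 else 0 :: ennreal) = 0" by simp
  then show ?thesis by eventually_elim (auto split: if_splits)
qed

lemma AE_gap_pos:
  assumes u: "u \<in> V"
  shows "AE \<omega> in M. 0 < gap (\<omega> u) k"
proof -
  have [measurable]: "(\<lambda>\<omega>. gap (\<omega> u) k) \<in> borel_measurable M" by (rule measurable_gap[OF u])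
  have eq: "(if gap (\<omega> u) k \<le> 0 then 1 else 0) = 1 * (indicator {..0} (gap (\<omega> u) k) :: ennreal)" for \<omega>
    by (simp add: indicator_def)
  have "AE \<omega> in M. \<not> gap (\<omega> u) k \<le> 0"
    by (rule AE_not_of_nn_integral, measurable, unfold eq, subst nn_integral_gap[OF u])
      (simp_all add: exp_measure_nonpos)
  then show ?thesis by (simp add: not_le)
qed

lemma AE_step_less:
  assumes u: "u \<in> V"
  shows "AE \<omega> in M. step (\<omega> u) k < d"
proof -
  note [measurable] = measurable_step[OF u, of k]
  have eq: "(\<integral>\<^sup>+i. (if d \<le> i then 1 else 0) \<partial>measure_pmf (pmf_of_set {..<d})) = 0"
    using d by (subst nn_integral_0_iff_AE) (auto simp: AE_measure_pmf_iff lessThan_empty_iff)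
  have "(\<integral>\<^sup>+\<omega>. (if d \<le> step (\<omega> u) k then 1 else 0) \<partial>M) =
      (\<integral>\<^sup>+\<omega>. (\<integral>\<^sup>+i. (if d \<le> i then 1 else 0) \<partial>measure_pmf (pmf_of_set {..<d})) \<partial>M)"
    by (subst resamples_integral[OF resamples_step[OF u, of k]]) simp_all
  then have "AE \<omega> in M. \<not> d \<le> step (\<omega> u) k"
    by (intro AE_not_of_nn_integral) (simp_all add: eq)
  then show ?thesis by (simp add: not_le)
qed

text \<open>With everything fixed except the gap that ends with one of the two arrivals, a tie
  leaves a single value for that gap, and the exponential law has no atoms. Distinct lists name
  distinct particles, so the other arrival does not move.\<close>

lemma AE_arrival_neq:
  assumes v: "v \<in> V" and js: "js \<in> L" "ks \<in> L" "js \<noteq> ks"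
  shows "AE \<omega> in M. arrival \<omega> v js \<noteq> arrival \<omega> v ks"
proof -
  have *: "AE \<omega> in M. arrival \<omega> v (j # js) \<noteq> arrival \<omega> v ks"
    if js: "j # js \<in> L" "ks \<in> L" "j # js \<noteq> ks" for j js ks
  proof -
    let ?u = "up v (j # js)" and ?k = "length js" and ?w = "bt_in v j"
    have jd: "j < d" "js \<in> L" and w: "?w \<in> V" and u: "?u \<in> V"
      using js v by (auto intro!: bt_in_in_verts up_in_verts)
    note [measurable] = measurable_arrival[OF v js(1)] measurable_arrival[OF v js(2)]
    let ?F = "\<lambda>\<omega>. if arrival \<omega> v (j # js) = arrival \<omega> v ks then 1 else 0 :: ennreal"
    have "(\<integral>\<^sup>+\<omega>. ?F \<omega> \<partial>M) = (\<integral>\<^sup>+\<omega>. (\<integral>\<^sup>+y. ?F (upd_gap ?u ?k \<omega> y) \<partial>exp_measure) \<partial>M)"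
      by (rule resamples_integral[OF resamples_gap[OF u]]) measurable
    also have "\<dots> = (\<integral>\<^sup>+\<omega>. (\<integral>\<^sup>+y. indicator {arrival \<omega> v ks - arrival \<omega> ?w js} y \<partial>exp_measure) \<partial>M)"
    proof (intro nn_integral_cong)
      fix \<omega> y
      have "arrival (upd_gap ?u ?k \<omega> y) v ks = arrival \<omega> v ks"
        using js(3) inj_up[of v ks "j # js"] by (auto simp: arrival_def jump_time_def)
      moreover have "arrival (upd_gap ?u ?k \<omega> y) ?w js = arrival \<omega> ?w js"
        using agree_arrival[OF agree_upd_gap[where d = d and v = ?w and js = js, OF order_refl] jd(2), of \<omega> y] by simp
      ultimately show "?F (upd_gap ?u ?k \<omega> y) = indicator {arrival \<omega> v ks - arrival \<omega> ?w js} y"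
        by (auto simp: arrival_Cons split: split_indicator)
    qed
    also have "\<dots> = 0" by (simp add: exp_measure_singleton)
    finally have "(\<integral>\<^sup>+\<omega>. ?F \<omega> \<partial>M) = 0" .
    then show ?thesis
      using borel_measurable_eq[OF measurable_arrival[OF v js(1)] measurable_arrival[OF v js(2)]]
      by (intro AE_not_of_nn_integral) (simp_all add: pred_def)
  qed
  show ?thesis
  proof (cases js)
    case (Cons j js')
    with * js show ?thesis by blast
  next
    case Nil
    with js obtain i ls where ls: "ks = i # ls" by (cases ks) auto
    \<comment> \<open>The particle of \<open>v\<close> itself is there at time 0 without using a
      gap, so the gap is redrawn for the other particle.\<close>
    have "AE \<omega> in M. arrival \<omega> v ks \<noteq> arrival \<omega> v js"
      unfolding ls by (rule *) (use js ls in auto)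
    then show ?thesis by eventually_elim simp
  qed
qed

end

lemma measurable_card_subset:
  assumes "finite B" "\<And>\<omega>. S \<omega> \<subseteq> B" and [measurable]: "\<And>x. x \<in> B \<Longrightarrow> Measurable.pred N (\<lambda>\<omega>. x \<in> S \<omega>)"
  shows "(\<lambda>\<omega>. card (S \<omega>)) \<in> N \<rightarrow>\<^sub>M count_space UNIV"
proof -
  have "card (S \<omega>) = (\<Sum>x\<in>B. if x \<in> S \<omega> then 1 else 0)" for \<omega>
  proof -
    have "S \<omega> = {x \<in> B. x \<in> S \<omega>}" using assms(2)[of \<omega>] by auto
    then show ?thesis using sum.inter_filter[OF assms(1), of "\<lambda>_. 1::nat" "\<lambda>x. x \<in> S \<omega>"] by simp
  qed
  then show ?thesis by simp
qed

context dlas_tree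
begin

section \<open>The approximations from above and below meet\<close>

lemma arrives_free:
  assumes "\<And>w ks. X w ks \<Longrightarrow> free_visit d \<omega> w ks" "js \<in> L" "arrives \<omega> X v js"
  shows "free_visit d \<omega> v js"
  using assms by (cases js) (auto simp: free_visit_def)

text \<open>At an \<open>A\<close>-site the survivors are the arrivals and the site's own particle,
  which belongs to both systems. At a \<open>B\<close>-site this is
  \<open>nsum_survivors_le\<close>.\<close>

lemma nsum_difference_Suc_le:
  assumes v: "v \<in> V" and fin: "\<And>t. finite {js. free_visit d \<omega> v js \<and> arrival \<omega> v js \<le> t}"
    and inj: "inj_on (arrival \<omega> v) L"
  shows "nsum L (\<lambda>js. if upper d \<omega> (Suc n) v js \<and> \<not> lower d \<omega> (Suc n) v js then weight \<omega> v js else 0) \<le>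
    nsum L (\<lambda>js. if arrives \<omega> (upper d \<omega> n) v js \<and> \<not> arrives \<omega> (lower d \<omega> n) v js then weight \<omega> v js else 0)"
proof -
  define P where "P = {js \<in> L. arrives \<omega> (upper d \<omega> n) v js}"
  define Q where "Q = {js \<in> L. arrives \<omega> (lower d \<omega> n) v js}"
  have QP: "Q \<subseteq> P"
    unfolding P_def Q_def using v by (auto intro: arrives_mono[of d "lower d \<omega> n"] lower_imp_upper)
  have nil: "[] \<notin> P" by (simp add: P_def)
  have "finite {x \<in> P. arrival \<omega> v x \<le> c}" for c
    by (rule finite_subset[OF _ fin[of c]])
      (auto simp: P_def simp del: in_lists_conv_set intro: arrives_free upper_free)
  note le = nsum_survivors_le[OF QP inj_on_subset[OF inj] this]
  have rhs: "{js \<in> L. arrives \<omega> (upper d \<omega> n) v js \<and> \<not> arrives \<omega> (lower d \<omega> n) v js} = P - Q"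
    by (auto simp: P_def Q_def)
  have lhs: "{js \<in> L. upper d \<omega> (Suc n) v js \<and> \<not> lower d \<omega> (Suc n) v js} =
    (if is_A (\<omega> v) then P - Q
     else {x\<in>P. \<exists>y\<in>P. arrival \<omega> v y < arrival \<omega> v x} - {x\<in>Q. \<exists>y\<in>Q. arrival \<omega> v y < arrival \<omega> v x})"
    unfolding upper_simps lower_simps survives_def P_def Q_def by (auto simp del: in_lists_conv_set)
  show ?thesis
    unfolding nsum_If rhs lhs weight_def using le by (auto simp: P_def)
qed

lemma AE_inj_arrival:
  assumes "v \<in> V"
  shows "AE \<omega> in M. inj_on (arrival \<omega> v) L"
proof -
  have "AE \<omega> in M. \<forall>js\<in>L. \<forall>ks\<in>L. js \<noteq> ks \<longrightarrow> arrival \<omega> v js \<noteq> arrival \<omega> v ks"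
    using AE_arrival_neq[OF assms]
    by (simp add: AE_ball_countable[OF countable_L] del: in_lists_conv_set)
  then show ?thesis by eventually_elim (auto simp: inj_on_def)
qed

text \<open>The free visits have total discounted weight 2, and each level sums \<open>d\<close>
  in-edges with factor \<open>1 / (2 * d)\<close>.\<close>

lemma nn_integral_nsum_difference_le:
  "v \<in> V \<Longrightarrow> (\<integral>\<^sup>+\<omega>. nsum L (\<lambda>js. if upper d \<omega> n v js \<and> \<not> lower d \<omega> n v js then weight \<omega> v js else 0) \<partial>M)
    \<le> ennreal (2 * (1 / 2) ^ n)"
proof (induction n arbitrary: v)
  case 0
  then show ?case using nn_integral_nsum_free[of v] by (simp add: lower_simps upper_simps)
next
  case (Suc n)
  note v = Suc.prems
  let ?D = "\<lambda>n v js \<omega>. if upper d \<omega> n v js \<and> \<not> lower d \<omega> n v js then weight \<omega> v js else 0"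
  let ?E = "\<lambda>js \<omega>. if arrives \<omega> (upper d \<omega> n) v js \<and> \<not> arrives \<omega> (lower d \<omega> n) v js
    then weight \<omega> v js else 0"
  have D_meas: "?D n w js \<in> borel_measurable M" if "w \<in> V" "js \<in> L" for n w js
    by (intro measurable_If_weight pred_intros_logic measurable_upper measurable_lower that)
  have E_meas: "?E js \<in> borel_measurable M" if "js \<in> L" for js
    by (intro measurable_If_weight pred_intros_logic measurable_arrives measurable_upper measurable_lower that v)
  have E_Cons: "(\<integral>\<^sup>+\<omega>. ?E (j # ks) \<omega> \<partial>M) = ennreal (1 / (2 * real d)) * (\<integral>\<^sup>+\<omega>. ?D n (bt_in v j) ks \<omega> \<partial>M)"
    if "j < d" "ks \<in> L" for j ks
  proof -
    have w: "bt_in v j \<in> V" using v that by (intro bt_in_in_verts)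
    have *: "arrives \<omega> (upper d \<omega> n) v (j # ks) \<and> \<not> arrives \<omega> (lower d \<omega> n) v (j # ks) \<longleftrightarrow>
      (upper d \<omega> n (bt_in v j) ks \<and> \<not> lower d \<omega> n (bt_in v j) ks) \<and> step (\<omega> (up v (j # ks))) (length ks) = j" for \<omega>
      by auto
    show ?thesis
      unfolding * using that w v measurable_upper[OF w] measurable_lower[OF w]
      by (intro nn_integral_weight_Cons) (auto simp: agree_upper agree_lower simp del: in_lists_conv_set)
  qed
  have "(\<integral>\<^sup>+\<omega>. nsum L (\<lambda>js. ?D (Suc n) v js \<omega>) \<partial>M) \<le> (\<integral>\<^sup>+\<omega>. nsum L (\<lambda>js. ?E js \<omega>) \<partial>M)"
  proof (rule nn_integral_mono_AE)
    show "AE \<omega> in M. nsum L (\<lambda>js. ?D (Suc n) v js \<omega>) \<le> nsum L (\<lambda>js. ?E js \<omega>)"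
      using AE_finite_arrivals[OF v] AE_inj_arrival[OF v]
      by eventually_elim (intro nsum_difference_Suc_le v, auto)
  qed
  also have "\<dots> = nsum L (\<lambda>js. \<integral>\<^sup>+\<omega>. ?E js \<omega> \<partial>M)"
    by (intro nsum_nn_integral countable_L E_meas)
  also have "\<dots> = (\<Sum>j<d. nsum L (\<lambda>ks. \<integral>\<^sup>+\<omega>. ?E (j # ks) \<omega> \<partial>M))"
    by (subst nsum_lists) simp
  also have "\<dots> = (\<Sum>j<d. nsum L (\<lambda>ks. ennreal (1 / (2 * real d)) * (\<integral>\<^sup>+\<omega>. ?D n (bt_in v j) ks \<omega> \<partial>M)))"
    by (intro sum.cong refl nsum_cong E_Cons) auto
  also have "\<dots> = (\<Sum>j<d. ennreal (1 / (2 * real d)) * (\<integral>\<^sup>+\<omega>. nsum L (\<lambda>ks. ?D n (bt_in v j) ks \<omega>) \<partial>M))"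
    unfolding nsum_cmult using v
    by (intro sum.cong refl arg_cong2[where f = times] nsum_nn_integral[symmetric] countable_L D_meas)
      (auto intro: bt_in_in_verts)
  also have "\<dots> \<le> (\<Sum>j<d. ennreal (1 / (2 * real d)) * ennreal (2 * (1 / 2) ^ n))"
    using v by (intro sum_mono mult_left_mono Suc.IH) (auto intro: bt_in_in_verts)
  also have "\<dots> = ennreal (real d * ((1 / (2 * real d)) * (2 * (1 / 2) ^ n)))"
    by (simp only: sum_constant card_lessThan ennreal_of_nat_eq_real_of_nat)
      (subst ennreal_mult[symmetric], simp, simp, subst ennreal_mult[symmetric], simp_all)
  also have "real d * ((1 / (2 * real d)) * (2 * (1 / 2) ^ n)) = 2 * (1 / 2) ^ Suc n"
    using d by simp
  finally show ?case .
qed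

lemma AE_upper_imp_visits:
  assumes v: "v \<in> V"
  shows "AE \<omega> in M. \<forall>js. (\<forall>n. upper d \<omega> n v js) \<longrightarrow> visits d \<omega> v js"
proof -
  have "AE \<omega> in M. (\<forall>n. upper d \<omega> n v js) \<longrightarrow> visits d \<omega> v js" if js: "js \<in> L" for js
  proof -
    let ?Q = "\<lambda>\<omega>. (\<forall>n. upper d \<omega> n v js) \<and> \<not> visits d \<omega> v js"
    \<comment> \<open>Weights are positive, so the weighted event is null iff the event is. With its
      weight it is bounded by one term of the discounted discrepancy at every depth.\<close>
    let ?F = "\<lambda>\<omega>. if ?Q \<omega> then weight \<omega> v js else 0"
    have F: "?F \<in> borel_measurable M"
      by (intro measurable_If_weight pred_intros_logic pred_intros_countable measurable_upper measurable_visits v js)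
    have le: "(\<integral>\<^sup>+\<omega>. ?F \<omega> \<partial>M) \<le> ennreal (2 * (1 / 2) ^ n)" for n
    proof -
      let ?D = "\<lambda>\<omega> js. if upper d \<omega> n v js \<and> \<not> lower d \<omega> n v js then weight \<omega> v js else 0"
      have "?F \<omega> \<le> nsum L (?D \<omega>)" for \<omega>
      proof -
        have "?F \<omega> \<le> ?D \<omega> js" by (auto simp: visits_def)
        also have "\<dots> \<le> nsum L (?D \<omega>)" by (rule nsum_ge[OF js])
        finally show ?thesis .
      qed
      then have "(\<integral>\<^sup>+\<omega>. ?F \<omega> \<partial>M) \<le> (\<integral>\<^sup>+\<omega>. nsum L (?D \<omega>) \<partial>M)" by (intro nn_integral_mono)
      also have "\<dots> \<le> ennreal (2 * (1 / 2) ^ n)" by (rule nn_integral_nsum_difference_le[OF v])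
      finally show ?thesis .
    qed
    have "(\<lambda>n. ennreal (2 * (1 / 2) ^ n)) \<longlonglongrightarrow> ennreal (2 * 0)"
      by (intro tendsto_ennrealI tendsto_mult tendsto_const LIMSEQ_power_zero) simp
    then have "(\<integral>\<^sup>+\<omega>. ?F \<omega> \<partial>M) \<le> ennreal (2 * 0)"
      by (rule LIMSEQ_le_const) (use le in auto)
    then have "AE \<omega> in M. ?F \<omega> = 0" using nn_integral_0_iff_AE[OF F] by simp
    then show ?thesis by eventually_elim (auto simp: weight_def split: if_splits)
  qed
  then have "AE \<omega> in M. \<forall>js\<in>L. (\<forall>n. upper d \<omega> n v js) \<longrightarrow> visits d \<omega> v js"
    by (simp add: AE_ball_countable[OF countable_L] del: in_lists_conv_set)
  then show ?thesis
    by eventually_elim (use upper_lists in blast)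
qed

lemma AE_regular_config: "AE \<omega> in M. regular_config d \<omega>"
proof -
  have cV: "countable V" by simp
  have "AE \<omega> in M. \<forall>v\<in>V. \<forall>n. 0 < gap (\<omega> v) n"
    "AE \<omega> in M. \<forall>v\<in>V. \<forall>n. step (\<omega> v) n < d"
    "AE \<omega> in M. \<forall>v\<in>V. \<forall>t. finite {n. jump_time (\<omega> v) n \<le> t}"
    "AE \<omega> in M. \<forall>v\<in>V. \<forall>t. finite {js. free_visit d \<omega> v js \<and> arrival \<omega> v js \<le> t}"
    "AE \<omega> in M. \<forall>v\<in>V. \<forall>js. (\<forall>n. upper d \<omega> n v js) \<longrightarrow> visits d \<omega> v js"
    using AE_gap_pos AE_step_less AE_finite_jumps AE_finite_arrivals AE_upper_imp_visits
    by (simp_all add: AE_ball_countable[OF cV] AE_all_countable)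
  then show ?thesis by eventually_elim (simp add: regular_config_def)
qed

section \<open>The law of the number of surviving visitors\<close>

definition survivors :: "(vertex \<Rightarrow> particle) \<Rightarrow> nat \<Rightarrow> vertex \<Rightarrow> nat list set" where
  "survivors \<omega> n v = {js. lower d \<omega> n v js}"

definition arrivals :: "(vertex \<Rightarrow> particle) \<Rightarrow> nat \<Rightarrow> vertex \<Rightarrow> nat list set" where
  "arrivals \<omega> n v = {js \<in> L. arrives \<omega> (lower d \<omega> n) v js}"

text \<open>The thinned copy number \<open>j\<close>: the next step of each survivor at the
  \<open>j\<close>-th in-neighbour decides whether it comes to \<open>v\<close>.\<close>

definition moved :: "(vertex \<Rightarrow> particle) \<Rightarrow> nat \<Rightarrow> vertex \<Rightarrow> nat \<Rightarrow> nat list set" where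
  "moved \<omega> n v j = {ks \<in> survivors \<omega> n (bt_in v j). step (\<omega> (up v (j # ks))) (length ks) = j}"

lemma finite_short: "finite {js \<in> L. length js < n}"
proof (rule finite_subset)
  show "{js \<in> L. length js < n} \<subseteq> {js. set js \<subseteq> {..<d} \<and> length js \<le> n}" by auto
qed (simp add: finite_lists_length_le)

lemma survivors_short: "survivors \<omega> n v \<subseteq> {js \<in> L. length js < n}"
  unfolding survivors_def using lower_lists length_lower by blast

lemma finite_survivors: "finite (survivors \<omega> n v)"
  using survivors_short finite_short by (rule finite_subset)

lemma finite_moved: "finite (moved \<omega> n v j)"
  unfolding moved_def using finite_survivors by auto

lemma arrivals_eq: "arrivals \<omega> n v = (\<Union>j<d. (#) j ` moved \<omega> n v j)"
proof (intro equalityI subsetI)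
  fix js assume "js \<in> arrivals \<omega> n v"
  then show "js \<in> (\<Union>j<d. (#) j ` moved \<omega> n v j)"
    by (cases js) (auto simp: arrivals_def moved_def survivors_def)
next
  fix js assume "js \<in> (\<Union>j<d. (#) j ` moved \<omega> n v j)"
  then obtain j ks where js: "js = j # ks" "j < d" "ks \<in> moved \<omega> n v j" by auto
  then have "ks \<in> L" by (auto simp: moved_def survivors_def dest: lower_lists)
  with js show "js \<in> arrivals \<omega> n v" by (simp add: arrivals_def moved_def survivors_def)
qed

lemma card_arrivals: "card (arrivals \<omega> n v) = (\<Sum>j<d. card (moved \<omega> n v j))"
  unfolding arrivals_eq
  by (subst card_UN_disjoint) (auto simp: finite_moved card_image)

lemma finite_arrivals: "finite (arrivals \<omega> n v)"
  unfolding arrivals_eq by (simp add: finite_moved)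

text \<open>Distinct arrival times make the first arrival unique, so a \<open>B\<close>-particle
  removes exactly one visitor. Subtraction on \<open>nat\<close> covers the case without
  arrivals.\<close>

lemma card_survivors_Suc:
  assumes inj: "inj_on (arrival \<omega> v) L"
  shows "card (survivors \<omega> (Suc n) v) =
    (if is_A (\<omega> v) then card (arrivals \<omega> n v) + 1 else card (arrivals \<omega> n v) - 1)"
proof (cases "is_A (\<omega> v)")
  case True
  have "survivors \<omega> (Suc n) v = insert [] (arrivals \<omega> n v)"
    using True by (auto simp: survivors_def arrivals_def lower_simps survives_def)
  moreover have "[] \<notin> arrivals \<omega> n v" by (simp add: arrivals_def)
  ultimately show ?thesis using True finite_arrivals by simp
next
  case False
  let ?R = "arrivals \<omega> n v"
  have eq: "survivors \<omega> (Suc n) v = {x \<in> ?R. \<exists>y\<in>?R. arrival \<omega> v y < arrival \<omega> v x}"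
    using False by (auto simp: survivors_def arrivals_def lower_simps survives_def)
  show ?thesis
  proof (cases "?R = {}")
    case True
    then show ?thesis using False eq by simp
  next
    case ne: False
    then obtain a where a: "a \<in> ?R" "\<And>y. y \<in> ?R \<Longrightarrow> \<not> arrival \<omega> v y < arrival \<omega> v a"
      using ex_is_arg_min_if_finite[OF finite_arrivals ne, of "arrival \<omega> v"] by (auto simp: is_arg_min_def)
    have "arrival \<omega> v a < arrival \<omega> v x" if "x \<in> ?R" "x \<noteq> a" for x
    proof -
      have "arrival \<omega> v x \<noteq> arrival \<omega> v a"
        using inj that a(1) by (auto simp: arrivals_def dest: inj_onD simp del: in_lists_conv_set)
      with a(2)[OF that(1)] show ?thesis by simp
    qed
    then have "survivors \<omega> (Suc n) v = ?R - {a}" unfolding eq using a by auto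
    then show ?thesis using False a(1) finite_arrivals by (simp add: card_Diff_singleton)
  qed
qed

lemma measurable_card_survivors:
  assumes "v \<in> V"
  shows "(\<lambda>\<omega>. card (survivors \<omega> n v)) \<in> M \<rightarrow>\<^sub>M count_space UNIV"
proof (rule measurable_card_subset[OF finite_short survivors_short])
  show "Measurable.pred M (\<lambda>\<omega>. js \<in> survivors \<omega> n v)" for js
    unfolding survivors_def using measurable_lower[OF assms] by simp
qed

lemma measurable_card_moved:
  assumes "v \<in> V" "j < d"
  shows "(\<lambda>\<omega>. card (moved \<omega> n v j)) \<in> M \<rightarrow>\<^sub>M count_space UNIV"
proof (rule measurable_card_subset[OF finite_short])
  have w: "bt_in v j \<in> V" using assms by (intro bt_in_in_verts)
  show "moved \<omega> n v j \<subseteq> {ks \<in> L. length ks < n}" for \<omega>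
    using survivors_short[of \<omega> n "bt_in v j"] by (auto simp: moved_def)
  show "Measurable.pred M (\<lambda>\<omega>. ks \<in> moved \<omega> n v j)" if "ks \<in> {ks \<in> L. length ks < n}" for ks
    unfolding moved_def survivors_def mem_Collect_eq up.simps
    using that by (intro pred_intros_logic measurable_lower w pred_step_eq up_in_verts) simp
qed

lemma measurable_card_arrivals:
  assumes "v \<in> V"
  shows "(\<lambda>\<omega>. card (arrivals \<omega> n v)) \<in> M \<rightarrow>\<^sub>M count_space UNIV"
  unfolding card_arrivals using measurable_card_moved[OF assms] by simp

end

lemma ennreal_le_ennrealE:
  assumes "x \<le> ennreal a"
  obtains r where "0 \<le> r" "x = ennreal r"
  using assms by (cases x) (auto simp: top_unique)

context dlas_tree
begin

text \<open>The next step of a survivor is independent of its survival, and steps of different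
  particles are independent. Averaging \<open>s\<close> over a step along \<open>j\<close> and 1
  over the other steps gives the base on the right.\<close>

lemma nn_integral_thin:
  assumes v: "v \<in> V" and j: "j < d" and s: "0 \<le> s" "s \<le> 1"
  shows "(\<integral>\<^sup>+\<omega>. ennreal (s ^ card (moved \<omega> n v j)) \<partial>M) =
    (\<integral>\<^sup>+\<omega>. ennreal ((1 - (1 - s) / real d) ^ card (survivors \<omega> n (bt_in v j))) \<partial>M)"
proof -
  define w where "w = bt_in v j"
  have w: "w \<in> V" unfolding w_def using v j by (intro bt_in_in_verts)
  define B where "B = {ks \<in> L. length ks < n}"
  have B: "finite B" "B \<subseteq> L" unfolding B_def using finite_short by auto
  define c where "c = 1 - (1 - s) / real d"
  have c0: "0 \<le> c"
  proof -
    have "(1 - s) / real d \<le> 1 / 1" using s d by (intro frac_le) auto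
    then show ?thesis by (simp add: c_def)
  qed
  have c: "ennreal (1 / real d) * ennreal s + ennreal (1 - 1 / real d) * 1 = ennreal c"
  proof -
    have "1 / real d * s + (1 - 1 / real d) = c" using d by (simp add: c_def field_simps)
    moreover have "0 \<le> 1 - 1 / real d" using d by simp
    ultimately show ?thesis using s by (simp add: ennreal_mult[symmetric] ennreal_plus[symmetric] del: ennreal_plus)
  qed
  define f where "f \<omega> ks = (if lower d \<omega> n w ks \<and> step (\<omega> (up w ks)) (length ks) = j then ennreal s else 1)" for \<omega> ks
  define g where "g \<omega> ks = (if lower d \<omega> n w ks then ennreal c else 1)" for \<omega> ks
  have f_meas: "(\<lambda>\<omega>. f \<omega> ks) \<in> borel_measurable M" if "ks \<in> L" for ks
    using measurable_lower[OF w, of n ks] pred_step_eq[OF up_in_verts[OF w that], of "length ks" j]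
    unfolding f_def by measurable
  have g_meas: "(\<lambda>\<omega>. g \<omega> ks) \<in> borel_measurable M" if "ks \<in> L" for ks
    using measurable_lower[OF w, of n ks] unfolding g_def by measurable
  \<comment> \<open>In \<open>R\<close> are the walkers whose step is still random; the others carry
    the averaged factor. They are averaged one at a time because the set of survivors is random
    too.\<close>
  have swap: "(\<integral>\<^sup>+\<omega>. (\<Prod>ks\<in>R. f \<omega> ks) * (\<Prod>ks\<in>B - R. g \<omega> ks) \<partial>M) = (\<integral>\<^sup>+\<omega>. (\<Prod>ks\<in>B. g \<omega> ks) \<partial>M)"
    if "R \<subseteq> B" for R
    using finite_subset[OF that B(1)] that
  proof (induction R)
    case (insert x R)
    define F where "F \<omega> = (\<Prod>ks\<in>R. f \<omega> ks) * (\<Prod>ks\<in>B - insert x R. g \<omega> ks)" for \<omega>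
    have x: "x \<in> L" and RL: "R \<subseteq> L" using insert B by auto
    let ?u = "up w x" and ?k = "length x"
    have u: "?u \<in> V" using w x by (rule up_in_verts)
    have F_meas: "F \<in> borel_measurable M"
      unfolding F_def using RL B(2)
      by (intro borel_measurable_times_ennreal borel_measurable_prod_ennreal f_meas g_meas) auto
    have low: "lower d (upd_step ?u ?k \<omega> i) n w ks = lower d \<omega> n w ks" for \<omega> i ks
      by (rule agree_lower[OF agree_upd_step[OF order_refl]])
    have F_inv: "F (upd_step ?u ?k \<omega> i) = F \<omega>" for \<omega> i
    proof -
      have "f (upd_step ?u ?k \<omega> i) ks = f \<omega> ks" if "ks \<in> R" for ks
      proof -
        have "up w ks \<noteq> ?u" using that insert.hyps inj_up[of w ks x] by auto
        then show ?thesis unfolding f_def low by simp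
      qed
      moreover have "g (upd_step ?u ?k \<omega> i) ks = g \<omega> ks" for ks unfolding g_def low ..
      ultimately show ?thesis unfolding F_def by simp
    qed
    \<comment> \<open>The step of \<open>x\<close> enters only on the event that \<open>x\<close>
      has survived.\<close>
    let ?a = "\<lambda>\<omega>. if lower d \<omega> n w x then F \<omega> else 0" and ?b = "\<lambda>\<omega>. if lower d \<omega> n w x then 0 else F \<omega>"
    note [measurable] = F_meas measurable_lower[OF w] pred_step_eq[OF u]
    have ab: "?a \<in> borel_measurable M" "?b \<in> borel_measurable M"
      by measurable
    have prodR: "(\<Prod>ks\<in>insert x R. f \<omega> ks) * (\<Prod>ks\<in>B - insert x R. g \<omega> ks) =
        ?a \<omega> * (if step (\<omega> ?u) ?k = j then ennreal s else 1) + ?b \<omega>" for \<omega>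
      using insert.hyps by (simp add: F_def f_def[of \<omega> x] ac_simps)
    have BR: "B - R = insert x (B - insert x R)" using insert by auto
    have prodB: "(\<Prod>ks\<in>R. f \<omega> ks) * (\<Prod>ks\<in>B - R. g \<omega> ks) = ?a \<omega> * ennreal c + ?b \<omega>" for \<omega>
      unfolding BR using B(1) by (simp add: F_def g_def[of \<omega> x] ac_simps)
    have "(\<integral>\<^sup>+\<omega>. (\<Prod>ks\<in>insert x R. f \<omega> ks) * (\<Prod>ks\<in>B - insert x R. g \<omega> ks) \<partial>M) =
        (\<integral>\<^sup>+\<omega>. ?a \<omega> * (if step (\<omega> ?u) ?k = j then ennreal s else 1) \<partial>M) + (\<integral>\<^sup>+\<omega>. ?b \<omega> \<partial>M)"
      unfolding prodR by (intro nn_integral_add) measurable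
    also have "(\<integral>\<^sup>+\<omega>. ?a \<omega> * (if step (\<omega> ?u) ?k = j then ennreal s else 1) \<partial>M) = (\<integral>\<^sup>+\<omega>. ?a \<omega> * ennreal c \<partial>M)"
      by (subst nn_integral_step[OF u ab(1) _ j]) (simp_all only: low F_inv c)
    also have "(\<integral>\<^sup>+\<omega>. ?a \<omega> * ennreal c \<partial>M) + (\<integral>\<^sup>+\<omega>. ?b \<omega> \<partial>M) =
        (\<integral>\<^sup>+\<omega>. (\<Prod>ks\<in>R. f \<omega> ks) * (\<Prod>ks\<in>B - R. g \<omega> ks) \<partial>M)"
      unfolding prodB by (intro nn_integral_add[symmetric]) measurable
    also have "\<dots> = (\<integral>\<^sup>+\<omega>. (\<Prod>ks\<in>B. g \<omega> ks) \<partial>M)"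
      using insert by simp
    finally show ?case .
  qed simp
  have pow: "(\<Prod>ks\<in>B. if Q ks then ennreal a else 1) = ennreal (a ^ card {ks \<in> B. Q ks})" if "0 \<le> a" for a Q
    using B(1) that by (simp add: prod.inter_filter[symmetric] ennreal_power)
  have "{ks \<in> B. lower d \<omega> n w ks \<and> step (\<omega> (up w ks)) (length ks) = j} = moved \<omega> n v j"
    "{ks \<in> B. lower d \<omega> n w ks} = survivors \<omega> n w" for \<omega>
    using survivors_short[of \<omega> n w] by (auto simp: moved_def B_def w_def survivors_def)
  then have "(\<Prod>ks\<in>B. f \<omega> ks) = ennreal (s ^ card (moved \<omega> n v j))"
    "(\<Prod>ks\<in>B. g \<omega> ks) = ennreal (c ^ card (survivors \<omega> n w))" for \<omega>
    unfolding f_def g_def using pow[OF s(1)] pow[OF c0] by simp_all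
  with swap[OF order_refl] show ?thesis by (simp add: w_def c_def)
qed

lemma nn_integral_mult_M:
  assumes "F \<in> borel_measurable M" "G \<in> borel_measurable M"
    "\<And>x y. (\<And>i. i \<in> J \<Longrightarrow> x i = y i) \<Longrightarrow> F x = F y"
    "\<And>x y. (\<And>i. i \<notin> J \<Longrightarrow> x i = y i) \<Longrightarrow> G x = G y"
  shows "(\<integral>\<^sup>+x. F x * G x \<partial>M) = (\<integral>\<^sup>+x. F x \<partial>M) * (\<integral>\<^sup>+x. G x \<partial>M)"
  unfolding M_PiM
proof (rule nn_integral_mult_PiM[where J = J])
  show "F \<in> borel_measurable (\<Pi>\<^sub>M v\<in>V. particle_measure d p)"
    "G \<in> borel_measurable (\<Pi>\<^sub>M v\<in>V. particle_measure d p)"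
    using assms(1,2) unfolding M_PiM .
  show "prob_space (particle_measure d p)" by (rule prob_space_particle_measure)
  show "F x = F y" if "\<And>i. i \<in> J \<Longrightarrow> x i = y i" for x y using that by (rule assms(3))
  show "G x = G y" if "\<And>i. i \<notin> J \<Longrightarrow> x i = y i" for x y using that by (rule assms(4))
qed

lemma moved_cong:
  assumes "\<And>ks. ks \<in> L \<Longrightarrow> \<omega> (up v (j # ks)) = \<omega>' (up v (j # ks))"
  shows "moved \<omega> n v j = moved \<omega>' n v j"
proof -
  have "agree d (bt_in v j) \<omega> \<omega>'" unfolding agree_def using assms by simp
  note low = agree_lower[OF this]
  have "\<omega> (up v (j # ks)) = \<omega>' (up v (j # ks))" if "lower d \<omega>' n (bt_in v j) ks" for ks
    by (rule assms[OF lower_lists[OF that]])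
  then show ?thesis by (auto simp: moved_def survivors_def low)
qed

text \<open>By \<open>inj_up\<close> the walkers that come through different in-edges start in
  disjoint branches. The branches are split off one by one.\<close>

lemma nn_integral_power_arrivals:
  assumes v: "v \<in> V" and s: "0 \<le> s"
  shows "(\<integral>\<^sup>+\<omega>. ennreal (s ^ card (arrivals \<omega> n v)) \<partial>M) =
    (\<Prod>j<d. \<integral>\<^sup>+\<omega>. ennreal (s ^ card (moved \<omega> n v j)) \<partial>M)"
proof -
  let ?f = "\<lambda>j \<omega>. ennreal (s ^ card (moved \<omega> n v j))"
  have f_meas: "?f j \<in> borel_measurable M" if "j < d" for j
    using measurable_card_moved[OF v that, of n] by measurable
  have "(\<integral>\<^sup>+\<omega>. (\<Prod>j<m. ?f j \<omega>) \<partial>M) = (\<Prod>j<m. \<integral>\<^sup>+\<omega>. ?f j \<omega> \<partial>M)" if "m \<le> d" for m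
    using that
  proof (induction m)
    case (Suc m)
    have "(\<integral>\<^sup>+\<omega>. (\<Prod>j<m. ?f j \<omega>) * ?f m \<omega> \<partial>M) = (\<integral>\<^sup>+\<omega>. (\<Prod>j<m. ?f j \<omega>) \<partial>M) * (\<integral>\<^sup>+\<omega>. ?f m \<omega> \<partial>M)"
    proof (rule nn_integral_mult_M[where J = "- {up v (m # ks) |ks. ks \<in> L}"])
      show "(\<lambda>\<omega>. \<Prod>j<m. ?f j \<omega>) \<in> borel_measurable M" "?f m \<in> borel_measurable M"
        using Suc.prems by (intro borel_measurable_prod_ennreal f_meas, simp)+
      show "?f m \<omega> = ?f m \<omega>'" if "\<And>i. i \<notin> - {up v (m # ks) |ks. ks \<in> L} \<Longrightarrow> \<omega> i = \<omega>' i" for \<omega> \<omega>'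
        using that by (subst moved_cong[of \<omega> v m \<omega>']) blast+
      show "(\<Prod>j<m. ?f j \<omega>) = (\<Prod>j<m. ?f j \<omega>')"
        if "\<And>i. i \<in> - {up v (m # ks) |ks. ks \<in> L} \<Longrightarrow> \<omega> i = \<omega>' i" for \<omega> \<omega>'
      proof (rule prod.cong[OF refl])
        fix j assume "j \<in> {..<m}"
        then have "up v (j # ks) \<notin> {up v (m # ks) |ks. ks \<in> L}" for ks
          using inj_up[of v "j # ks"] by blast
        then have "moved \<omega> n v j = moved \<omega>' n v j" using that by (intro moved_cong) blast
        then show "?f j \<omega> = ?f j \<omega>'" by simp
      qed
    qed
    with Suc show ?case by (simp add: ac_simps)
  qed (simp add: M.emeasure_space_1)
  from this[OF order_refl] show ?thesis
    using s by (simp add: card_arrivals power_sum prod_ennreal)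
qed

lemma nn_integral_is_A:
  assumes v: "v \<in> V"
  shows "(\<integral>\<^sup>+\<omega>. (if is_A (\<omega> v) then 1 else 0) \<partial>M) = ennreal p"
    "(\<integral>\<^sup>+\<omega>. (if is_A (\<omega> v) then 0 else 1) \<partial>M) = ennreal (1 - p)"
proof -
  have *: "(\<integral>\<^sup>+\<omega>. h (is_A (\<omega> v)) \<partial>M) = (\<integral>\<^sup>+a. h a \<partial>bernoulli_pmf p)" for h :: "bool \<Rightarrow> ennreal"
  proof -
    let ?R = "gaps_measure \<Otimes>\<^sub>M steps_measure d \<Otimes>\<^sub>M uniform_measure lborel {0..1::real}"
    interpret R: prob_space ?R
      by (intro prob_space_pair prob_space_gaps prob_space_steps prob_space_mark)
    interpret PM: prob_space "particle_measure d p" by (rule prob_space_particle_measure)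
    have h: "(\<lambda>x. h (is_A x)) \<in> borel_measurable (particle_measure d p)" by measurable
    have "(\<integral>\<^sup>+\<omega>. h (is_A (\<omega> v)) \<partial>M) = (\<integral>\<^sup>+\<omega>. (\<integral>\<^sup>+y. h (is_A (((\<omega>)(v := y)) v)) \<partial>particle_measure d p) \<partial>M)"
      unfolding M_PiM
      by (rule nn_integral_resample_PiM)
        (use v in \<open>auto intro: prob_space_particle_measure measurable_compose[OF _ h]\<close>)
    also have "\<dots> = (\<integral>\<^sup>+y. h (is_A y) \<partial>particle_measure d p)" by (simp add: M.emeasure_space_1)
    also have "\<dots> = (\<integral>\<^sup>+a. (\<integral>\<^sup>+r. h (is_A (a, r)) \<partial>?R) \<partial>bernoulli_pmf p)"
      using h unfolding particle_measure_def by (intro R.nn_integral_fst[symmetric])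
    also have "\<dots> = (\<integral>\<^sup>+a. h a \<partial>bernoulli_pmf p)"
      by (simp add: is_A_def R.emeasure_space_1)
    finally show ?thesis .
  qed
  show "(\<integral>\<^sup>+\<omega>. (if is_A (\<omega> v) then 1 else 0) \<partial>M) = ennreal p"
    using p by (subst *[of "\<lambda>a. if a then 1 else 0"]) simp
  show "(\<integral>\<^sup>+\<omega>. (if is_A (\<omega> v) then 0 else 1) \<partial>M) = ennreal (1 - p)"
    using p by (subst *[of "\<lambda>a. if a then 0 else 1"]) simp
qed

text \<open>No directed path returns to \<open>v\<close>, so the type of its own particle is
  independent of the arrivals there.\<close>

lemma nn_integral_survivors_Suc:
  fixes f :: "nat \<Rightarrow> ennreal"
  assumes v: "v \<in> V"
  shows "(\<integral>\<^sup>+\<omega>. f (card (survivors \<omega> (Suc n) v)) \<partial>M) =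
    ennreal p * (\<integral>\<^sup>+\<omega>. f (card (arrivals \<omega> n v) + 1) \<partial>M) +
    ennreal (1 - p) * (\<integral>\<^sup>+\<omega>. f (card (arrivals \<omega> n v) - 1) \<partial>M)"
proof -
  let ?S = "\<lambda>\<omega>. card (arrivals \<omega> n v)"
  note [measurable] = measurable_card_arrivals[OF v, of n] measurable_is_A[OF v]
  have arr: "arrivals \<omega> n v = arrivals \<omega>' n v" if "\<And>i. i \<noteq> v \<Longrightarrow> \<omega> i = \<omega>' i" for \<omega> \<omega>'
  proof -
    have "up v (j # ks) \<noteq> v" for j ks using inj_up[of v "j # ks" "[]"] by auto
    then have "moved \<omega> n v j = moved \<omega>' n v j" for j using that by (intro moved_cong) blast
    then show ?thesis by (simp add: arrivals_eq)
  qed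
  have *: "(\<integral>\<^sup>+\<omega>. h (is_A (\<omega> v)) * g (?S \<omega>) \<partial>M) = (\<integral>\<^sup>+\<omega>. h (is_A (\<omega> v)) \<partial>M) * (\<integral>\<^sup>+\<omega>. g (?S \<omega>) \<partial>M)"
    for h :: "bool \<Rightarrow> ennreal" and g :: "nat \<Rightarrow> ennreal"
  proof (rule nn_integral_mult_M[where J = "{v}"])
    show "(\<lambda>\<omega>. h (is_A (\<omega> v))) \<in> borel_measurable M" "(\<lambda>\<omega>. g (?S \<omega>)) \<in> borel_measurable M"
      by measurable
    show "h (is_A (\<omega> v)) = h (is_A (\<omega>' v))" if "\<And>i. i \<in> {v} \<Longrightarrow> \<omega> i = \<omega>' i" for \<omega> \<omega>'
      using that[of v] by simp
    show "g (?S \<omega>) = g (?S \<omega>')" if "\<And>i. i \<notin> {v} \<Longrightarrow> \<omega> i = \<omega>' i" for \<omega> \<omega>'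
      using arr[of \<omega> \<omega>'] that by simp
  qed
  have "(\<integral>\<^sup>+\<omega>. f (card (survivors \<omega> (Suc n) v)) \<partial>M) =
      (\<integral>\<^sup>+\<omega>. (if is_A (\<omega> v) then 1 else 0) * f (?S \<omega> + 1) + (if is_A (\<omega> v) then 0 else 1) * f (?S \<omega> - 1) \<partial>M)"
    using AE_inj_arrival[OF v] by (intro nn_integral_cong_AE, eventually_elim) (simp add: card_survivors_Suc)
  also have "\<dots> = (\<integral>\<^sup>+\<omega>. (if is_A (\<omega> v) then 1 else 0) * f (?S \<omega> + 1) \<partial>M) +
      (\<integral>\<^sup>+\<omega>. (if is_A (\<omega> v) then 0 else 1) * f (?S \<omega> - 1) \<partial>M)"
    by (intro nn_integral_add) measurable
  also have "\<dots> = ennreal p * (\<integral>\<^sup>+\<omega>. f (?S \<omega> + 1) \<partial>M) + ennreal (1 - p) * (\<integral>\<^sup>+\<omega>. f (?S \<omega> - 1) \<partial>M)"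
    using *[of "\<lambda>a. if a then 1 else 0" "\<lambda>m. f (m + 1)"] *[of "\<lambda>a. if a then 0 else 1" "\<lambda>m. f (m - 1)"]
    by (simp add: nn_integral_is_A[OF v])
  finally show ?thesis .
qed

end

section \<open>Recursions for the generating function and the mean\<close>

text \<open>\<open>gen_fun d p n s\<close> is the expectation of \<open>s ^ N\<close> for \<open>0 < s \<le> 1\<close>, where \<open>N\<close> counts the surviving
  visitors in the system truncated at depth \<open>n\<close>; for \<open>s = 0\<close> the recursion divides by zero.\<close>

primrec gen_fun :: "nat \<Rightarrow> real \<Rightarrow> nat \<Rightarrow> real \<Rightarrow> real" where
  "gen_fun d p 0 s = 1"
| "gen_fun d p (Suc n) s = p * (s * gen_fun d p n (1 - (1 - s) / real d) ^ d) +
     (1 - p) * ((gen_fun d p n (1 - (1 - s) / real d) ^ d - gen_fun d p n (1 - 1 / real d) ^ d) / s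
       + gen_fun d p n (1 - 1 / real d) ^ d)"

text \<open>The recursion in drift form. Thinning and summing \<open>d\<close> copies keep the mean;
  then one visitor is added with probability \<open>p\<close> or removed with probability
  \<open>1 - p\<close>, the latter only if someone arrives. The last factor is the probability that
  nobody does.\<close>

primrec mean_fun :: "nat \<Rightarrow> real \<Rightarrow> nat \<Rightarrow> real" where
  "mean_fun d p 0 = 0"
| "mean_fun d p (Suc n) = mean_fun d p n - (1 - 2 * p) + (1 - p) * gen_fun d p n (1 - 1 / real d) ^ d"

context dlas_tree
begin

lemma survivors_0: "survivors \<omega> 0 v = {}"
  by (simp add: survivors_def lower_simps)

text \<open>For \<open>d \<ge> 2\<close> a thinned argument is at least 1/2, so even the probability
  of no arrival, which belongs to \<open>s = 0\<close>, calls \<open>gen_fun\<close> only at a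
  positive argument.\<close>

lemma thinned_range:
  assumes "0 \<le> s" "s \<le> 1"
  shows "0 < 1 - (1 - s) / real d" "1 - (1 - s) / real d \<le> 1"
proof -
  have "(1 - s) / real d \<le> 1 / 2" using assms d by (intro frac_le) auto
  then show "0 < 1 - (1 - s) / real d" by linarith
  show "1 - (1 - s) / real d \<le> 1" using assms by simp
qed

lemma nn_integral_arrivals_of_survivors:
  assumes "v \<in> V" "0 \<le> s" "s \<le> 1" "0 \<le> x"
    and "\<And>w. w \<in> V \<Longrightarrow> (\<integral>\<^sup>+\<omega>. ennreal ((1 - (1 - s) / real d) ^ card (survivors \<omega> n w)) \<partial>M) = ennreal x"
  shows "(\<integral>\<^sup>+\<omega>. ennreal (s ^ card (arrivals \<omega> n v)) \<partial>M) = ennreal (x ^ d)"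
proof -
  have "(\<integral>\<^sup>+\<omega>. ennreal (s ^ card (moved \<omega> n v j)) \<partial>M) = ennreal x" if "j < d" for j
    using nn_integral_thin[OF assms(1) that assms(2,3)] assms(5) bt_in_in_verts[OF assms(1) that] by simp
  then have "(\<integral>\<^sup>+\<omega>. ennreal (s ^ card (arrivals \<omega> n v)) \<partial>M) = (\<Prod>j<d. ennreal x)"
    unfolding nn_integral_power_arrivals[OF assms(1,2)] by (intro prod.cong) auto
  then show ?thesis using assms(4) by (simp add: ennreal_power)
qed

lemma gen_fun_correct:
  "0 < s \<Longrightarrow> s \<le> 1 \<Longrightarrow> 0 \<le> gen_fun d p n s \<and>
    (\<forall>v\<in>V. (\<integral>\<^sup>+\<omega>. ennreal (s ^ card (survivors \<omega> n v)) \<partial>M) = ennreal (gen_fun d p n s))"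
proof (induction n arbitrary: s)
  case 0
  then show ?case by (simp add: survivors_0 M.emeasure_space_1)
next
  case (Suc n)
  let ?S = "\<lambda>v \<omega>. card (arrivals \<omega> n v)"
  define g where "g = gen_fun d p n (1 - (1 - s) / real d) ^ d"
  define g0 where "g0 = gen_fun d p n (1 - 1 / real d) ^ d"
  note s = thinned_range[of s] and z = thinned_range[of 0]
  have g: "0 \<le> g" "0 \<le> g0" using Suc s z by (simp_all add: g_def g0_def)
  have G: "(\<integral>\<^sup>+\<omega>. ennreal (s ^ ?S v \<omega>) \<partial>M) = ennreal g" if "v \<in> V" for v
    unfolding g_def by (rule nn_integral_arrivals_of_survivors) (use Suc s that in auto)
  have G0: "(\<integral>\<^sup>+\<omega>. ennreal (0 ^ ?S v \<omega>) \<partial>M) = ennreal g0" if "v \<in> V" for v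
    unfolding g0_def by (rule nn_integral_arrivals_of_survivors) (use Suc.IH z that in auto)
  define h where "h = (g - g0) / s + g0"
  have H: "(\<integral>\<^sup>+\<omega>. ennreal (s ^ (?S v \<omega> - 1)) \<partial>M) = ennreal h \<and> 0 \<le> h" if v: "v \<in> V" for v
  proof -
    note [measurable] = measurable_card_arrivals[OF v, of n]
    let ?I = "\<integral>\<^sup>+\<omega>. ennreal (s ^ (?S v \<omega> - 1)) \<partial>M"
    have "?I \<le> (\<integral>\<^sup>+\<omega>. 1 \<partial>M)"
      using Suc.prems by (intro nn_integral_mono) (auto simp: power_le_one)
    then have "?I \<le> ennreal 1" by (simp add: M.emeasure_space_1)
    then obtain r where r: "0 \<le> r" "?I = ennreal r" by (rule ennreal_le_ennrealE)
    \<comment> \<open>\<open>0 ^ S\<close> is the indicator of \<open>S = 0\<close>. Putting it on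
      both sides gives an identity valid for all \<open>S\<close> and avoids subtraction in
      \<open>ennreal\<close>.\<close>
    have "(\<integral>\<^sup>+\<omega>. ennreal (s ^ (?S v \<omega> - 1)) + ennreal (1 / s) * ennreal (0 ^ ?S v \<omega>) \<partial>M) =
        (\<integral>\<^sup>+\<omega>. ennreal (1 / s) * ennreal (s ^ ?S v \<omega>) + ennreal (0 ^ ?S v \<omega>) \<partial>M)"
    proof (intro nn_integral_cong)
      fix \<omega>
      have "s ^ (m - 1) + 1 / s * 0 ^ m = 1 / s * s ^ m + 0 ^ m" for m :: nat
        using Suc.prems by (cases m) auto
      then show "ennreal (s ^ (?S v \<omega> - 1)) + ennreal (1 / s) * ennreal (0 ^ ?S v \<omega>) =
        ennreal (1 / s) * ennreal (s ^ ?S v \<omega>) + ennreal (0 ^ ?S v \<omega>)"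
        using Suc.prems by (simp add: ennreal_mult[symmetric] ennreal_plus[symmetric] del: ennreal_plus)
    qed
    then have "?I + ennreal (1 / s) * ennreal g0 = ennreal (1 / s) * ennreal g + ennreal g0"
      by (simp add: nn_integral_add nn_integral_cmult G[OF v] G0[OF v])
    then have "ennreal r + ennreal (1 / s * g0) = ennreal (1 / s * g) + ennreal g0"
      unfolding r(2) using ennreal_mult[of "1 / s" g0] ennreal_mult[of "1 / s" g] Suc.prems g by simp
    then have "ennreal (r + 1 / s * g0) = ennreal (1 / s * g + g0)"
      using Suc.prems r g by (subst (1 2) ennreal_plus) auto
    then have "r + 1 / s * g0 = 1 / s * g + g0"
      using Suc.prems r g by (subst (asm) ennreal_inj) auto
    then have "r = h" by (simp add: h_def diff_divide_distrib)
    with r show ?thesis by simp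
  qed
  have "0 \<le> h" using H[of "[]"] by (simp add: bt_verts_def)
  have eq: "gen_fun d p (Suc n) s = p * (s * g) + (1 - p) * h"
    by (simp add: g_def g0_def h_def)
  have "(\<integral>\<^sup>+\<omega>. ennreal (s ^ card (survivors \<omega> (Suc n) v)) \<partial>M) = ennreal (p * (s * g) + (1 - p) * h)"
    if v: "v \<in> V" for v
  proof -
    note [measurable] = measurable_card_arrivals[OF v, of n]
    have "(\<integral>\<^sup>+\<omega>. ennreal (s ^ (?S v \<omega> + 1)) \<partial>M) = (\<integral>\<^sup>+\<omega>. ennreal s * ennreal (s ^ ?S v \<omega>) \<partial>M)"
      using Suc.prems by (intro nn_integral_cong) (simp add: ennreal_mult)
    also have "\<dots> = ennreal (s * g)"
      using Suc.prems g by (simp add: nn_integral_cmult G[OF v] ennreal_mult)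
    finally have "(\<integral>\<^sup>+\<omega>. ennreal (s ^ card (survivors \<omega> (Suc n) v)) \<partial>M) =
        ennreal p * ennreal (s * g) + ennreal (1 - p) * ennreal h"
      using nn_integral_survivors_Suc[OF v, of "\<lambda>m. ennreal (s ^ m)" n] H[OF v] by (simp only:)
    also have "\<dots> = ennreal (p * (s * g)) + ennreal ((1 - p) * h)"
      using p g \<open>0 \<le> h\<close> Suc.prems by (intro arg_cong2[where f = plus] ennreal_mult[symmetric]) auto
    also have "\<dots> = ennreal (p * (s * g) + (1 - p) * h)"
      using p g \<open>0 \<le> h\<close> Suc.prems by (intro ennreal_plus[symmetric]) auto
    finally show ?thesis .
  qed
  then show ?case unfolding eq using p g \<open>0 \<le> h\<close> Suc.prems by simp
qed

text \<open>Each survivor moves on to \<open>v\<close> with probability \<open>1 / d\<close>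
  whatever happened before; for the mean, linearity does the rest.\<close>

lemma nn_integral_card_arrivals:
  assumes v: "v \<in> V"
  shows "(\<integral>\<^sup>+\<omega>. ennreal (card (arrivals \<omega> n v)) \<partial>M) =
    (\<Sum>j<d. ennreal (1 / real d) * (\<integral>\<^sup>+\<omega>. ennreal (card (survivors \<omega> n (bt_in v j))) \<partial>M))"
proof -
  have moved: "(\<integral>\<^sup>+\<omega>. ennreal (card (moved \<omega> n v j)) \<partial>M) =
      ennreal (1 / real d) * (\<integral>\<^sup>+\<omega>. ennreal (card (survivors \<omega> n (bt_in v j))) \<partial>M)" if j: "j < d" for j
  proof -
    define w where "w = bt_in v j"
    have w: "w \<in> V" unfolding w_def using v j by (intro bt_in_in_verts)
    let ?B = "{ks \<in> L. length ks < n}"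
    let ?f = "\<lambda>ks \<omega>. if lower d \<omega> n w ks then 1 else 0 :: ennreal"
    have f_meas: "?f ks \<in> borel_measurable M" for ks
      using measurable_lower[OF w, of n ks] by measurable
    have count: "ennreal (card {ks \<in> ?B. Q ks}) = (\<Sum>ks\<in>?B. if Q ks then 1 else 0)" for Q
      using sum.inter_filter[OF finite_short[of n], of "\<lambda>_. 1::ennreal" Q]
      by (simp add: ennreal_of_nat_eq_real_of_nat)
    have sets: "moved \<omega> n v j = {ks \<in> ?B. lower d \<omega> n w ks \<and> step (\<omega> (up w ks)) (length ks) = j}"
      "survivors \<omega> n w = {ks \<in> ?B. lower d \<omega> n w ks}" for \<omega>
      using survivors_short[of \<omega> n w] by (auto simp: moved_def w_def survivors_def)
    have one: "(\<integral>\<^sup>+\<omega>. (if lower d \<omega> n w ks \<and> step (\<omega> (up w ks)) (length ks) = j then 1 else 0) \<partial>M) =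
        ennreal (1 / real d) * (\<integral>\<^sup>+\<omega>. ?f ks \<omega> \<partial>M)" if ks: "ks \<in> L" for ks
    proof -
      have u: "up w ks \<in> V" using w ks by (rule up_in_verts)
      have "(\<integral>\<^sup>+\<omega>. (if lower d \<omega> n w ks \<and> step (\<omega> (up w ks)) (length ks) = j then 1 else 0) \<partial>M) =
          (\<integral>\<^sup>+\<omega>. ?f ks \<omega> * (if step (\<omega> (up w ks)) (length ks) = j then 1 else 0) \<partial>M)"
        by (intro nn_integral_cong) auto
      also have "\<dots> = (\<integral>\<^sup>+\<omega>. ?f ks \<omega> * ennreal (1 / real d) \<partial>M)"
        by (subst nn_integral_step[OF u f_meas _ j])
          (simp_all only: agree_lower[OF agree_upd_step[OF order_refl]] mult_1_right mult_zero_right add_0_right)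
      also have "\<dots> = (\<integral>\<^sup>+\<omega>. ?f ks \<omega> \<partial>M) * ennreal (1 / real d)"
        by (rule nn_integral_multc[OF f_meas])
      finally show ?thesis by (simp only: mult.commute)
    qed
    have "(\<integral>\<^sup>+\<omega>. ennreal (card (moved \<omega> n v j)) \<partial>M) =
        (\<Sum>ks\<in>?B. \<integral>\<^sup>+\<omega>. (if lower d \<omega> n w ks \<and> step (\<omega> (up w ks)) (length ks) = j then 1 else 0) \<partial>M)"
      unfolding sets count
    proof (rule nn_integral_sum)
      fix ks assume "ks \<in> ?B"
      then show "(\<lambda>\<omega>. if lower d \<omega> n w ks \<and> step (\<omega> (up w ks)) (length ks) = j then 1 else 0 :: ennreal)
          \<in> borel_measurable M"
        using measurable_lower[OF w, of n ks] pred_step_eq[OF up_in_verts[OF w], of ks "length ks" j]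
        by (intro measurable_If) (auto simp: pred_def)
    qed
    also have "\<dots> = (\<Sum>ks\<in>?B. ennreal (1 / real d) * (\<integral>\<^sup>+\<omega>. ?f ks \<omega> \<partial>M))"
      by (intro sum.cong one) auto
    also have "\<dots> = ennreal (1 / real d) * (\<integral>\<^sup>+\<omega>. ennreal (card (survivors \<omega> n w)) \<partial>M)"
      unfolding sets count by (subst nn_integral_sum) (simp_all add: f_meas sum_distrib_left)
    finally show ?thesis by (simp add: w_def)
  qed
  have "(\<integral>\<^sup>+\<omega>. ennreal (card (arrivals \<omega> n v)) \<partial>M) = (\<integral>\<^sup>+\<omega>. (\<Sum>j<d. ennreal (card (moved \<omega> n v j))) \<partial>M)"
    by (simp add: card_arrivals)
  also have "\<dots> = (\<Sum>j<d. \<integral>\<^sup>+\<omega>. ennreal (card (moved \<omega> n v j)) \<partial>M)"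
  proof (rule nn_integral_sum)
    fix j assume "j \<in> {..<d}"
    then show "(\<lambda>\<omega>. ennreal (card (moved \<omega> n v j))) \<in> borel_measurable M"
      using measurable_card_moved[OF v, of j n] by simp
  qed
  finally show ?thesis by (simp add: moved)
qed

lemma mean_fun_correct:
  "0 \<le> mean_fun d p n \<and> (\<forall>v\<in>V. (\<integral>\<^sup>+\<omega>. ennreal (card (survivors \<omega> n v)) \<partial>M) = ennreal (mean_fun d p n))"
proof (induction n)
  case 0
  then show ?case by (simp add: survivors_0)
next
  case (Suc n)
  let ?S = "\<lambda>v \<omega>. card (arrivals \<omega> n v)" and ?m = "mean_fun d p n"
  define g0 where "g0 = gen_fun d p n (1 - 1 / real d) ^ d"
  note z = thinned_range[of 0]
  have g0: "0 \<le> g0" using gen_fun_correct[of "1 - 1 / real d" n] z by (simp add: g0_def)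
  have G0: "(\<integral>\<^sup>+\<omega>. ennreal (0 ^ ?S v \<omega>) \<partial>M) = ennreal g0" if "v \<in> V" for v
    unfolding g0_def by (rule nn_integral_arrivals_of_survivors) (use gen_fun_correct z that in auto)
  have S: "(\<integral>\<^sup>+\<omega>. ennreal (?S v \<omega>) \<partial>M) = ennreal ?m" if v: "v \<in> V" for v
  proof -
    have "(\<integral>\<^sup>+\<omega>. ennreal (?S v \<omega>) \<partial>M) = (\<Sum>j<d. ennreal (1 / real d) * ennreal ?m)"
      unfolding nn_integral_card_arrivals[OF v] using Suc bt_in_in_verts[OF v] by (intro sum.cong) auto
    also have "\<dots> = (\<Sum>j<d. ennreal (1 / real d * ?m))"
      using Suc by (intro sum.cong refl ennreal_mult[symmetric]) auto
    also have "\<dots> = ennreal ?m"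
      using Suc d by (subst sum_ennreal) auto
    finally show ?thesis .
  qed
  define h where "h = ?m - 1 + g0"
  have H: "(\<integral>\<^sup>+\<omega>. ennreal (real (?S v \<omega> - 1)) \<partial>M) = ennreal h \<and> 0 \<le> h" if v: "v \<in> V" for v
  proof -
    note [measurable] = measurable_card_arrivals[OF v, of n]
    let ?I = "\<integral>\<^sup>+\<omega>. ennreal (real (?S v \<omega> - 1)) \<partial>M"
    have "?I \<le> (\<integral>\<^sup>+\<omega>. ennreal (?S v \<omega>) \<partial>M)"
      by (intro nn_integral_mono ennreal_leI) simp
    then obtain r where r: "0 \<le> r" "?I = ennreal r" unfolding S[OF v] by (rule ennreal_le_ennrealE)
    \<comment> \<open>\<open>(S - 1) + 1\<close> exceeds \<open>S\<close> exactly when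
      \<open>S = 0\<close>; this is how the probability of no arrival enters the mean.\<close>
    have "(\<integral>\<^sup>+\<omega>. ennreal (real (?S v \<omega> - 1)) + 1 \<partial>M) = (\<integral>\<^sup>+\<omega>. ennreal (?S v \<omega>) + ennreal (0 ^ ?S v \<omega>) \<partial>M)"
    proof (intro nn_integral_cong)
      fix \<omega>
      have "real (m - 1) + 1 = real m + 0 ^ m" for m :: nat by (cases m) auto
      then show "ennreal (real (?S v \<omega> - 1)) + 1 = ennreal (?S v \<omega>) + ennreal (0 ^ ?S v \<omega>)"
        by (simp add: ennreal_plus[symmetric] flip: ennreal_1 del: ennreal_plus)
    qed
    then have "?I + 1 = ennreal ?m + ennreal g0"
      by (simp add: nn_integral_add S[OF v] G0[OF v] M.emeasure_space_1)
    then have "ennreal r + ennreal 1 = ennreal ?m + ennreal g0" unfolding r(2) by simp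
    then have "ennreal (r + 1) = ennreal (?m + g0)"
      using Suc r g0 by (subst (1 2) ennreal_plus) auto
    then have "r + 1 = ?m + g0" using Suc r g0 by (subst (asm) ennreal_inj) auto
    then have "r = h" by (simp add: h_def)
    with r show ?thesis by simp
  qed
  have h: "0 \<le> h" using H[of "[]"] by (simp add: bt_verts_def)
  have eq: "mean_fun d p (Suc n) = p * (?m + 1) + (1 - p) * h"
    by (simp add: g0_def h_def algebra_simps)
  have "(\<integral>\<^sup>+\<omega>. ennreal (card (survivors \<omega> (Suc n) v)) \<partial>M) = ennreal (p * (?m + 1) + (1 - p) * h)"
    if v: "v \<in> V" for v
  proof -
    note [measurable] = measurable_card_arrivals[OF v, of n]
    have "(\<integral>\<^sup>+\<omega>. ennreal (real (?S v \<omega> + 1)) \<partial>M) = (\<integral>\<^sup>+\<omega>. ennreal (?S v \<omega>) + 1 \<partial>M)"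
      by (intro nn_integral_cong) (simp add: ennreal_plus add.commute)
    also have "\<dots> = ennreal (?m + 1)"
      using Suc by (simp add: nn_integral_add S[OF v] M.emeasure_space_1 ennreal_plus)
    finally have "(\<integral>\<^sup>+\<omega>. ennreal (card (survivors \<omega> (Suc n) v)) \<partial>M) =
        ennreal p * ennreal (?m + 1) + ennreal (1 - p) * ennreal h"
      using nn_integral_survivors_Suc[OF v, of "\<lambda>m. ennreal (real m)" n] H[OF v] by (simp only:)
    also have "\<dots> = ennreal (p * (?m + 1)) + ennreal ((1 - p) * h)"
      using p h Suc by (intro arg_cong2[where f = plus] ennreal_mult[symmetric]) auto
    also have "\<dots> = ennreal (p * (?m + 1) + (1 - p) * h)"
      using p h Suc by (intro ennreal_plus[symmetric]) auto
    finally show ?thesis .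
  qed
  then show ?case unfolding eq using p h Suc by simp
qed

end

section \<open>Analysis of the recursion\<close>

text \<open>Thinning turns the exponent \<open>2 x\<^sup>2\<close> into \<open>d (2 (x / d)\<^sup>2) \<le> x\<^sup>2\<close>, which leaves room for the
  factor \<open>exp (x\<^sup>2)\<close> produced by adding or removing one particle.\<close>

lemma gen_fun_le_exp:
  assumes d: "2 \<le> d" and p: "0 \<le> p" "p \<le> 1/2"
    and nonneg: "\<And>n s. 0 < s \<Longrightarrow> s \<le> 1 \<Longrightarrow> 0 \<le> gen_fun d p n s"
    and le1: "\<And>n s. 0 < s \<Longrightarrow> s \<le> 1 \<Longrightarrow> gen_fun d p n s \<le> 1"
    and mono: "\<And>n. mean_fun d p n \<le> mean_fun d p (Suc n)"
    and x: "0 \<le> x" "x \<le> 1/2"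
  shows "gen_fun d p n (1 - x) \<le> exp (- mean_fun d p n * x + 2 * x\<^sup>2)"
  using x
proof (induction n arbitrary: x)
  case (Suc n)
  note x = Suc.prems
  define m where "m = mean_fun d p n"
  define g where "g = gen_fun d p n (1 - x / real d) ^ d"
  define g0 where "g0 = gen_fun d p n (1 - 1 / real d) ^ d"
  \<comment> \<open>The increment of the mean, nonnegative by \<open>mono\<close>.\<close>
  define \<delta> where "\<delta> = (1 - p) * g0 - (1 - 2 * p)"
  have \<delta>: "0 \<le> \<delta>" using mono[of n] by (simp add: \<delta>_def g0_def)
  have m': "mean_fun d p (Suc n) = m + \<delta>" by (simp add: m_def \<delta>_def g0_def)
  have xd: "0 \<le> x / real d" "x / real d \<le> x / 2" using x d divide_left_mono[of 2 "real d" x] by auto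
  have g_nonneg: "0 \<le> g" and g_le1: "g \<le> 1"
    using nonneg[of "1 - x / real d" n] le1[of "1 - x / real d" n] xd x
    by (auto simp: g_def intro: power_le_one)
  have g0_nonneg: "0 \<le> g0"
    using nonneg[of "1 - 1 / real d" n] d by (simp add: g0_def)
  have "gen_fun d p n (1 - x / real d) \<le> exp (- m * (x / real d) + 2 * (x / real d)\<^sup>2)"
    unfolding m_def using xd x by (intro Suc.IH) auto
  then have "g \<le> exp (- m * (x / real d) + 2 * (x / real d)\<^sup>2) ^ d"
    unfolding g_def using nonneg[of "1 - x / real d" n] xd x by (intro power_mono) auto
  also have "\<dots> = exp (real d * (- m * (x / real d) + 2 * (x / real d)\<^sup>2))"
    by (simp add: exp_of_nat_mult)
  also have "real d * (- m * (x / real d) + 2 * (x / real d)\<^sup>2) = - m * x + 2 * (x * (x / real d))"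
    using d by (simp add: field_simps power2_eq_square)
  also have "exp (- m * x + 2 * (x * (x / real d))) \<le> exp (- m * x + x\<^sup>2)"
  proof -
    have "x * (x / 2) * 2 = x\<^sup>2" by (simp add: power2_eq_square)
    with mult_left_mono[OF xd(2) x(1)] have "- m * x + 2 * (x * (x / real d)) \<le> - m * x + x\<^sup>2" by linarith
    then show ?thesis by (simp only: exp_le_cancel_iff)
  qed
  finally have g_le: "g \<le> exp (- m * x + x\<^sup>2)" .
  have pos: "0 < 1 - x" using x by simp
  have "gen_fun d p (Suc n) (1 - x) = p * ((1 - x) * g) + (1 - p) * ((g - g0) / (1 - x) + g0)"
    by (simp add: g_def g0_def)
  \<comment> \<open>The deviation from \<open>g\<close> is isolated, because its part of first order
    in \<open>x\<close> will turn out to be -\<delta>.\<close>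
  also have "\<dots> = g + x / (1 - x) * (g * ((1 - 2 * p) + p * x) - (1 - p) * g0)"
    using pos by (simp add: divide_simps) (simp add: algebra_simps power2_eq_square)
  \<comment> \<open>Replacing \<open>g0\<close> by the smaller \<open>g0 * g\<close> makes
    \<open>g\<close> a common factor.\<close>
  also have "\<dots> \<le> g + x / (1 - x) * (g * ((1 - 2 * p) + p * x) - (1 - p) * (g0 * g))"
  proof -
    have "g0 * g \<le> g0" using g0_nonneg g_le1 by (simp add: mult_left_le)
    then show ?thesis using p x pos by (intro add_left_mono mult_left_mono diff_left_mono) auto
  qed
  also have "\<dots> = g * (1 + x / (1 - x) * (p * x - \<delta>))"
    by (simp add: \<delta>_def algebra_simps)
  also have "\<dots> \<le> g * (1 + (x\<^sup>2 - \<delta> * x))"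
  proof -
    have "x / (1 - x) * (p * x - \<delta>) = (p * x\<^sup>2) / (1 - x) - (\<delta> * x) / (1 - x)"
      by (simp add: algebra_simps diff_divide_distrib power2_eq_square)
    \<comment> \<open>The inequality \<open>p \<le> 1/2 \<le> 1 - x\<close> absorbs the
      denominator.\<close>
    moreover have "(p * x\<^sup>2) / (1 - x) \<le> x\<^sup>2"
    proof -
      have "p * x\<^sup>2 \<le> (1 - x) * x\<^sup>2" using p x by (intro mult_right_mono) auto
      then show ?thesis using pos by (simp add: divide_le_eq mult.commute)
    qed
    moreover have "\<delta> * x \<le> (\<delta> * x) / (1 - x)"
      using mult_left_mono[of "1 - x" 1 "\<delta> * x"] \<delta> x pos by (simp add: le_divide_eq)
    ultimately have "x / (1 - x) * (p * x - \<delta>) \<le> x\<^sup>2 - \<delta> * x" by (simp only: diff_mono)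
    then show ?thesis using g_nonneg by (intro mult_left_mono) auto
  qed
  also have "\<dots> \<le> g * exp (x\<^sup>2 - \<delta> * x)"
    using g_nonneg by (intro mult_left_mono exp_ge_add_one_self)
  also have "\<dots> \<le> exp (- m * x + x\<^sup>2) * exp (x\<^sup>2 - \<delta> * x)"
    using g_le by (intro mult_right_mono) auto
  also have "\<dots> = exp (- mean_fun d p (Suc n) * x + 2 * x\<^sup>2)"
    unfolding m' by (simp add: algebra_simps flip: exp_add)
  finally show ?case .
qed simp

text \<open>Increasing means force the probability of no arrival to be at least
  \<open>1 - 2 * p\<close> at every depth. The exponential bound at \<open>x = 1 / d\<close>, raised
  to the power \<open>d\<close>, bounds the same probability above by
  \<open>exp (1 - m)\<close>.\<close>

lemma mean_fun_le:
  assumes d: "2 \<le> d" and p: "0 \<le> p" "p < 1/2"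
    and nonneg: "\<And>n s. 0 < s \<Longrightarrow> s \<le> 1 \<Longrightarrow> 0 \<le> gen_fun d p n s"
    and le1: "\<And>n s. 0 < s \<Longrightarrow> s \<le> 1 \<Longrightarrow> gen_fun d p n s \<le> 1"
    and mono: "\<And>n. mean_fun d p n \<le> mean_fun d p (Suc n)"
  shows "mean_fun d p n \<le> 1 + ln (inverse (1 - 2 * p))"
proof -
  define m where "m = mean_fun d p n"
  let ?q = "gen_fun d p n (1 - 1 / real d) ^ d"
  have x: "0 \<le> 1 / real d" "1 / real d \<le> 1 / 2" using d by auto
  have "1 - 2 * p \<le> (1 - p) * ?q" using mono[of n] by simp
  also have "\<dots> \<le> 1 * ?q"
    using nonneg[of "1 - 1 / real d" n] d p by (intro mult_right_mono) auto
  also have "1 * ?q \<le> exp (- m * (1 / real d) + 2 * (1 / real d)\<^sup>2) ^ d"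
    using nonneg[of "1 - 1 / real d" n] d gen_fun_le_exp[OF d p(1) _ nonneg le1 mono x, of n] p
    by (simp add: m_def)
  also have "\<dots> = exp (real d * (- m * (1 / real d) + 2 * (1 / real d)\<^sup>2))"
    by (simp add: exp_of_nat_mult)
  also have "real d * (- m * (1 / real d) + 2 * (1 / real d)\<^sup>2) = - m + 2 / real d"
    using d by (simp add: field_simps power2_eq_square)
  also have "exp (- m + 2 / real d) \<le> exp (1 - m)" using d by simp
  finally have "ln (1 - 2 * p) \<le> ln (exp (1 - m))" using p by (subst ln_le_cancel_iff) auto
  then show ?thesis using p by (simp add: m_def ln_inverse)
qed

text \<open>A smaller bound \<open>B\<close> would keep the probability of no arrival so large that
  the means grow by a fixed amount \<open>e\<close> at each depth. The term \<open>ln 2\<close>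
  comes from estimating \<open>1 - p\<close> below by 1/2.\<close>

lemma mean_limit_ge:
  assumes d: "2 \<le> d" and p: "0 \<le> p" "p < 1/2"
    and jensen: "\<And>n. (1 - 1 / real d) powr mean_fun d p n \<le> gen_fun d p n (1 - 1 / real d)"
    and mono: "\<And>n. mean_fun d p n \<le> mean_fun d p (Suc n)"
    and le: "\<And>n. mean_fun d p n \<le> B"
  shows "(ln (inverse (1 - 2 * p)) - ln 2) / 2 \<le> B"
proof (rule ccontr)
  assume "\<not> ?thesis"
  then have B: "2 * B < ln (inverse (1 - 2 * p)) - ln 2" by (simp add: field_simps)
  have B0: "0 \<le> B" using le[of 0] by simp
  define e where "e = (1 - p) * exp (- 2 * B) - (1 - 2 * p)"
  have "ln (2 * (1 - 2 * p)) < - 2 * B" using B p by (subst ln_mult) (auto simp: ln_inverse)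
  then have "2 * (1 - 2 * p) < exp (- 2 * B)" using p by (metis diff_gt_0_iff_gt exp_less_mono exp_ln
    mult_pos_pos zero_less_numeral mult_2 field_sum_of_halves less_divide_eq_numeral1(1) mult.commute)
  then have "1 - 2 * p < 1 / 2 * exp (- 2 * B)" by simp
  also have "\<dots> \<le> (1 - p) * exp (- 2 * B)" using p by (intro mult_right_mono) auto
  finally have e: "0 < e" by (simp add: e_def)
  have step: "mean_fun d p n + e \<le> mean_fun d p (Suc n)" for n
  proof -
    let ?m = "mean_fun d p n"
    have "0 \<le> ?m"
    proof (induction n)
      case (Suc n)
      from Suc mono[of n] show ?case by (rule order_trans)
    qed simp
    \<comment> \<open>The bounds \<open>ln (1 - 1 / d) \<ge> - 1 / (d - 1) \<ge> - 2 / d\<close>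
      turn the power \<open>d\<close> of Jensen's bound into \<open>exp (- 2 * m)\<close>.\<close>
    have "ln (1 - 1 / real d) = - ln (1 + 1 / (real d - 1))"
    proof -
      have "1 - 1 / real d = inverse (1 + 1 / (real d - 1))" using d by (simp add: field_simps)
      then show ?thesis using d by (simp add: ln_inverse)
    qed
    moreover have "ln (1 + 1 / (real d - 1)) \<le> 1 / (real d - 1)"
      using d by (intro ln_add_one_self_le_self) auto
    moreover have "1 / (real d - 1) \<le> 2 / real d" using d by (simp add: field_simps)
    ultimately have l: "- 2 / real d \<le> ln (1 - 1 / real d)" by simp
    have "exp (- 2 * B) \<le> exp (- 2 * ?m)" using le[of n] by simp
    also have "\<dots> = exp (?m * (- 2 / real d)) ^ d"
      using d by (simp flip: exp_of_nat_mult)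
    also have "\<dots> \<le> exp (?m * ln (1 - 1 / real d)) ^ d"
      using mult_left_mono[OF l \<open>0 \<le> ?m\<close>] by (intro power_mono) auto
    also have "exp (?m * ln (1 - 1 / real d)) = (1 - 1 / real d) powr ?m"
      using d by (simp add: powr_def)
    also have "\<dots> ^ d \<le> gen_fun d p n (1 - 1 / real d) ^ d"
      using jensen[of n] by (intro power_mono) auto
    finally have "(1 - p) * exp (- 2 * B) \<le> (1 - p) * gen_fun d p n (1 - 1 / real d) ^ d"
      using p by (intro mult_left_mono) auto
    then show ?thesis by (simp add: e_def)
  qed
  have "real n * e \<le> mean_fun d p n" for n
  proof (induction n)
    case (Suc n)
    then show ?case using step[of n] by (simp add: algebra_simps)
  qed simp
  with le have "real n * e \<le> B" for n by (meson order_trans)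
  moreover obtain n where "B < real n * e" using reals_Archimedean3[OF e] by blast
  ultimately show False by (meson not_less)
qed

lemma nsum_SUP:
  assumes "incseq f"
  shows "nsum A (\<lambda>x. SUP n. f n x) = (SUP n. nsum A (f n))"
  unfolding nsum_def using assms by (rule nn_integral_monotone_convergence_SUP) simp

context dlas_tree
begin

lemma survivors_mono: "v \<in> V \<Longrightarrow> m \<le> n \<Longrightarrow> survivors \<omega> m v \<subseteq> survivors \<omega> n v"
  unfolding survivors_def using lower_mono by blast

section \<open>The expected occupation time\<close>

text \<open>The holding time after a visit has an index that \<open>visits\<close> does not see, so
  it is independent of the visit and contributes its mean 1. The visits are then counted by monotone
  convergence in the depth.\<close>

lemma nn_integral_occupation_time:
  assumes v: "v \<in> V"
  shows "(\<integral>\<^sup>+\<omega>. occupation_time V bt_out 1 0 v \<infinity> \<omega> \<partial>M) = (SUP n. ennreal (mean_fun d p n))"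
proof -
  let ?low = "\<lambda>\<omega> n js. if lower d \<omega> n v js then 1 else 0 :: ennreal"
  let ?vis = "\<lambda>\<omega> js. if visits d \<omega> v js then 1 else 0 :: ennreal"
  have vis_meas: "(\<lambda>\<omega>. ?vis \<omega> js) \<in> borel_measurable M" for js
    using measurable_visits[OF v, of js] by (intro measurable_If) (auto simp: pred_def)
  have visit: "(\<integral>\<^sup>+\<omega>. (if visits d \<omega> v js then ennreal (gap (\<omega> (up v js)) (length js)) else 0) \<partial>M) =
      (\<integral>\<^sup>+\<omega>. ?vis \<omega> js \<partial>M)" if js: "js \<in> L" for js
  proof -
    have u: "up v js \<in> V" using v js by (rule up_in_verts)
    have "(\<integral>\<^sup>+\<omega>. (if visits d \<omega> v js then ennreal (gap (\<omega> (up v js)) (length js)) else 0) \<partial>M) =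
        (\<integral>\<^sup>+\<omega>. ?vis \<omega> js * ennreal (gap (\<omega> (up v js)) (length js)) \<partial>M)"
      by (intro nn_integral_cong) auto
    also have "\<dots> = (\<integral>\<^sup>+\<omega>. ?vis \<omega> js \<partial>M) * 1"
      by (subst nn_integral_gap[OF u vis_meas])
        (simp_all only: agree_visits[OF agree_upd_gap[OF order_refl]] nn_integral_exp_measure_ident, simp)
    finally show ?thesis by simp
  qed
  have SUP: "nsum L (?vis \<omega>) = (SUP n. ennreal (card (survivors \<omega> n v)))" for \<omega>
  proof -
    have inc: "incseq (?low \<omega>)"
      using lower_Suc[OF v] by (intro incseq_SucI) (auto simp: le_fun_def)
    have "?vis \<omega> js = (SUP n. ?low \<omega> n js)" for js
    proof (cases "visits d \<omega> v js")
      case True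
      then obtain n where "lower d \<omega> n v js" by (auto simp: visits_def)
      moreover have "?low \<omega> n js \<le> (SUP n. ?low \<omega> n js)" by (rule SUP_upper) simp
      ultimately have "1 \<le> (SUP n. ?low \<omega> n js)" by simp
      moreover have "(SUP n. ?low \<omega> n js) \<le> 1" by (intro SUP_least) auto
      ultimately show ?thesis using True by (simp add: antisym)
    qed (auto simp: visits_def)
    then have "nsum L (?vis \<omega>) = nsum L (\<lambda>js. SUP n. ?low \<omega> n js)" by simp
    also have "\<dots> = (SUP n. nsum L (?low \<omega> n))" by (rule nsum_SUP[OF inc])
    also have "\<dots> = (SUP n. ennreal (card (survivors \<omega> n v)))"
    proof (intro SUP_cong refl)
      fix n
      have "{js \<in> L. lower d \<omega> n v js} = survivors \<omega> n v"
        using survivors_short[of \<omega> n v] by (auto simp: survivors_def)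
      then show "nsum L (?low \<omega> n) = ennreal (card (survivors \<omega> n v))"
        unfolding nsum_If using finite_survivors
        by (simp add: nsum_def emeasure_count_space_finite ennreal_of_nat_eq_real_of_nat)
    qed
    finally show ?thesis .
  qed
  have "(\<integral>\<^sup>+\<omega>. occupation_time V bt_out 1 0 v \<infinity> \<omega> \<partial>M) =
      (\<integral>\<^sup>+\<omega>. nsum L (\<lambda>js. if visits d \<omega> v js then ennreal (gap (\<omega> (up v js)) (length js)) else 0) \<partial>M)"
    using AE_regular_config
    by (intro nn_integral_cong_AE, eventually_elim) (simp add: regular_config.occupation_time_eq v nsum_def)
  also have "\<dots> = nsum L (\<lambda>js. \<integral>\<^sup>+\<omega>. (if visits d \<omega> v js then ennreal (gap (\<omega> (up v js)) (length js)) else 0) \<partial>M)"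
  proof (intro nsum_nn_integral countable_L)
    fix js assume "js \<in> L"
    then show "(\<lambda>\<omega>. if visits d \<omega> v js then ennreal (gap (\<omega> (up v js)) (length js)) else 0) \<in> borel_measurable M"
      using measurable_visits[OF v, of js] measurable_gap[OF up_in_verts[OF v], of js "length js"]
      by (intro measurable_If) (auto simp: pred_def)
  qed
  also have "\<dots> = nsum L (\<lambda>js. \<integral>\<^sup>+\<omega>. ?vis \<omega> js \<partial>M)"
    by (intro nsum_cong visit)
  also have "\<dots> = (\<integral>\<^sup>+\<omega>. nsum L (?vis \<omega>) \<partial>M)"
    by (intro nsum_nn_integral[symmetric] countable_L vis_meas)
  also have "\<dots> = (SUP n. \<integral>\<^sup>+\<omega>. ennreal (card (survivors \<omega> n v)) \<partial>M)"
    unfolding SUP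
  proof (rule nn_integral_monotone_convergence_SUP)
    show "incseq (\<lambda>n \<omega>. ennreal (card (survivors \<omega> n v)))"
      by (intro incseq_SucI le_funI ennreal_leI of_nat_mono card_mono finite_survivors survivors_mono v) simp
    show "(\<lambda>\<omega>. ennreal (card (survivors \<omega> n v))) \<in> borel_measurable M" for n
      using measurable_card_survivors[OF v, of n] by simp
  qed
  finally show ?thesis using mean_fun_correct v by simp
qed

lemma root_in: "bt_root \<in> V"
  by (simp add: bt_verts_def)

section \<open>Monotone means and Jensen's inequality for the truncated systems\<close>

lemma gen_fun_bounds:
  assumes "0 < s" "s \<le> 1"
  shows "0 \<le> gen_fun d p n s" "gen_fun d p n s \<le> 1"
proof -
  show "0 \<le> gen_fun d p n s" using gen_fun_correct[OF assms] by blast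
  have "ennreal (gen_fun d p n s) = (\<integral>\<^sup>+\<omega>. ennreal (s ^ card (survivors \<omega> n bt_root)) \<partial>M)"
    using gen_fun_correct[OF assms] root_in by simp
  also have "\<dots> \<le> (\<integral>\<^sup>+\<omega>. 1 \<partial>M)"
    using assms by (intro nn_integral_mono) (auto simp: power_le_one)
  finally show "gen_fun d p n s \<le> 1" by (simp add: M.emeasure_space_1)
qed

text \<open>Read through the recursion this says that the drift is nonnegative. It comes from
  pathwise inclusion of the truncated systems.\<close>

lemma mean_fun_mono: "mean_fun d p n \<le> mean_fun d p (Suc n)"
proof -
  have "(\<integral>\<^sup>+\<omega>. ennreal (card (survivors \<omega> n bt_root)) \<partial>M) \<le> (\<integral>\<^sup>+\<omega>. ennreal (card (survivors \<omega> (Suc n) bt_root)) \<partial>M)"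
    by (intro nn_integral_mono ennreal_leI of_nat_mono card_mono finite_survivors survivors_mono root_in) simp
  then have "ennreal (mean_fun d p n) \<le> ennreal (mean_fun d p (Suc n))"
    using mean_fun_correct root_in by (simp del: mean_fun.simps)
  then show ?thesis
    using mean_fun_correct[of "Suc n"] by (simp add: ennreal_le_iff del: mean_fun.simps)
qed

text \<open>Jensen's inequality for the convex map from \<open>k\<close> to \<open>s ^ k\<close>,
  obtained by integrating its tangent at the mean.\<close>

lemma powr_mean_le_gen_fun:
  assumes s: "0 < s" "s \<le> 1"
  shows "s powr mean_fun d p n \<le> gen_fun d p n s"
proof -
  define m where "m = mean_fun d p n"
  define b where "b = - ln s"
  define a where "a = s powr m"
  have m: "0 \<le> m" using mean_fun_correct[of n] by (simp add: m_def)
  have b: "0 \<le> b" using s by (simp add: b_def)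
  have a: "0 \<le> a" by (simp add: a_def)
  note g = gen_fun_bounds(1)[OF s, of n]
  note [measurable] = measurable_card_survivors[OF root_in, of n]
  let ?W = "\<lambda>\<omega>. card (survivors \<omega> n bt_root)"
  \<comment> \<open>The tangent inequality with its linear term moved to the right, so that both
    sides are nonnegative and can be integrated in \<open>ennreal\<close>.\<close>
  have pt: "a * (1 + m * b) \<le> s ^ k + a * b * real k" for k
  proof -
    have "a * (1 + (real k - m) * ln s) \<le> a * exp ((real k - m) * ln s)"
      using a by (intro mult_left_mono exp_ge_add_one_self)
    also have "\<dots> = exp (real k * ln s)"
      using s by (simp add: a_def powr_def algebra_simps flip: exp_add)
    also have "\<dots> = s ^ k" using s by (simp add: exp_of_nat_mult)
    finally show ?thesis by (simp add: b_def algebra_simps)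
  qed
  have "ennreal (a * (1 + m * b)) = (\<integral>\<^sup>+\<omega>. ennreal (a * (1 + m * b)) \<partial>M)"
    by (simp add: M.emeasure_space_1)
  also have "\<dots> \<le> (\<integral>\<^sup>+\<omega>. ennreal (s ^ ?W \<omega>) + ennreal (a * b) * ennreal (?W \<omega>) \<partial>M)"
  proof (intro nn_integral_mono)
    fix \<omega>
    have "ennreal (a * (1 + m * b)) \<le> ennreal (s ^ ?W \<omega> + a * b * real (?W \<omega>))"
      by (intro ennreal_leI pt)
    also have "\<dots> = ennreal (s ^ ?W \<omega>) + ennreal (a * b) * ennreal (?W \<omega>)"
      using a b s by (simp add: ennreal_plus ennreal_mult)
    finally show "ennreal (a * (1 + m * b)) \<le> ennreal (s ^ ?W \<omega>) + ennreal (a * b) * ennreal (?W \<omega>)" .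
  qed
  also have "\<dots> = ennreal (gen_fun d p n s) + ennreal (a * b) * ennreal m"
    using gen_fun_correct[OF s, of n] mean_fun_correct[of n] root_in
    by (simp add: nn_integral_add nn_integral_cmult m_def)
  also have "\<dots> = ennreal (gen_fun d p n s + a * b * m)"
    using a b m g by (simp add: ennreal_plus ennreal_mult)
  finally have "a * (1 + m * b) \<le> gen_fun d p n s + a * b * m"
    using a b m g by (subst (asm) ennreal_le_iff) auto
  then show ?thesis by (simp add: a_def m_def algebra_simps)
qed

end

theorem theorem1p6:
  shows "\<exists>c C \<eta> :: real. 0 < c \<and> 0 < C \<and> 0 < \<eta> \<and>
    (\<forall>(d::nat) (p::real). 2 \<le> d \<and> 1/2 - \<eta> < p \<and> p < 1/2 \<longrightarrow>
      (let EV = (\<integral>\<^sup>+ \<omega>. occupation_time (bt_verts d) bt_out 1 0 bt_root \<infinity> \<omega>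
                   \<partial>dlas_measure d (bt_verts d) p)
       in ennreal (c * ln (inverse (1 - 2 * p))) \<le> EV \<and>
          EV \<le> ennreal (C * ln (inverse (1 - 2 * p)))))"
proof (rule exI[of _ "1/4"], rule exI[of _ 2], rule exI[of _ "1/8"], intro conjI allI impI)
  fix d :: nat and p :: real
  assume "2 \<le> d \<and> 1/2 - 1/8 < p \<and> p < 1/2"
  then have d2: "2 \<le> d" and p_near: "3/8 < p" "p < 1/2" by auto
  interpret dlas_tree d p by unfold_locales (use d2 p_near in auto)
  define r where "r = ln (inverse (1 - 2 * p))"
  \<comment> \<open>From \<open>p > 3/8\<close> one gets \<open>1 - 2 * p < 1/4\<close>. The
    resulting \<open>r \<ge> 2 * ln 2\<close> absorbs the additive constants:
    \<open>1 + r \<le> 2 * r\<close> and \<open>(r - ln 2) / 2 \<ge> r / 4\<close>. This is the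
    origin of the three witnesses.\<close>
  have "ln 4 \<le> r"
    unfolding r_def using p_near by (subst ln_le_cancel_iff) (auto simp: field_simps)
  then have r: "2 * ln 2 \<le> r" using ln_realpow[of 2 2] by simp
  define EV where "EV = (\<integral>\<^sup>+\<omega>. occupation_time V bt_out 1 0 bt_root \<infinity> \<omega> \<partial>dlas_measure d V p)"
  have EV: "EV = (SUP n. ennreal (mean_fun d p n))"
    using nn_integral_occupation_time[OF root_in] by (simp add: EV_def M_def)
  have "EV \<le> ennreal (1 + r)"
    unfolding EV r_def using d2 p_near
    by (intro SUP_least ennreal_leI mean_fun_le gen_fun_bounds mean_fun_mono) auto
  also have "\<dots> \<le> ennreal (2 * r)"
    using r ln2_ge_two_thirds by (intro ennreal_leI) simp
  finally have upper: "EV \<le> ennreal (2 * r)" .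
  then obtain B where B: "0 \<le> B" "EV = ennreal B" by (rule ennreal_le_ennrealE)
  have "mean_fun d p n \<le> B" for n
  proof -
    have "ennreal (mean_fun d p n) \<le> ennreal B"
      unfolding B(2)[symmetric] EV by (rule SUP_upper) simp
    then show ?thesis using B(1) by (simp add: ennreal_le_iff)
  qed
  moreover have z: "0 < 1 - 1 / real d" "1 - 1 / real d \<le> 1" using d2 by auto
  ultimately have "(r - ln 2) / 2 \<le> B"
    unfolding r_def using d2 p_near powr_mean_le_gen_fun[OF z]
    by (intro mean_limit_ge[of d p B] mean_fun_mono) simp_all
  then have "ennreal (1/4 * r) \<le> EV"
    unfolding B(2) using r by (intro ennreal_leI) simp
  with upper show "let EV = (\<integral>\<^sup>+ \<omega>. occupation_time (bt_verts d) bt_out 1 0 bt_root \<infinity> \<omega>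
                   \<partial>dlas_measure d (bt_verts d) p)
       in ennreal (1/4 * ln (inverse (1 - 2 * p))) \<le> EV \<and> EV \<le> ennreal (2 * ln (inverse (1 - 2 * p)))"
    by (simp only: Let_def EV_def r_def)
qed simp_all

end
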